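(* Let $p(z)=az^2+bz+c$ be a quadratic polynomial ($a,b,c\in\mathbb C$, $a\neq0$) and let $\varphi(z)=\overline{z}+p(z)$. Then the spectrum of the Bergman-space Toeplitz operator $T_\varphi$ is $$\sigma(T_\varphi)=\varphi(\partial\mathbb D)\cup\big\{\lambda\in\mathbb C:\ \lambda\notin\varphi(\partial\mathbb D)\text{ and }\mathrm{wind}(\varphi(\partial\mathbb D),\lambda)\neq0\big\},$$ which coincides with the spectrum of the Hardy-space Toeplitz operator with symbol $e^{-i\theta}+p(e^{i\theta})$. Hence $\sigma(T_{\overline{z}+p})$ is connected.
   Context: $\mathbb D$ is the open unit disk, $dA$ normalized area measure on $\mathbb D$, $L^2_a$ the Bergman space of analytic functions in $L^2(\mathbb D,dA)$, $P$ the orthogonal projection onto $L^2_a$, and $T_\varphi f=P(\varphi f)$ for $\varphi\in L^\infty(\mathbb D)$, $f\in L^2_a$. For a closed oriented curve $\Gamma$ and $\lambda\notin\Gamma$, $\mathrm{wind}(\Gamma,\lambda)=\frac{1}{2\pi i}\int_\Gamma\frac{dz}{z-\lambda}$; $\varphi(\partial\mathbb D)$ is the curve $\theta\mapsto\varphi(e^{i\theta})$, $\theta\in[0,2\pi]$. The Hardy-space Toeplitz operator with continuous symbol $\psi$ on $\partial\mathbb D$ is $f\mapsto Q(\psi f)$ on the Hardy space $H^2\subset L^2(\partial\mathbb D)$, where $Q$ is the orthogonal projection of $L^2(\partial\mathbb D)$ onto $H^2$. *)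

theory Defs
  imports "HOL-Complex_Analysis.Complex_Analysis"
begin

text \<open>Elements of L^2_a are represented by functions holomorphic on the open unit disk,
  square integrable w.r.t. area measure, normalised to be 0 outside the disk
  (so that an element is a unique HOL function).\<close>

definition bergman_space :: "(complex \<Rightarrow> complex) set" where
  "bergman_space = {f. f holomorphic_on ball 0 1 \<and> (\<forall>z. z \<notin> ball 0 1 \<longrightarrow> f z = 0) \<and>
      set_integrable lborel (ball 0 1) (\<lambda>z. (cmod (f z))\<^sup>2)}"

definition disk_inner :: "(complex \<Rightarrow> complex) \<Rightarrow> (complex \<Rightarrow> complex) \<Rightarrow> complex" where
  "disk_inner u v = (LINT z:ball 0 1|lborel. u z * cnj (v z)) / complex_of_real pi"

definition disk_norm :: "(complex \<Rightarrow> complex) \<Rightarrow> real" where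
  "disk_norm u = sqrt ((LINT z:ball 0 1|lborel. (cmod (u z))\<^sup>2) / pi)"

definition bergman_proj :: "(complex \<Rightarrow> complex) \<Rightarrow> (complex \<Rightarrow> complex)" where
  "bergman_proj u = (THE g. g \<in> bergman_space \<and>
       (\<forall>h\<in>bergman_space. disk_inner (\<lambda>z. u z - g z) h = 0))"

definition bergman_toeplitz :: "(complex \<Rightarrow> complex) \<Rightarrow> (complex \<Rightarrow> complex) \<Rightarrow> (complex \<Rightarrow> complex)" where
  "bergman_toeplitz \<phi> f = bergman_proj (\<lambda>z. \<phi> z * f z)"

text \<open>Functions on the circle are represented as functions of theta on [0, 2 pi];
  elements of L^2 are identified up to equality almost everywhere.\<close>

definition circle_L2 :: "(real \<Rightarrow> complex) set" where
  "circle_L2 = {f. set_borel_measurable lborel {0..2*pi} f \<and>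
      set_integrable lborel {0..2*pi} (\<lambda>t. (cmod (f t))\<^sup>2)}"

definition fourier_coeff :: "(real \<Rightarrow> complex) \<Rightarrow> int \<Rightarrow> complex" where
  "fourier_coeff f n = (LINT t:{0..2*pi}|lborel. f t * exp (- \<i> * of_int n * of_real t))
      / complex_of_real (2*pi)"

definition hardy_H2 :: "(real \<Rightarrow> complex) set" where
  "hardy_H2 = {f \<in> circle_L2. \<forall>n::int. n < 0 \<longrightarrow> fourier_coeff f n = 0}"

definition circle_inner :: "(real \<Rightarrow> complex) \<Rightarrow> (real \<Rightarrow> complex) \<Rightarrow> complex" where
  "circle_inner u v = (LINT t:{0..2*pi}|lborel. u t * cnj (v t)) / complex_of_real (2*pi)"

definition circle_norm :: "(real \<Rightarrow> complex) \<Rightarrow> real" where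
  "circle_norm u = sqrt ((LINT t:{0..2*pi}|lborel. (cmod (u t))\<^sup>2) / (2*pi))"

definition circle_ae_eq :: "(real \<Rightarrow> complex) \<Rightarrow> (real \<Rightarrow> complex) \<Rightarrow> bool" where
  "circle_ae_eq f g \<longleftrightarrow> (AE t in lborel. t \<in> {0..2*pi} \<longrightarrow> f t = g t)"

text \<open>Szego projection Q (a representative of the class, chosen by SOME).\<close>
definition szego_proj :: "(real \<Rightarrow> complex) \<Rightarrow> (real \<Rightarrow> complex)" where
  "szego_proj u = (SOME g. g \<in> hardy_H2 \<and>
       (\<forall>h\<in>hardy_H2. circle_inner (\<lambda>t. u t - g t) h = 0))"

definition hardy_toeplitz :: "(complex \<Rightarrow> complex) \<Rightarrow> (real \<Rightarrow> complex) \<Rightarrow> (real \<Rightarrow> complex)" where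
  "hardy_toeplitz \<psi> f = szego_proj (\<lambda>t. \<psi> (cis t) * f t)"

definition op_spectrum ::
  "('a \<Rightarrow> complex) set \<Rightarrow> (('a \<Rightarrow> complex) \<Rightarrow> real) \<Rightarrow>
   (('a \<Rightarrow> complex) \<Rightarrow> ('a \<Rightarrow> complex) \<Rightarrow> bool) \<Rightarrow>
   (('a \<Rightarrow> complex) \<Rightarrow> ('a \<Rightarrow> complex)) \<Rightarrow> complex set" where
  "op_spectrum H N eqv T = {w. \<not> (\<exists>S.
      (\<forall>g\<in>H. S g \<in> H) \<and>
      (\<forall>g\<in>H. \<forall>g'\<in>H. eqv g g' \<longrightarrow> eqv (S g) (S g')) \<and>
      (\<exists>C. \<forall>g\<in>H. N (S g) \<le> C * N g) \<and>
      (\<forall>g\<in>H. eqv (\<lambda>x. T (S g) x - w * S g x) g) \<and>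
      (\<forall>f\<in>H. eqv (S (\<lambda>x. T f x - w * f x)) f))}"

end

theory Submission
  imports Defs "HOL-Real_Asymp.Real_Asymp"
    "HOL-Computational_Algebra.Fundamental_Theorem_Algebra"
begin

text \<open>
  Put \<open>p z = a z\<^sup>2 + b z + (c - w)\<close> and \<open>q z = 1 + z p z = a (z - r) (z - s) (z - t)\<close> with
  \<open>|r| \<le> |s| \<le> |t|\<close>. On the unit circle \<open>\<phi> z - w = q z / z\<close>, so \<open>w\<close> lies outside the right-hand side
  of the theorem iff exactly one root of \<open>q\<close> lies in the open disk and none on the circle, i.e. iff
  \<open>|r| < 1 < |s|\<close>; both spectra are compared with this condition.

  On the Hardy space \<open>(T - w) f = (q f - f 0) / z\<close>. If \<open>|r| < 1 < |s|\<close> the inverse is \<open>g \<mapsto> (z g + k) / q\<close>,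
  where the constant \<open>k\<close> cancels the pole at \<open>r\<close>. If all roots lie outside the closed disk, \<open>1 / q\<close> is in
  the kernel; if two lie inside, the constant function 1 is not in the range; if one lies on the circle,
  the operator is not bounded below.

  On the Bergman space \<open>(T - w) f = (q f - f 0) / z - W f\<close>, where \<open>W\<close> multiplies the Taylor coefficients,
  shifted by one, by \<open>1 / (n + 2)\<close> and is therefore compact. The Fredholm alternative reduces
  invertibility for \<open>|r| < 1 < |s|\<close> to injectivity. If \<open>f\<close> is in the kernel, then
  \<open>G z = f 0 + z W f z\<close> solves \<open>q G' + p G = 0\<close>, and a zero of order \<open>n\<close> of \<open>G\<close> at \<open>r\<close> forces
  \<open>n (1 - r/s) (1 - r/t) = -1\<close>. This is impossible, because both factors have positive real part; it is
  the only place where the degree of the polynomial matters.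
\<close>

section \<open>Square integrable functions on the circle\<close>

text \<open>The factor \<open>1 / z\<close> in \<open>q z / z\<close> contributes -1 to the winding
  number, so winding number 0 means exactly one root in the disk. Multiplication by
  \<open>cnj z\<close> followed by the projection is the plain backward shift on the Hardy space,
  but on the Bergman space a shift with weights \<open>(n + 1) / (n + 2)\<close>; the defect
  \<open>1 / (n + 2)\<close> is \<open>W\<close>. The identity for a zero of order \<open>n\<close>
  arises by putting \<open>G = (z - r)^n g\<close> into the differential equation, dividing by
  \<open>(z - r)^n\<close> and evaluating at \<open>r\<close>: \<open>p r + n q'(r) = 0\<close>,
  while \<open>r p(r) = -1\<close> and \<open>a r s t = -1\<close>. \<open>op_spectrum\<close> does
  not require the inverse \<open>S\<close> to be linear; where linearity is used, it is first
  derived from \<open>S\<close> being a two-sided inverse. On the Hardy space the roots enter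
  through two-term recurrences for bounded Fourier coefficients. On the Bergman space Parseval's
  identity leads to a weighted sequence space, where compactness of \<open>W\<close> is a norm
  estimate on functions vanishing to high order at 0 and limits are taken coefficientwise.\<close>

lemma cmod_add_sq_le: "(cmod (x + y))\<^sup>2 \<le> 2 * (cmod x)\<^sup>2 + 2 * (cmod y)\<^sup>2"
proof -
  have "(cmod (x + y))\<^sup>2 \<le> (cmod x + cmod y)\<^sup>2"
    by (intro power_mono norm_triangle_ineq) auto
  also have "\<dots> \<le> 2 * (cmod x)\<^sup>2 + 2 * (cmod y)\<^sup>2"
    using sum_squares_bound[of "cmod x" "cmod y"] by (simp add: power2_sum)
  finally show ?thesis .
qed

lemma norm_mult_cnj_le: "cmod (x * cnj y) \<le> (cmod x)\<^sup>2 + (cmod y)\<^sup>2"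
  using sum_squares_bound[of "cmod x" "cmod y"] mult_nonneg_nonneg[OF norm_ge_zero norm_ge_zero, of x y]
  by (simp only: norm_mult complex_mod_cnj)

lemma set_borel_measurable_cmod_sq:
  assumes "set_borel_measurable lborel A f"
  shows "set_borel_measurable lborel A (\<lambda>t. (cmod (f t))\<^sup>2)"
proof -
  have "(\<lambda>t. (cmod (indicator A t *\<^sub>R f t))\<^sup>2) \<in> borel_measurable lborel"
    using assms unfolding set_borel_measurable_def by measurable
  also have "(\<lambda>t. (cmod (indicator A t *\<^sub>R f t))\<^sup>2) = (\<lambda>t. indicator A t *\<^sub>R ((cmod (f t))\<^sup>2))"
    by (auto simp: indicator_def)
  finally show ?thesis by (simp add: set_borel_measurable_def)
qed

text \<open>Squares keep square roots out of the estimates: \<open>circle_sq_add\<close>, with its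
  factor 2, stands in for the triangle inequality, since only the existence of a bound
  matters.\<close>

definition circle_sq :: "(real \<Rightarrow> complex) \<Rightarrow> real" where
  "circle_sq u = (LINT t:{0..2*pi}|lborel. (cmod (u t))\<^sup>2) / (2*pi)"

lemma circle_norm_sqrt: "circle_norm u = sqrt (circle_sq u)"
  by (simp add: circle_norm_def circle_sq_def)

lemma circle_sq_nonneg: "circle_sq u \<ge> 0"
  unfolding circle_sq_def set_lebesgue_integral_def by (auto intro!: divide_nonneg_pos integral_nonneg)

lemma circle_norm_power2: "(circle_norm u)\<^sup>2 = circle_sq u"
  by (simp add: circle_norm_sqrt circle_sq_nonneg)

lemma circle_L2_mult_continuous:
  assumes "f \<in> circle_L2" "continuous_on {0..2*pi} m"
  shows "(\<lambda>t. m t * f t) \<in> circle_L2"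
proof -
  have mm: "set_borel_measurable lborel {0..2*pi} m"
    using borel_measurable_continuous_on_indicator[OF _ assms(2)]
    by (auto simp: set_borel_measurable_def)
  have fm: "set_borel_measurable lborel {0..2*pi} f"
    using assms by (auto simp: circle_L2_def)
  have "(\<lambda>t. (indicator {0..2*pi} t *\<^sub>R m t) * (indicator {0..2*pi} t *\<^sub>R f t)) \<in> borel_measurable lborel"
    using mm fm unfolding set_borel_measurable_def by (intro borel_measurable_times)
  also have "(\<lambda>t. (indicator {0..2*pi} t *\<^sub>R m t) * (indicator {0..2*pi} t *\<^sub>R f t))
    = (\<lambda>t. indicator {0..2*pi} t *\<^sub>R (m t * f t))"
    by (auto simp: indicator_def)
  finally have meas: "set_borel_measurable lborel {0..2*pi} (\<lambda>t. m t * f t)"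
    by (simp add: set_borel_measurable_def)
  have "compact (m ` {0..2*pi})" using assms(2) compact_continuous_image by blast
  then obtain B where B: "\<And>t. t \<in> {0..2*pi} \<Longrightarrow> cmod (m t) \<le> B"
    by (metis bounded_iff compact_imp_bounded imageI)
  have "set_integrable lborel {0..2*pi} (\<lambda>t. (cmod (m t * f t))\<^sup>2)"
  proof (rule set_integrable_bound)
    show "set_integrable lborel {0..2*pi} (\<lambda>t. B\<^sup>2 * (cmod (f t))\<^sup>2)"
      using assms(1) by (auto simp: circle_L2_def)
    show "set_borel_measurable lborel {0..2*pi} (\<lambda>t. (cmod (m t * f t))\<^sup>2)"
      by (rule set_borel_measurable_cmod_sq[OF meas])
    show "AE x in lborel. x \<in> {0..2*pi} \<longrightarrow> norm ((cmod (m x * f x))\<^sup>2) \<le> norm (B\<^sup>2 * (cmod (f x))\<^sup>2)"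
      using B by (auto simp: norm_mult power_mult_distrib intro!: mult_right_mono power_mono)
  qed
  with meas show ?thesis by (simp add: circle_L2_def)
qed

lemma circle_L2_add:
  assumes "f \<in> circle_L2" "g \<in> circle_L2"
  shows "(\<lambda>t. f t + g t) \<in> circle_L2"
proof -
  have fg: "set_borel_measurable lborel {0..2*pi} f" "set_borel_measurable lborel {0..2*pi} g"
    using assms by (auto simp: circle_L2_def)
  have "(\<lambda>t. (indicator {0..2*pi} t *\<^sub>R f t) + (indicator {0..2*pi} t *\<^sub>R g t)) \<in> borel_measurable lborel"
    using fg unfolding set_borel_measurable_def by (intro borel_measurable_add)
  then have meas: "set_borel_measurable lborel {0..2*pi} (\<lambda>t. f t + g t)"
    by (simp add: set_borel_measurable_def scaleR_add_right)
  have "set_integrable lborel {0..2*pi} (\<lambda>t. (cmod (f t + g t))\<^sup>2)"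
  proof (rule set_integrable_bound)
    show "set_integrable lborel {0..2*pi} (\<lambda>t. 2 * (cmod (f t))\<^sup>2 + 2 * (cmod (g t))\<^sup>2)"
      using assms by (auto simp: circle_L2_def)
    show "set_borel_measurable lborel {0..2*pi} (\<lambda>t. (cmod (f t + g t))\<^sup>2)"
      by (rule set_borel_measurable_cmod_sq[OF meas])
    show "AE x in lborel. x \<in> {0..2*pi} \<longrightarrow> norm ((cmod (f x + g x))\<^sup>2) \<le> norm (2 * (cmod (f x))\<^sup>2 + 2 * (cmod (g x))\<^sup>2)"
      using cmod_add_sq_le by auto
  qed
  with meas show ?thesis by (simp add: circle_L2_def)
qed

lemma circle_L2_cmult: "f \<in> circle_L2 \<Longrightarrow> (\<lambda>t. k * f t) \<in> circle_L2"
  by (rule circle_L2_mult_continuous) auto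

lemma circle_L2_diff:
  assumes "f \<in> circle_L2" "g \<in> circle_L2"
  shows "(\<lambda>t. f t - g t) \<in> circle_L2"
  using circle_L2_add[OF assms(1) circle_L2_cmult[OF assms(2), of "-1"]] by simp

lemma circle_L2_one: "(\<lambda>t. 1) \<in> circle_L2"
  by (auto simp: circle_L2_def set_borel_measurable_def set_integrable_def)

lemma circle_L2_continuous: "continuous_on {0..2*pi} m \<Longrightarrow> m \<in> circle_L2"
  using circle_L2_mult_continuous[OF circle_L2_one] by simp

lemma circle_L2_sq_integrable:
  "f \<in> circle_L2 \<Longrightarrow> set_integrable lborel {0..2*pi} (\<lambda>t. (cmod (f t))\<^sup>2)"
  by (simp add: circle_L2_def)

lemma circle_L2_mult_cnj_integrable:
  assumes "f \<in> circle_L2" "g \<in> circle_L2"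
  shows "set_integrable lborel {0..2*pi} (\<lambda>t. f t * cnj (g t))"
proof (rule set_integrable_bound)
  show "set_integrable lborel {0..2*pi} (\<lambda>t. (cmod (f t))\<^sup>2 + (cmod (g t))\<^sup>2)"
    using assms by (auto simp: circle_L2_def)
  have fg: "set_borel_measurable lborel {0..2*pi} f" "set_borel_measurable lborel {0..2*pi} g"
    using assms by (auto simp: circle_L2_def)
  have "(\<lambda>t. (indicator {0..2*pi} t *\<^sub>R f t) * cnj (indicator {0..2*pi} t *\<^sub>R g t)) \<in> borel_measurable lborel"
    using fg unfolding set_borel_measurable_def 
    by (intro borel_measurable_times measurable_compose[OF _ borel_measurable_continuous_onI[of cnj]])
      (auto intro!: continuous_intros)
  also have "(\<lambda>t. (indicator {0..2*pi} t *\<^sub>R f t) * cnj (indicator {0..2*pi} t *\<^sub>R g t))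
     = (\<lambda>t. indicator {0..2*pi} t *\<^sub>R (f t * cnj (g t)))"
    by (auto simp: indicator_def)
  finally show "set_borel_measurable lborel {0..2*pi} (\<lambda>t. f t * cnj (g t))"
    by (simp add: set_borel_measurable_def)
  show "AE x in lborel. x \<in> {0..2*pi} \<longrightarrow> norm (f x * cnj (g x)) \<le> norm ((cmod (f x))\<^sup>2 + (cmod (g x))\<^sup>2)"
    using norm_mult_cnj_le by auto
qed

lemma circle_L2_exp_integrable:
  assumes "f \<in> circle_L2"
  shows "set_integrable lborel {0..2*pi} (\<lambda>t. f t * exp (- \<i> * of_int n * of_real t))"
proof -
  have "(\<lambda>t. exp (\<i> * of_int n * of_real t)) \<in> circle_L2"
    by (intro circle_L2_continuous continuous_intros)
  from circle_L2_mult_cnj_integrable[OF assms this] show ?thesis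
    by (simp add: exp_cnj)
qed

lemma fourier_coeff_add:
  assumes "f \<in> circle_L2" "g \<in> circle_L2"
  shows "fourier_coeff (\<lambda>t. f t + g t) n = fourier_coeff f n + fourier_coeff g n"
  unfolding fourier_coeff_def distrib_right
  by (subst set_integral_add(2)[OF circle_L2_exp_integrable[OF assms(1)] circle_L2_exp_integrable[OF assms(2)]])
    (rule add_divide_distrib)

lemma fourier_coeff_cmult: "fourier_coeff (\<lambda>t. k * f t) n = k * fourier_coeff f n"
  by (simp add: fourier_coeff_def mult.assoc)

lemma fourier_coeff_diff:
  assumes "f \<in> circle_L2" "g \<in> circle_L2"
  shows "fourier_coeff (\<lambda>t. f t - g t) n = fourier_coeff f n - fourier_coeff g n"
  using fourier_coeff_add[OF assms(1) circle_L2_cmult[OF assms(2), of "-1"]] fourier_coeff_cmult[of "-1" g]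
  by simp

lemma fourier_coeff_shift: "fourier_coeff (\<lambda>t. cis t * f t) n = fourier_coeff f (n - 1)"
proof -
  have "cis t * f t * exp (- \<i> * of_int n * of_real t) = f t * exp (- \<i> * of_int (n - 1) * of_real t)" for t
    by (simp add: cis_conv_exp exp_add[symmetric] exp_diff[symmetric] algebra_simps)
  then show ?thesis by (simp only: fourier_coeff_def)
qed

lemma fourier_coeff_cong_ae:
  assumes "circle_ae_eq f g" "f \<in> circle_L2" "g \<in> circle_L2"
  shows "fourier_coeff f n = fourier_coeff g n"
proof -
  have "(LINT t:{0..2*pi}|lborel. f t * exp (- \<i> * of_int n * of_real t))
     = (LINT t:{0..2*pi}|lborel. g t * exp (- \<i> * of_int n * of_real t))"
    unfolding set_lebesgue_integral_def
  proof (rule integral_cong_AE)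
    show "(\<lambda>x. indicat_real {0..2 * pi} x *\<^sub>R (f x * exp (- \<i> * of_int n * of_real x))) \<in> borel_measurable lborel"
      using circle_L2_exp_integrable[OF assms(2)] by (auto simp: set_integrable_def)
    show "(\<lambda>x. indicat_real {0..2 * pi} x *\<^sub>R (g x * exp (- \<i> * of_int n * of_real x))) \<in> borel_measurable lborel"
      using circle_L2_exp_integrable[OF assms(3)] by (auto simp: set_integrable_def)
    show "AE x in lborel. indicat_real {0..2 * pi} x *\<^sub>R (f x * exp (- \<i> * of_int n * of_real x)) =
         indicat_real {0..2 * pi} x *\<^sub>R (g x * exp (- \<i> * of_int n * of_real x))"
      using assms(1) unfolding circle_ae_eq_def by (rule AE_mp) (auto simp: indicator_def)
  qed
  then show ?thesis by (simp add: fourier_coeff_def)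
qed

lemma circle_sq_cong_ae:
  assumes "circle_ae_eq f g" "f \<in> circle_L2" "g \<in> circle_L2"
  shows "circle_sq f = circle_sq g"
proof -
  have "(LINT t:{0..2*pi}|lborel. (cmod (f t))\<^sup>2) = (LINT t:{0..2*pi}|lborel. (cmod (g t))\<^sup>2)"
    unfolding set_lebesgue_integral_def
  proof (rule integral_cong_AE)
    show "(\<lambda>x. indicat_real {0..2 * pi} x *\<^sub>R (cmod (f x))\<^sup>2) \<in> borel_measurable lborel"
      using circle_L2_sq_integrable[OF assms(2)] by (auto simp: set_integrable_def)
    show "(\<lambda>x. indicat_real {0..2 * pi} x *\<^sub>R (cmod (g x))\<^sup>2) \<in> borel_measurable lborel"
      using circle_L2_sq_integrable[OF assms(3)] by (auto simp: set_integrable_def)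
    show "AE x in lborel. indicat_real {0..2 * pi} x *\<^sub>R (cmod (f x))\<^sup>2 = indicat_real {0..2 * pi} x *\<^sub>R (cmod (g x))\<^sup>2"
      using assms(1) unfolding circle_ae_eq_def by (rule AE_mp) (auto simp: indicator_def)
  qed
  then show ?thesis by (simp add: circle_sq_def)
qed

lemma fourier_coeff_one: "fourier_coeff (\<lambda>t. 1) n = (if n = 0 then 1 else 0)"
proof (cases "n = 0")
  case True
  then show ?thesis by (simp add: fourier_coeff_def set_lebesgue_integral_def scaleR_conv_of_real)
next
  case False
  let ?F = "\<lambda>t. exp (- \<i> * of_int n * of_real t) / (- \<i> * of_int n)"
  have "(LBINT t:{0..2*pi}. exp (- \<i> * of_int n * of_real t)) = ?F (2*pi) - ?F 0"
    unfolding set_lebesgue_integral_def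
  proof (rule integral_FTC_atLeastAtMost)
    fix x :: real
    show "(?F has_vector_derivative exp (- \<i> * of_int n * of_real x)) (at x within {0..2*pi})"
      by (rule has_vector_derivative_real_field[of "\<lambda>z. exp (- \<i> * of_int n * z) / (- \<i> * of_int n)"])
        (use False in \<open>auto intro!: derivative_eq_intros\<close>)
  qed (auto intro!: continuous_intros)
  moreover have "exp (- \<i> * of_int n * of_real (2*pi)) = 1"
    using exp_integer_2pi[of "of_int (-n)"] by (simp add: algebra_simps)
  ultimately show ?thesis using False by (simp add: fourier_coeff_def)
qed

text \<open>Pythagoras for one Fourier mode. It gives Bessel's inequality for a single coefficient,
  and it evaluates the norms of geometric sums exactly, one mode at a time.\<close>

lemma circle_sq_remove_coeff:
  assumes f: "f \<in> circle_L2"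
  shows "circle_sq f = circle_sq (\<lambda>t. f t - fourier_coeff f n * exp (\<i> * of_int n * of_real t)) + (cmod (fourier_coeff f n))\<^sup>2"
proof -
  define k where "k = fourier_coeff f n"
  define e where "e = (\<lambda>t::real. exp (- \<i> * of_int n * of_real t))"
  have e1: "cmod (e t) = 1" for t by (simp add: e_def)
  have int: "set_integrable lborel {0..2*pi} (\<lambda>t. f t * e t)"
    unfolding e_def by (rule circle_L2_exp_integrable[OF f])
  have intk: "set_integrable lborel {0..2*pi} (\<lambda>t. cnj k * (f t * e t))"
    using int by auto
  \<comment> \<open>The unimodular factor \<open>e t\<close> turns the mode into the constant
    \<open>k\<close>, so the square expands as for numbers and the mixed term integrates to a
    Fourier coefficient.\<close>
  have eq: "(cmod (f t - k * exp (\<i> * of_int n * of_real t)))\<^sup>2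
      = (cmod (f t))\<^sup>2 + (cmod k)\<^sup>2 - 2 * Re (cnj k * (f t * e t))" for t
  proof -
    have "(cmod (x - k))\<^sup>2 = (cmod x)\<^sup>2 + (cmod k)\<^sup>2 - 2 * Re (cnj k * x)" for x
      by (simp add: cmod_power2) (simp add: power2_eq_square algebra_simps)
    from this[of "f t * e t"]
    have "(cmod (f t * e t - k))\<^sup>2 = (cmod (f t))\<^sup>2 + (cmod k)\<^sup>2 - 2 * Re (cnj k * (f t * e t))"
      by (simp add: norm_mult e1)
    moreover have "f t * e t - k = (f t - k * exp (\<i> * of_int n * of_real t)) * e t"
      by (simp add: e_def algebra_simps exp_add[symmetric])
    ultimately show ?thesis by (simp add: norm_mult e1)
  qed
  have int2: "set_integrable lborel {0..2*pi} (\<lambda>t. Re (cnj k * (f t * e t)))"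
    using intk unfolding set_integrable_def by (drule_tac integrable_Re) simp
  have int3: "set_integrable lborel {0..2*pi} (\<lambda>t. (cmod k)\<^sup>2)"
    by (simp add: set_integrable_def)
  have "(LINT t:{0..2*pi}|lborel. (cmod (f t - k * exp (\<i> * of_int n * of_real t)))\<^sup>2)
     = (LINT t:{0..2*pi}|lborel. (cmod (f t))\<^sup>2 + (cmod k)\<^sup>2) - (LINT t:{0..2*pi}|lborel. 2 * Re (cnj k * (f t * e t)))"
    unfolding eq using circle_L2_sq_integrable[OF f] int2 int3
    by (intro set_integral_diff(2) set_integral_add(1) set_integrable_mult_right)
  also have "(LINT t:{0..2*pi}|lborel. (cmod (f t))\<^sup>2 + (cmod k)\<^sup>2) = (LINT t:{0..2*pi}|lborel. (cmod (f t))\<^sup>2) + (LINT t:{0..2*pi}|lborel. (cmod k)\<^sup>2)"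
    using circle_L2_sq_integrable[OF f] int3 by (intro set_integral_add(2)) auto
  also have "(LINT t:{0..2*pi}|lborel. 2 * Re (cnj k * (f t * e t))) = 2 * (LINT t:{0..2*pi}|lborel. Re (cnj k * (f t * e t)))"
    by (rule set_integral_mult_right)
  also have "(LINT t:{0..2*pi}|lborel. Re (cnj k * (f t * e t))) = Re (LINT t:{0..2*pi}|lborel. cnj k * (f t * e t))"
    using intk unfolding set_lebesgue_integral_def set_integrable_def
    by (subst integral_Re[symmetric]) (simp_all only: scaleR_complex.simps real_scaleR_def)
  also have "(LINT t:{0..2*pi}|lborel. cnj k * (f t * e t)) = cnj k * (2 * pi * k)"
    by (simp add: k_def fourier_coeff_def e_def)
  also have "Re (cnj k * (2 * pi * k)) = 2 * pi * (cmod k)\<^sup>2"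
    by (simp add: cmod_power2) (simp add: power2_eq_square algebra_simps)
  also have "(LINT t:{0..2*pi}|lborel. (cmod k)\<^sup>2) = 2 * pi * (cmod k)\<^sup>2"
    by (simp add: set_lebesgue_integral_def)
  finally show ?thesis by (simp add: circle_sq_def k_def field_simps)
qed

lemma fourier_coeff_le:
  assumes "f \<in> circle_L2"
  shows "(cmod (fourier_coeff f n))\<^sup>2 \<le> circle_sq f"
  using circle_sq_remove_coeff[OF assms, of n] circle_sq_nonneg by auto

lemma circle_sq_add:
  assumes "f \<in> circle_L2" "g \<in> circle_L2"
  shows "circle_sq (\<lambda>t. f t + g t) \<le> 2 * circle_sq f + 2 * circle_sq g"
proof -
  note i = circle_L2_sq_integrable[OF assms(1)] circle_L2_sq_integrable[OF assms(2)]
     circle_L2_sq_integrable[OF circle_L2_add[OF assms]]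
  have "(LINT t:{0..2*pi}|lborel. (cmod (f t + g t))\<^sup>2)
     \<le> (LINT t:{0..2*pi}|lborel. 2 * (cmod (f t))\<^sup>2 + 2 * (cmod (g t))\<^sup>2)"
    using i cmod_add_sq_le by (intro set_integral_mono) auto
  also have "\<dots> = 2 * (LINT t:{0..2*pi}|lborel. (cmod (f t))\<^sup>2) + 2 * (LINT t:{0..2*pi}|lborel. (cmod (g t))\<^sup>2)"
    using i by (subst set_integral_add(2)) auto
  finally show ?thesis by (simp add: circle_sq_def field_simps)
qed

lemma circle_sq_mult_le:
  assumes f: "f \<in> circle_L2" and m: "continuous_on {0..2*pi} m"
    and B: "\<And>t. t \<in> {0..2*pi} \<Longrightarrow> cmod (m t) \<le> B"
  shows "circle_sq (\<lambda>t. m t * f t) \<le> B\<^sup>2 * circle_sq f"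
proof -
  have "(LINT t:{0..2*pi}|lborel. (cmod (m t * f t))\<^sup>2) \<le> (LINT t:{0..2*pi}|lborel. B\<^sup>2 * (cmod (f t))\<^sup>2)"
    using circle_L2_sq_integrable[OF f] circle_L2_sq_integrable[OF circle_L2_mult_continuous[OF f m]] B
    by (intro set_integral_mono) (auto simp: norm_mult power_mult_distrib intro!: mult_right_mono power_mono)
  then show ?thesis by (simp add: circle_sq_def field_simps)
qed

section \<open>The Hardy space\<close>

lemma hardy_H2_L2: "f \<in> hardy_H2 \<Longrightarrow> f \<in> circle_L2"
  by (simp add: hardy_H2_def)

lemma hardy_H2_add: "f \<in> hardy_H2 \<Longrightarrow> g \<in> hardy_H2 \<Longrightarrow> (\<lambda>t. f t + g t) \<in> hardy_H2"
  by (auto simp: hardy_H2_def circle_L2_add fourier_coeff_add)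

lemma hardy_H2_diff: "f \<in> hardy_H2 \<Longrightarrow> g \<in> hardy_H2 \<Longrightarrow> (\<lambda>t. f t - g t) \<in> hardy_H2"
  by (auto simp: hardy_H2_def circle_L2_diff fourier_coeff_diff)

lemma hardy_H2_cmult: "f \<in> hardy_H2 \<Longrightarrow> (\<lambda>t. k * f t) \<in> hardy_H2"
  by (auto simp: hardy_H2_def circle_L2_cmult fourier_coeff_cmult)

lemma circle_L2_shift: "f \<in> circle_L2 \<Longrightarrow> (\<lambda>t. cis t * f t) \<in> circle_L2"
  by (intro circle_L2_mult_continuous continuous_intros)

lemma hardy_H2_shift: "f \<in> hardy_H2 \<Longrightarrow> (\<lambda>t. cis t * f t) \<in> hardy_H2"
  by (auto simp: hardy_H2_def circle_L2_shift fourier_coeff_shift)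

lemma hardy_H2_one: "(\<lambda>t. 1) \<in> hardy_H2"
  by (auto simp: hardy_H2_def circle_L2_one fourier_coeff_one)

lemma hardy_H2_const: "(\<lambda>t. k) \<in> hardy_H2"
  using hardy_H2_cmult[OF hardy_H2_one, of k] by simp

text \<open>A linear factor acts on Fourier coefficients as a two-term recurrence. Whether
  \<open>r\<close> lies inside or outside the circle decides in which direction bounded solutions
  must decay.\<close>

lemma fourier_coeff_linear_factor:
  assumes "h \<in> circle_L2"
  shows "fourier_coeff (\<lambda>t. (cis t - r) * h t) n = fourier_coeff h (n - 1) - r * fourier_coeff h n"
  using fourier_coeff_diff[OF circle_L2_shift[OF assms] circle_L2_cmult[OF assms, of r], of n]
  by (simp add: fourier_coeff_shift fourier_coeff_cmult algebra_simps)

section \<open>Equality almost everywhere and the Szego projection\<close>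

lemma circle_ae_eq_refl: "circle_ae_eq f f" by (simp add: circle_ae_eq_def)

lemma circle_ae_eq_sym: "circle_ae_eq f g \<Longrightarrow> circle_ae_eq g f"
  unfolding circle_ae_eq_def by (elim AE_mp) auto

lemma circle_ae_eq_trans: "circle_ae_eq f g \<Longrightarrow> circle_ae_eq g h \<Longrightarrow> circle_ae_eq f h"
  unfolding circle_ae_eq_def by (elim AE_mp) auto

lemma circle_ae_eqI: "(\<And>t. f t = g t) \<Longrightarrow> circle_ae_eq f g"
  by (simp add: circle_ae_eq_def)

lemma circle_inner_diff:
  assumes "u \<in> circle_L2" "v \<in> circle_L2" "h \<in> circle_L2"
  shows "circle_inner (\<lambda>t. u t - v t) h = circle_inner u h - circle_inner v h"
  unfolding circle_inner_def left_diff_distrib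
  by (subst set_integral_diff(2)[OF circle_L2_mult_cnj_integrable[OF assms(1,3)] circle_L2_mult_cnj_integrable[OF assms(2,3)]])
    (rule diff_divide_distrib)

lemma circle_inner_self_zero:
  assumes "d \<in> circle_L2" "circle_inner d d = 0"
  shows "circle_ae_eq d (\<lambda>t. 0)"
proof -
  have "(LINT t:{0..2*pi}|lborel. d t * cnj (d t)) = (LINT t:{0..2*pi}|lborel. complex_of_real ((cmod (d t))\<^sup>2))"
    by (simp only: complex_norm_square)
  also have "\<dots> = complex_of_real (LINT t:{0..2*pi}|lborel. (cmod (d t))\<^sup>2)"
    by (rule set_integral_complex_of_real)
  finally have "(LINT t:{0..2*pi}|lborel. (cmod (d t))\<^sup>2) = 0"
    using assms(2) by (simp add: circle_inner_def)
  then have "AE t in lborel. indicat_real {0..2*pi} t *\<^sub>R (cmod (d t))\<^sup>2 = 0"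
    using circle_L2_sq_integrable[OF assms(1)]
    unfolding set_lebesgue_integral_def set_integrable_def
    by (subst (asm) integral_nonneg_eq_0_iff_AE) auto
  then show ?thesis unfolding circle_ae_eq_def
    by (rule AE_mp) (auto simp: indicator_def split: if_splits)
qed

text \<open>The candidate \<open>g\<close> has the defining property, so the chosen representative
  has it too, and the difference of the two is orthogonal to itself. As \<open>szego_proj\<close>
  picks one representative of a class, the conclusion is equality almost everywhere.\<close>

lemma szego_proj_eq:
  assumes u: "u \<in> circle_L2" and g: "g \<in> hardy_H2"
    and orth: "\<And>h. h \<in> hardy_H2 \<Longrightarrow> circle_inner (\<lambda>t. u t - g t) h = 0"
  shows "szego_proj u \<in> hardy_H2" "circle_ae_eq (szego_proj u) g"
proof -
  have "szego_proj u \<in> hardy_H2 \<and> (\<forall>h\<in>hardy_H2. circle_inner (\<lambda>t. u t - szego_proj u t) h = 0)"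
    unfolding szego_proj_def by (rule someI[of _ g]) (use g orth in auto)
  then have g': "szego_proj u \<in> hardy_H2"
    and orth': "\<And>h. h \<in> hardy_H2 \<Longrightarrow> circle_inner (\<lambda>t. u t - szego_proj u t) h = 0" by auto
  define d where "d = (\<lambda>t. szego_proj u t - g t)"
  have d: "d \<in> hardy_H2" unfolding d_def using g' g by (rule hardy_H2_diff)
  have "circle_inner u d - circle_inner g d = 0"
    using orth[OF d] circle_inner_diff[of u g d] u g d by (simp add: hardy_H2_L2)
  moreover have "circle_inner u d - circle_inner (szego_proj u) d = 0"
    using orth'[OF d] circle_inner_diff[of u "szego_proj u" d] u g' d by (simp add: hardy_H2_L2)
  moreover have "circle_inner d d = circle_inner (szego_proj u) d - circle_inner g d"
    using circle_inner_diff[of "szego_proj u" g d] g g' d by (simp add: hardy_H2_L2 d_def)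
  ultimately have "circle_inner d d = 0" by simp
  then have "circle_ae_eq d (\<lambda>t. 0)" using circle_inner_self_zero d hardy_H2_L2 by blast
  then show "circle_ae_eq (szego_proj u) g"
    unfolding circle_ae_eq_def d_def by (elim AE_mp) auto
  show "szego_proj u \<in> hardy_H2" by (rule g')
qed

text \<open>Iteration gives \<open>x 0 = \<rho> ^ n * x n\<close>, a null sequence times a bounded
  one. In the applications \<open>\<rho>\<close> is a root in the disk or the reciprocal of a root
  outside, and the bound is Bessel's inequality.\<close>

lemma bounded_geometric_backward_zero:
  fixes x :: "nat \<Rightarrow> complex"
  assumes "\<And>n. cmod (x n) \<le> B" "\<And>n. x n = \<rho> * x (Suc n)" "cmod \<rho> < 1"
  shows "x 0 = 0"
proof -
  have "x 0 = \<rho> ^ n * x n" for n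
  proof (induction n)
    case (Suc n)
    have "x n = \<rho> * x (Suc n)" by (rule assms(2))
    with Suc show ?case by (metis mult.assoc power_Suc2)
  qed simp
  then have "cmod (x 0) \<le> cmod \<rho> ^ n * B" for n
    by (metis assms(1) mult_left_mono norm_ge_zero norm_mult norm_power zero_le_power)
  moreover have "(\<lambda>n. cmod \<rho> ^ n * B) \<longlonglongrightarrow> 0 * B"
    using assms(3) by (intro tendsto_intros LIMSEQ_power_zero) auto
  ultimately have "cmod (x 0) \<le> 0 * B" by (intro LIMSEQ_le_const) auto
  then show ?thesis by simp
qed

section \<open>Division by linear factors on the circle\<close>

lemma fourier_coeff_norm_le:
  "f \<in> circle_L2 \<Longrightarrow> cmod (fourier_coeff f n) \<le> sqrt (circle_sq f)"
  by (rule real_le_rsqrt) (rule fourier_coeff_le)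

lemma circle_L2_divide_linear:
  assumes "cmod s \<noteq> 1" "f \<in> circle_L2"
  shows "(\<lambda>t. f t / (cis t - s)) \<in> circle_L2"
proof -
  have "cis t - s \<noteq> 0" for t using assms(1) norm_cis[of t] by auto
  then have "(\<lambda>t. (1 / (cis t - s)) * f t) \<in> circle_L2"
    using assms(2) by (intro circle_L2_mult_continuous continuous_intros) auto
  then show ?thesis by simp
qed

text \<open>At negative indices the coefficients of the quotient \<open>h\<close> satisfy
  \<open>h (n - 1) = s * h n\<close>, so a non-zero one would grow geometrically towards minus
  infinity, against their boundedness.\<close>

lemma hardy_H2_divide_outer:
  assumes s: "cmod s > 1" and f: "f \<in> hardy_H2"
  shows "(\<lambda>t. f t / (cis t - s)) \<in> hardy_H2"
proof -
  define h where "h = (\<lambda>t. f t / (cis t - s))"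
  have h: "h \<in> circle_L2" unfolding h_def
    using circle_L2_divide_linear[of s f] s f by (auto simp: hardy_H2_L2)
  have ne: "cis t - s \<noteq> 0" for t using s norm_cis[of t] by auto
  have "(\<lambda>t. (cis t - s) * h t) = f" using ne by (auto simp: h_def)
  then have rec: "fourier_coeff f n = fourier_coeff h (n - 1) - s * fourier_coeff h n" for n
    using fourier_coeff_linear_factor[OF h, of s n] by simp
  have z: "fourier_coeff h (- int m - 1) = 0" for m
  proof -
    define x where "x = (\<lambda>n. fourier_coeff h (- int m - 1 - int n))"
    have "x 0 = 0"
    proof (rule bounded_geometric_backward_zero)
      show "cmod (x n) \<le> sqrt (circle_sq h)" for n unfolding x_def by (rule fourier_coeff_norm_le[OF h])
      show "cmod (1 / s) < 1" using s by (simp add: norm_divide divide_less_eq)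
      fix n
      have "fourier_coeff f (- int m - 1 - int n) = 0" using f by (auto simp: hardy_H2_def)
      with rec[of "- int m - 1 - int n"] have "x (Suc n) = s * x n"
        by (simp add: x_def algebra_simps)
      then show "x n = 1 / s * x (Suc n)" using s by (auto simp: field_simps)
    qed
    then show ?thesis by (simp add: x_def)
  qed
  have "fourier_coeff h n = 0" if "n < 0" for n
    using z[of "nat (- n - 1)"] that by simp
  then show ?thesis using h by (auto simp: hardy_H2_def h_def)
qed

text \<open>On the circle \<open>1 / (z - r) = 1/z + r/z^2 + ...\<close>. The coefficient of index 0
  vanishes by the backward recurrence, and the recurrence at index 0 then gives the value at
  -1.\<close>

lemma fourier_coeff_inverse_linear:
  assumes r: "cmod r < 1"
  shows "fourier_coeff (\<lambda>t. 1 / (cis t - r)) (-1) = 1"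
proof -
  define h where "h = (\<lambda>t. 1 / (cis t - r))"
  have h: "h \<in> circle_L2" unfolding h_def
    using circle_L2_divide_linear[of r "\<lambda>t. 1"] r by (auto simp: circle_L2_one)
  have ne: "cis t - r \<noteq> 0" for t using r norm_cis[of t] by auto
  have "(\<lambda>t. (cis t - r) * h t) = (\<lambda>t. 1)" using ne by (auto simp: h_def)
  then have rec: "fourier_coeff (\<lambda>t. 1) n = fourier_coeff h (n - 1) - r * fourier_coeff h n" for n
    using fourier_coeff_linear_factor[OF h, of r n] by simp
  define x where "x = (\<lambda>n. fourier_coeff h (int n))"
  have "x 0 = 0"
  proof (rule bounded_geometric_backward_zero)
    show "cmod (x n) \<le> sqrt (circle_sq h)" for n unfolding x_def by (rule fourier_coeff_norm_le[OF h])
    show "x n = r * x (Suc n)" for n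
      using rec[of "int n + 1"] by (simp add: x_def fourier_coeff_one add.commute)
  qed (rule r)
  with rec[of 0] show ?thesis by (simp add: x_def fourier_coeff_one h_def)
qed

text \<open>For a root in the disk the recurrence propagates zeros downwards from index -1, so this
  one coefficient is the whole obstruction to divisibility.\<close>

lemma hardy_H2_divide_inner:
  assumes r: "cmod r < 1" and f: "f \<in> hardy_H2"
    and 0: "fourier_coeff (\<lambda>t. f t / (cis t - r)) (-1) = 0"
  shows "(\<lambda>t. f t / (cis t - r)) \<in> hardy_H2"
proof -
  define h where "h = (\<lambda>t. f t / (cis t - r))"
  have h: "h \<in> circle_L2" unfolding h_def
    using circle_L2_divide_linear[of r f] r f by (auto simp: hardy_H2_L2)
  have ne: "cis t - r \<noteq> 0" for t using r norm_cis[of t] by auto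
  have "(\<lambda>t. (cis t - r) * h t) = f" using ne by (auto simp: h_def)
  then have rec: "fourier_coeff f n = fourier_coeff h (n - 1) - r * fourier_coeff h n" for n
    using fourier_coeff_linear_factor[OF h, of r n] by simp
  have z: "fourier_coeff h (- 1 - int m) = 0" for m
  proof (induction m)
    case 0 then show ?case using assms(3) by (simp add: h_def)
  next
    case (Suc m)
    have "fourier_coeff f (- 1 - int m) = 0" using f by (auto simp: hardy_H2_def)
    with rec[of "- 1 - int m"] Suc show ?case by (simp add: algebra_simps)
  qed
  have "fourier_coeff h n = 0" if "n < 0" for n
    using z[of "nat (- 1 - n)"] that by simp
  then show ?thesis using h by (auto simp: hardy_H2_def h_def)
qed

section \<open>The Hardy-space Toeplitz operator\<close>

lemma op_spectrum_notI:
  assumes "\<And>g. g \<in> H \<Longrightarrow> S g \<in> H"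
    and "\<And>g g'. g \<in> H \<Longrightarrow> g' \<in> H \<Longrightarrow> eqv g g' \<Longrightarrow> eqv (S g) (S g')"
    and "\<And>g. g \<in> H \<Longrightarrow> N (S g) \<le> C * N g"
    and "\<And>g. g \<in> H \<Longrightarrow> eqv (\<lambda>x. T (S g) x - w * S g x) g"
    and "\<And>f. f \<in> H \<Longrightarrow> eqv (S (\<lambda>x. T f x - w * f x)) f"
  shows "w \<notin> op_spectrum H N eqv T"
proof -
  have "\<exists>C. \<forall>g\<in>H. N (S g) \<le> C * N g" using assms(3) by blast
  then show ?thesis unfolding op_spectrum_def mem_Collect_eq not_not
    by (intro exI[of _ S] conjI ballI impI)
      (assumption | erule assms(1) assms(4) assms(5) | erule (2) assms(2))+
qed

text \<open>The spectral parameter \<open>w\<close> is fixed, so that \<open>p\<close>,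
  \<open>q\<close> and the roots all belong to one \<open>w\<close>. The roots are unordered here;
  their ordering by modulus enters only in \<open>winding_set_iff\<close> and
  \<open>spectrum_iff\<close>.\<close>

locale toeplitz_symbol =
  fixes a b c w r s t :: complex
  assumes a_nz: "a \<noteq> 0"
    and factor: "\<And>z. 1 + z * (a * z\<^sup>2 + b * z + (c - w)) = a * (z - r) * (z - s) * (z - t)"
begin

definition p :: "complex \<Rightarrow> complex" where "p z = a * z\<^sup>2 + b * z + (c - w)"
definition q :: "complex \<Rightarrow> complex" where "q z = 1 + z * p z"
definition \<phi> :: "complex \<Rightarrow> complex" where "\<phi> z = cnj z + (a * z\<^sup>2 + b * z + c)"

lemma q_factor: "q z = a * (z - r) * (z - s) * (z - t)"
  using factor by (simp add: q_def p_def)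

lemma hardy_p_mult:
  assumes "f \<in> hardy_H2"
  shows "(\<lambda>\<tau>. p (cis \<tau>) * f \<tau>) \<in> hardy_H2"
proof -
  have "(\<lambda>\<tau>. a * (cis \<tau> * (cis \<tau> * f \<tau>)) + b * (cis \<tau> * f \<tau>) + (c - w) * f \<tau>) \<in> hardy_H2"
    using assms by (intro hardy_H2_add hardy_H2_cmult hardy_H2_shift)
  then show ?thesis by (simp add: p_def algebra_simps power2_eq_square)
qed

lemma hardy_q_mult:
  assumes "f \<in> hardy_H2"
  shows "(\<lambda>\<tau>. q (cis \<tau>) * f \<tau>) \<in> hardy_H2"
    "fourier_coeff (\<lambda>\<tau>. q (cis \<tau>) * f \<tau>) 0 = fourier_coeff f 0"
proof -
  note pf = hardy_p_mult[OF assms]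
  have eq: "(\<lambda>\<tau>. q (cis \<tau>) * f \<tau>) = (\<lambda>\<tau>. f \<tau> + cis \<tau> * (p (cis \<tau>) * f \<tau>))"
    by (simp add: q_def algebra_simps)
  show "(\<lambda>\<tau>. q (cis \<tau>) * f \<tau>) \<in> hardy_H2"
    unfolding eq using assms pf by (intro hardy_H2_add hardy_H2_shift)
  have "fourier_coeff (\<lambda>\<tau>. p (cis \<tau>) * f \<tau>) (- 1) = 0"
    using pf by (auto simp: hardy_H2_def)
  then show "fourier_coeff (\<lambda>\<tau>. q (cis \<tau>) * f \<tau>) 0 = fourier_coeff f 0"
    unfolding eq using assms pf
    by (subst fourier_coeff_add) (auto simp: hardy_H2_L2 circle_L2_shift fourier_coeff_shift)
qed

lemma phi_cis: "\<phi> (cis \<tau>) - w = cis (- \<tau>) * q (cis \<tau>)"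
proof -
  have "cis (- \<tau>) * cis \<tau> = 1" by (simp add: cis_mult)
  then show ?thesis unfolding \<phi>_def q_def p_def distrib_left mult.assoc[symmetric] by (simp add: cis_cnj)
qed

text \<open>In \<open>\<phi> f\<close> only the term \<open>cnj z * f\<close> leaves the Hardy
  space, and only through the mode of index -1, whose coefficient is the mean of \<open>f\<close>.
  Subtracting that mode is therefore the projection.\<close>

lemma hardy_toeplitz_shifted:
  assumes f: "f \<in> hardy_H2"
  shows "(\<lambda>\<tau>. hardy_toeplitz \<phi> f \<tau> - w * f \<tau>) \<in> hardy_H2"
    "circle_ae_eq (\<lambda>\<tau>. hardy_toeplitz \<phi> f \<tau> - w * f \<tau>)
       (\<lambda>\<tau>. cis (- \<tau>) * (q (cis \<tau>) * f \<tau> - fourier_coeff f 0))"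
proof -
  define k where "k = fourier_coeff f 0"
  define u where "u = (\<lambda>\<tau>. \<phi> (cis \<tau>) * f \<tau>)"
  define g where "g = (\<lambda>\<tau>. \<phi> (cis \<tau>) * f \<tau> - k * cis (- \<tau>))"
  have uL: "u \<in> circle_L2" unfolding u_def
    using f by (intro circle_L2_mult_continuous) (auto simp: \<phi>_def hardy_H2_L2 intro!: continuous_intros)
  have cL: "(\<lambda>\<tau>. k * cis (- \<tau>)) \<in> circle_L2"
    by (intro circle_L2_continuous continuous_intros)
  have gL: "g \<in> circle_L2" unfolding g_def using circle_L2_diff[OF uL cL] by (simp add: u_def)
  \<comment> \<open>\<open>R\<close> is \<open>z\<close> times the candidate for
    \<open>(T - w) f\<close>. Its mean vanishes because \<open>q\<close> has constant term 1, so
    division by \<open>z\<close> stays in the Hardy space.\<close>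
  define R where "R = (\<lambda>\<tau>. (q (cis \<tau>) * f \<tau> - k))"
  have R: "R \<in> hardy_H2" unfolding R_def
    by (intro hardy_H2_diff hardy_q_mult f hardy_H2_const)
  have R0: "fourier_coeff R 0 = 0"
    unfolding R_def using hardy_q_mult[OF f] fourier_coeff_cmult[of k "\<lambda>t. 1" 0]
    by (subst fourier_coeff_diff) (auto simp: hardy_H2_L2 hardy_H2_const k_def fourier_coeff_one)
  have cc: "cis \<tau> * cis (- \<tau>) = 1" for \<tau> by (simp add: cis_mult)
  have Rg: "R = (\<lambda>\<tau>. cis \<tau> * (g \<tau> - w * f \<tau>))"
  proof
    fix \<tau>
    have "cis \<tau> * (g \<tau> - w * f \<tau>) = cis \<tau> * ((\<phi> (cis \<tau>) - w) * f \<tau> - k * cis (- \<tau>))"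
      by (simp add: g_def algebra_simps)
    also have "\<dots> = (cis \<tau> * cis (- \<tau>)) * (q (cis \<tau>) * f \<tau> - k)"
      unfolding phi_cis by (simp add: algebra_simps)
    finally show "R \<tau> = cis \<tau> * (g \<tau> - w * f \<tau>)" by (simp add: cc R_def)
  qed
  have gw: "(\<lambda>\<tau>. g \<tau> - w * f \<tau>) \<in> hardy_H2"
  proof -
    have "fourier_coeff (\<lambda>\<tau>. g \<tau> - w * f \<tau>) n = 0" if "n < 0" for n
    proof -
      have "fourier_coeff (\<lambda>\<tau>. g \<tau> - w * f \<tau>) n = fourier_coeff R (n + 1)"
        unfolding Rg fourier_coeff_shift by simp
      then show ?thesis using R R0 that by (cases "n = -1") (auto simp: hardy_H2_def)
    qed
    moreover have "(\<lambda>\<tau>. g \<tau> - w * f \<tau>) \<in> circle_L2"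
      using gL f by (intro circle_L2_diff circle_L2_cmult) (auto simp: hardy_H2_L2)
    ultimately show ?thesis by (simp add: hardy_H2_def)
  qed
  have g: "g \<in> hardy_H2"
    using hardy_H2_add[OF gw hardy_H2_cmult[OF f, of w]] by simp
  \<comment> \<open>\<open>u - g\<close> is a multiple of the mode of index -1, so its inner product
    with \<open>h\<close> is, up to conjugation and a factor, a coefficient of \<open>h\<close> of
    negative index.\<close>
  have orth: "circle_inner (\<lambda>\<tau>. u \<tau> - g \<tau>) h = 0" if "h \<in> hardy_H2" for h
  proof -
    have eq: "(u \<tau> - g \<tau>) * cnj (h \<tau>) = k * cnj (h \<tau> * exp (- \<i> * of_int (-1) * of_real \<tau>))" for \<tau>
      by (simp add: u_def g_def cis_conv_exp exp_cnj)
    have "(LINT \<tau>:{0..2*pi}|lborel. cnj (h \<tau> * exp (- \<i> * of_int (-1) * of_real \<tau>)))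
       = cnj (LINT \<tau>:{0..2*pi}|lborel. (h \<tau> * exp (- \<i> * of_int (-1) * of_real \<tau>)))"
      unfolding set_lebesgue_integral_def by (subst Bochner_Integration.integral_cnj[symmetric]) (simp only: complex_cnj_scaleR)
    moreover have "(LINT \<tau>:{0..2*pi}|lborel. (h \<tau> * exp (- \<i> * of_int (-1) * of_real \<tau>))) = 0"
    proof -
      have "fourier_coeff h (-1) = 0" using that by (simp add: hardy_H2_def)
      then show ?thesis unfolding fourier_coeff_def by simp
    qed
    ultimately show ?thesis unfolding circle_inner_def eq by simp
  qed
  have sp: "szego_proj u \<in> hardy_H2" "circle_ae_eq (szego_proj u) g"
    using szego_proj_eq[OF uL g] orth by auto
  have T: "hardy_toeplitz \<phi> f = szego_proj u" by (simp add: hardy_toeplitz_def u_def)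
  show "(\<lambda>\<tau>. hardy_toeplitz \<phi> f \<tau> - w * f \<tau>) \<in> hardy_H2"
    unfolding T by (intro hardy_H2_diff sp(1) hardy_H2_cmult f)
  have "g \<tau> - w * f \<tau> = cis (- \<tau>) * (q (cis \<tau>) * f \<tau> - k)" for \<tau>
  proof -
    have "cis (- \<tau>) * (q (cis \<tau>) * f \<tau> - k) = cis \<tau> * cis (- \<tau>) * (g \<tau> - w * f \<tau>)"
      using fun_cong[OF Rg, of \<tau>] unfolding R_def by (simp only: mult_ac)
    then show ?thesis by (simp add: cc)
  qed
  with sp(2) show "circle_ae_eq (\<lambda>\<tau>. hardy_toeplitz \<phi> f \<tau> - w * f \<tau>)
       (\<lambda>\<tau>. cis (- \<tau>) * (q (cis \<tau>) * f \<tau> - fourier_coeff f 0))"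
    unfolding T circle_ae_eq_def k_def[symmetric] by (elim AE_mp) auto
qed

lemma hardy_toeplitz_eq_iff:
  assumes f: "f \<in> hardy_H2" and g: "g \<in> hardy_H2"
  shows "circle_ae_eq (\<lambda>\<tau>. hardy_toeplitz \<phi> f \<tau> - w * f \<tau>) g
    \<longleftrightarrow> circle_ae_eq (\<lambda>\<tau>. q (cis \<tau>) * f \<tau>) (\<lambda>\<tau>. cis \<tau> * g \<tau> + fourier_coeff f 0)"
proof -
  have e: "cis (- \<tau>) * (x - k) = y \<longleftrightarrow> x = cis \<tau> * y + k" for k \<tau> x y
  proof -
    have "cis \<tau> * (cis (- \<tau>) * (x - k)) = x - k" "cis (- \<tau>) * (cis \<tau> * y) = y"
      by (simp_all add: mult.assoc[symmetric] cis_mult)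
    then show ?thesis by (metis add_diff_cancel_right' diff_add_cancel)
  qed
  have "circle_ae_eq (\<lambda>\<tau>. hardy_toeplitz \<phi> f \<tau> - w * f \<tau>) g
    \<longleftrightarrow> circle_ae_eq (\<lambda>\<tau>. cis (- \<tau>) * (q (cis \<tau>) * f \<tau> - fourier_coeff f 0)) g"
    using circle_ae_eq_trans[OF hardy_toeplitz_shifted(2)[OF f], of g]
      circle_ae_eq_trans[OF circle_ae_eq_sym[OF hardy_toeplitz_shifted(2)[OF f]], of g] by (rule iffI[rotated])
  also have "\<dots> \<longleftrightarrow> circle_ae_eq (\<lambda>\<tau>. q (cis \<tau>) * f \<tau>) (\<lambda>\<tau>. cis \<tau> * g \<tau> + fourier_coeff f 0)"
    unfolding circle_ae_eq_def e ..
  finally show ?thesis .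
qed

text \<open>The constant may be left open when solving the equation: comparing coefficients of index
  0 forces it to be the mean of \<open>f\<close>.\<close>

lemma hardy_toeplitz_eqI:
  assumes f: "f \<in> hardy_H2" and g: "g \<in> hardy_H2"
    and eq: "circle_ae_eq (\<lambda>\<tau>. q (cis \<tau>) * f \<tau>) (\<lambda>\<tau>. cis \<tau> * g \<tau> + k)"
  shows "circle_ae_eq (\<lambda>\<tau>. hardy_toeplitz \<phi> f \<tau> - w * f \<tau>) g" "fourier_coeff f 0 = k"
proof -
  have gk: "(\<lambda>\<tau>. cis \<tau> * g \<tau> + k) \<in> hardy_H2"
    using g by (intro hardy_H2_add hardy_H2_shift hardy_H2_const)
  have "fourier_coeff f 0 = fourier_coeff (\<lambda>\<tau>. cis \<tau> * g \<tau> + k) 0"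
    using hardy_q_mult[OF f] fourier_coeff_cong_ae[OF eq] gk by (simp add: hardy_H2_L2)
  also have "\<dots> = fourier_coeff g (-1) + k" using g fourier_coeff_cmult[of k "\<lambda>t. 1" 0]
    by (subst fourier_coeff_add) (auto simp: hardy_H2_L2 circle_L2_shift hardy_H2_const fourier_coeff_shift fourier_coeff_one)
  also have "\<dots> = k" using g by (auto simp: hardy_H2_def)
  finally show k: "fourier_coeff f 0 = k" .
  show "circle_ae_eq (\<lambda>\<tau>. hardy_toeplitz \<phi> f \<tau> - w * f \<tau>) g"
    unfolding hardy_toeplitz_eq_iff[OF f g] k by (rule eq)
qed

lemma hardy_spectrum_outer:
  assumes "cmod r > 1" "cmod s > 1" "cmod t > 1"
  shows "w \<in> op_spectrum hardy_H2 circle_norm circle_ae_eq (hardy_toeplitz \<phi>)"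
  unfolding op_spectrum_def
proof (safe)
  fix S C
  assume S: "\<forall>g\<in>hardy_H2. S g \<in> hardy_H2"
    and cong: "\<forall>g\<in>hardy_H2. \<forall>g'\<in>hardy_H2. circle_ae_eq g g' \<longrightarrow> circle_ae_eq (S g) (S g')"
    and bd: "\<forall>g\<in>hardy_H2. circle_norm (S g) \<le> C * circle_norm g"
    and inv: "\<forall>f\<in>hardy_H2. circle_ae_eq (S (\<lambda>x. hardy_toeplitz \<phi> f x - w * f x)) f"
  define f where "f = (\<lambda>\<tau>. (1 / a) * (1 / (cis \<tau> - r) / (cis \<tau> - s) / (cis \<tau> - t)))"
  have f: "f \<in> hardy_H2" unfolding f_def
    by (intro hardy_H2_cmult hardy_H2_divide_outer hardy_H2_one assms)
  have ne: "cis \<tau> - r \<noteq> 0" "cis \<tau> - s \<noteq> 0" "cis \<tau> - t \<noteq> 0" for \<tau>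
    using assms norm_cis[of \<tau>] by auto
  have z: "(\<lambda>\<tau>. 0) \<in> hardy_H2" by (rule hardy_H2_const)
  have "circle_ae_eq (\<lambda>\<tau>. q (cis \<tau>) * f \<tau>) (\<lambda>\<tau>. cis \<tau> * 0 + 1)"
    using ne a_nz by (intro circle_ae_eqI) (simp add: q_factor f_def)
  note T = hardy_toeplitz_eqI[OF f z this]
  \<comment> \<open>As \<open>S\<close> is not assumed linear, its value at 0 is controlled by the
    norm bound, while the congruence condition identifies that value with \<open>f\<close>, whose
    mean is 1.\<close>
  have "circle_ae_eq (S (\<lambda>\<tau>. 0)) (S (\<lambda>x. hardy_toeplitz \<phi> f x - w * f x))"
    using cong T(1) z hardy_toeplitz_shifted(1)[OF f] circle_ae_eq_sym by blast
  then have "circle_ae_eq (S (\<lambda>\<tau>. 0)) f" using inv f circle_ae_eq_trans by blast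
  then have "circle_sq (S (\<lambda>\<tau>. 0)) = circle_sq f" using S z f by (intro circle_sq_cong_ae) (auto simp: hardy_H2_L2)
  moreover have "circle_norm (S (\<lambda>\<tau>. 0)) \<le> 0" using bd z by (force simp: circle_norm_def)
  then have "circle_sq (S (\<lambda>\<tau>. 0)) \<le> 0" by (simp add: circle_norm_sqrt)
  moreover have "(cmod (fourier_coeff f 0))\<^sup>2 \<le> circle_sq f"
    using f by (intro fourier_coeff_le hardy_H2_L2)
  ultimately show False using T(2) by simp
qed

text \<open>A solution of \<open>(T - w) f = 1\<close> would give \<open>q f = z + k\<close>, a
  polynomial of degree 1 divisible by two linear factors with roots in the disk. The recurrences
  remove one factor after the other: \<open>h\<close> has no coefficients of positive index, so its
  mean is 1; then the mean of \<open>F\<close> vanishes, which makes that of \<open>h\<close> equal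
  to 0.\<close>

lemma hardy_spectrum_inner:
  assumes "cmod r < 1" "cmod s < 1"
  shows "w \<in> op_spectrum hardy_H2 circle_norm circle_ae_eq (hardy_toeplitz \<phi>)"
  unfolding op_spectrum_def
proof (safe)
  fix S C
  assume S: "\<forall>g\<in>hardy_H2. S g \<in> hardy_H2"
    and inv: "\<forall>g\<in>hardy_H2. circle_ae_eq (\<lambda>x. hardy_toeplitz \<phi> (S g) x - w * S g x) g"
  define f where "f = S (\<lambda>\<tau>. 1)"
  have f: "f \<in> hardy_H2" using S hardy_H2_one by (simp add: f_def)
  define k where "k = fourier_coeff f 0"
  have "circle_ae_eq (\<lambda>x. hardy_toeplitz \<phi> f x - w * f x) (\<lambda>\<tau>. 1)"
    using inv hardy_H2_one by (simp add: f_def)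
  then have eq: "circle_ae_eq (\<lambda>\<tau>. q (cis \<tau>) * f \<tau>) (\<lambda>\<tau>. cis \<tau> * 1 + k)"
    unfolding hardy_toeplitz_eq_iff[OF f hardy_H2_one] by (simp add: k_def)
  \<comment> \<open>The factor of the root \<open>t\<close>, wherever it lies, is absorbed into
    \<open>F\<close>.\<close>
  define F where "F = (\<lambda>\<tau>. a * (cis \<tau> * f \<tau> - t * f \<tau>))"
  have F: "F \<in> hardy_H2" unfolding F_def
    by (intro hardy_H2_cmult hardy_H2_diff hardy_H2_shift f)
  define h where "h = (\<lambda>\<tau>. (cis \<tau> - s) * F \<tau>)"
  have h: "h \<in> hardy_H2" using hardy_H2_diff[OF hardy_H2_shift[OF F] hardy_H2_cmult[OF F, of s]]
    by (simp add: h_def algebra_simps)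
  have qf: "(\<lambda>\<tau>. q (cis \<tau>) * f \<tau>) = (\<lambda>\<tau>. (cis \<tau> - r) * h \<tau>)"
    by (simp add: q_factor h_def F_def algebra_simps)
  have recF: "fourier_coeff h n = fourier_coeff F (n - 1) - s * fourier_coeff F n" for n
    unfolding h_def by (rule fourier_coeff_linear_factor[OF hardy_H2_L2[OF F]])
  have rech: "fourier_coeff h (n - 1) - r * fourier_coeff h n = (if n = 1 then 1 else if n = 0 then k else 0)" for n
  proof -
    have L: "(\<lambda>\<tau>. q (cis \<tau>) * f \<tau>) \<in> circle_L2" "(\<lambda>\<tau>. cis \<tau> * 1 + k) \<in> circle_L2"
      using hardy_q_mult[OF f] hardy_H2_add[OF hardy_H2_shift[OF hardy_H2_one] hardy_H2_const[of k]]
      by (auto simp: hardy_H2_L2)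
    have "fourier_coeff h (n - 1) - r * fourier_coeff h n = fourier_coeff (\<lambda>\<tau>. q (cis \<tau>) * f \<tau>) n"
      unfolding qf by (rule fourier_coeff_linear_factor[OF hardy_H2_L2[OF h], symmetric])
    also have "\<dots> = fourier_coeff (\<lambda>\<tau>. cis \<tau> * 1 + k * 1) n"
      using fourier_coeff_cong_ae[OF eq L] by simp
    also have "\<dots> = fourier_coeff (\<lambda>\<tau>. 1) (n - 1) + k * fourier_coeff (\<lambda>\<tau>. 1) n"
      by (subst fourier_coeff_add) (simp_all only: circle_L2_one circle_L2_cmult circle_L2_shift fourier_coeff_shift fourier_coeff_cmult)
    finally show ?thesis by (simp add: fourier_coeff_one)
  qed
  have h0: "fourier_coeff h (1 + int m) = 0" for m
  proof -
    have "(\<lambda>n. fourier_coeff h (1 + int m + int n)) 0 = 0"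
    proof (rule bounded_geometric_backward_zero[OF _ _ assms(1)])
      show "cmod (fourier_coeff h (1 + int m + int n)) \<le> sqrt (circle_sq h)" for n
        by (rule fourier_coeff_norm_le[OF hardy_H2_L2[OF h]])
      show "fourier_coeff h (1 + int m + int n) = r * fourier_coeff h (1 + int m + int (Suc n))" for n
        using rech[of "1 + int m + int (Suc n)"] by (simp add: add.assoc)
    qed
    then show ?thesis by simp
  qed
  have "fourier_coeff h 0 = 1" using rech[of 1] h0[of 0] by simp
  moreover have "(\<lambda>n. fourier_coeff F (int n)) 0 = 0"
  proof (rule bounded_geometric_backward_zero[OF _ _ assms(2)])
    show "cmod (fourier_coeff F (int n)) \<le> sqrt (circle_sq F)" for n
      by (rule fourier_coeff_norm_le[OF hardy_H2_L2[OF F]])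
    show "fourier_coeff F (int n) = s * fourier_coeff F (int (Suc n))" for n
      using recF[of "1 + int n"] h0[of n] by (simp add: add.commute)
  qed
  moreover have "fourier_coeff F (-1) = 0" using F by (simp add: hardy_H2_def)
  ultimately show False using recF[of 0] by simp
qed

text \<open>The geometric sums \<open>f n\<close> concentrate at \<open>\<rho>\<close>: their
  squared norm is \<open>n\<close>, whereas
  \<open>(z - \<rho>) f n = \<rho> ((z / \<rho>)^n - 1)\<close> is bounded by 2. A bounded inverse
  would bound \<open>n\<close>.\<close>

lemma hardy_spectrum_circle:
  assumes \<rho>: "cmod \<rho> = 1" and u: "\<And>z. q z = (z - \<rho>) * u z" "continuous_on UNIV u"
  shows "w \<in> op_spectrum hardy_H2 circle_norm circle_ae_eq (hardy_toeplitz \<phi>)"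
  unfolding op_spectrum_def
proof (safe)
  fix S C
  assume S: "\<forall>g\<in>hardy_H2. S g \<in> hardy_H2"
    and bd: "\<forall>g\<in>hardy_H2. circle_norm (S g) \<le> C * circle_norm g"
    and inv: "\<forall>f\<in>hardy_H2. circle_ae_eq (S (\<lambda>x. hardy_toeplitz \<phi> f x - w * f x)) f"
  have \<rho>0: "\<rho> \<noteq> 0" using \<rho> by auto
  have "compact (u ` sphere 0 1)"
    using u(2) by (intro compact_continuous_image) (auto intro: continuous_on_subset)
  then obtain B where B: "\<And>z. cmod z = 1 \<Longrightarrow> cmod (u z) \<le> B"
    by (metis bounded_iff compact_imp_bounded imageI mem_sphere_0)
  define f where "f = (\<lambda>n \<tau>. \<Sum>j<n. (cis \<tau> / \<rho>) ^ j)"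
  have mon: "(\<lambda>\<tau>. (cis \<tau> / \<rho>) ^ j) \<in> hardy_H2 \<and>
     (\<forall>n. fourier_coeff (\<lambda>\<tau>. (cis \<tau> / \<rho>) ^ j) n = (if n = int j then (1 / \<rho>) ^ j else 0))" for j
  proof (induction j)
    case (Suc j)
    have eq: "(\<lambda>\<tau>. (cis \<tau> / \<rho>) ^ Suc j) = (\<lambda>\<tau>. (1 / \<rho>) * (cis \<tau> * (cis \<tau> / \<rho>) ^ j))" by simp
    show ?case unfolding eq fourier_coeff_cmult fourier_coeff_shift
      using hardy_H2_cmult[OF hardy_H2_shift[OF conjunct1[OF Suc]], of "1 / \<rho>"] Suc
      by (intro conjI) (blast, auto)
  qed (simp add: hardy_H2_one fourier_coeff_one)
  have f: "f n \<in> hardy_H2 \<and> (\<forall>m. fourier_coeff (f n) m = (if m < int n \<and> m \<ge> 0 then (1 / \<rho>) ^ nat m else 0))" for n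
  proof (induction n)
    case 0
    then show ?case using hardy_H2_const[of 0] fourier_coeff_cmult[of 0 "\<lambda>x. 1"] by (simp add: f_def)
  next
    case (Suc n)
    have eq: "f (Suc n) = (\<lambda>\<tau>. f n \<tau> + (cis \<tau> / \<rho>) ^ n)" by (simp add: f_def)
    have "fourier_coeff (f (Suc n)) m = fourier_coeff (f n) m + fourier_coeff (\<lambda>\<tau>. (cis \<tau> / \<rho>) ^ n) m" for m
      unfolding eq using Suc mon[of n] by (intro fourier_coeff_add hardy_H2_L2) auto
    moreover have "f (Suc n) \<in> hardy_H2" unfolding eq using Suc mon[of n] by (intro hardy_H2_add) auto
    ultimately show ?case using Suc mon[of n] by auto
  qed
  \<comment> \<open>Removing the top mode of \<open>f (Suc n)\<close> leaves \<open>f n\<close> and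
    costs the square of a unimodular coefficient.\<close>
  have sqf: "circle_sq (f n) = real n" for n
  proof (induction n)
    case 0
    then show ?case by (simp add: f_def circle_sq_def)
  next
    case (Suc n)
    have "exp (\<i> * of_int (int n) * of_real \<tau>) = cis \<tau> ^ n" for \<tau>
      by (simp add: cis_conv_exp exp_of_nat_mult[symmetric] mult_ac)
    moreover have k: "fourier_coeff (f (Suc n)) (int n) = (1 / \<rho>) ^ n" using f[of "Suc n"] by simp
    ultimately have "(\<lambda>\<tau>. f (Suc n) \<tau> - fourier_coeff (f (Suc n)) (int n) * exp (\<i> * of_int (int n) * of_real \<tau>)) = f n"
      by (simp add: f_def power_divide fun_eq_iff)
    then show ?case using circle_sq_remove_coeff[of "f (Suc n)" "int n"] f[of "Suc n"] k Suc \<rho>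
      by (simp add: hardy_H2_L2 norm_divide norm_power)
  qed
  have up: "circle_sq (\<lambda>x. hardy_toeplitz \<phi> (f (Suc n)) x - w * f (Suc n) x) \<le> (2 * B + 1)\<^sup>2" for n
  proof -
    note ff = f[of "Suc n", THEN conjunct1]
    define m where "m = (\<lambda>\<tau>. cis (- \<tau>) * (q (cis \<tau>) * f (Suc n) \<tau> - fourier_coeff (f (Suc n)) 0))"
    \<comment> \<open>\<open>2 * B\<close> bounds \<open>q f\<close>, and 1 is the mean of the test
      function.\<close>
    have m1: "cmod (m \<tau>) \<le> 2 * B + 1" for \<tau>
    proof -
      have "(cis \<tau> - \<rho>) * f (Suc n) \<tau> = \<rho> * ((cis \<tau> / \<rho>) ^ Suc n - 1)"
      proof -
        have "(cis \<tau> / \<rho>) ^ Suc n - 1 = (cis \<tau> / \<rho> - 1) * f (Suc n) \<tau>"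
          unfolding f_def by (rule power_diff_1_eq) 
        then have "\<rho> * ((cis \<tau> / \<rho>) ^ Suc n - 1) = (\<rho> * (cis \<tau> / \<rho> - 1)) * f (Suc n) \<tau>"
          by (simp only: mult.assoc)
        moreover have "\<rho> * (cis \<tau> / \<rho> - 1) = cis \<tau> - \<rho>"
          using \<rho>0 by (simp add: right_diff_distrib)
        ultimately show ?thesis by simp
      qed
      then have qf: "q (cis \<tau>) * f (Suc n) \<tau> = u (cis \<tau>) * (\<rho> * ((cis \<tau> / \<rho>) ^ Suc n - 1))"
        unfolding u(1) by (metis mult.assoc mult.commute)
      have "cmod ((cis \<tau> / \<rho>) ^ Suc n - 1) \<le> cmod ((cis \<tau> / \<rho>) ^ Suc n) + 1"
        using norm_triangle_ineq4[of "(cis \<tau> / \<rho>) ^ Suc n" 1] by simp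
      also have "\<dots> = 2" using \<rho> by (simp add: norm_divide norm_power norm_mult)
      finally have "cmod (q (cis \<tau>) * f (Suc n) \<tau>) \<le> B * 2"
        unfolding qf using B[of "cis \<tau>"] \<rho> by (simp only: norm_mult) (intro mult_mono; use order.trans[OF norm_ge_zero B[of "cis \<tau>"]] in auto)
      moreover have "cmod (m \<tau>) \<le> cmod (q (cis \<tau>) * f (Suc n) \<tau>) + cmod (fourier_coeff (f (Suc n)) 0)"
        unfolding m_def norm_mult[of "cis _"] by (simp del: norm_mult add: norm_triangle_ineq4)
      moreover have "fourier_coeff (f (Suc n)) 0 = 1" using f[of "Suc n"] by simp
      ultimately show ?thesis by simp
    qed
    have m: "continuous_on {0..2*pi} m" unfolding m_def f_def q_def p_def using \<rho>0
      by (intro continuous_intros) auto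
    have "circle_sq (\<lambda>x. hardy_toeplitz \<phi> (f (Suc n)) x - w * f (Suc n) x) = circle_sq m"
      unfolding m_def using hardy_toeplitz_shifted[OF ff] circle_L2_continuous[OF m, unfolded m_def]
      by (intro circle_sq_cong_ae) (auto simp: hardy_H2_L2)
    also have "\<dots> \<le> (2 * B + 1)\<^sup>2 * circle_sq (\<lambda>\<tau>. 1)"
      using circle_sq_mult_le[OF circle_L2_one m, of "2 * B + 1"] m1 by simp
    also have "circle_sq (\<lambda>\<tau>. 1) = 1" by (simp add: circle_sq_def set_lebesgue_integral_def)
    finally show ?thesis by simp
  qed
  have bound: "real (Suc n) \<le> C\<^sup>2 * (2 * B + 1)\<^sup>2" for n
  proof -
    note ff = f[of "Suc n", THEN conjunct1]
    define g where "g = (\<lambda>x. hardy_toeplitz \<phi> (f (Suc n)) x - w * f (Suc n) x)"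
    have g: "g \<in> hardy_H2" unfolding g_def by (rule hardy_toeplitz_shifted(1)[OF ff])
    have "circle_sq (S g) = circle_sq (f (Suc n))"
      using inv ff S g by (intro circle_sq_cong_ae) (auto simp: hardy_H2_L2 g_def)
    then have "real (Suc n) = (circle_norm (S g))\<^sup>2" by (simp add: circle_norm_power2 sqf)
    also have "\<dots> \<le> (C * circle_norm g)\<^sup>2"
      using bd g by (intro power_mono) (auto simp: circle_norm_sqrt circle_sq_nonneg)
    also have "\<dots> = C\<^sup>2 * circle_sq g" by (simp add: power_mult_distrib circle_norm_power2)
    also have "\<dots> \<le> C\<^sup>2 * (2 * B + 1)\<^sup>2" using up[of n] by (intro mult_left_mono) (auto simp: g_def)
    finally show ?thesis .
  qed
  obtain n where "real n > C\<^sup>2 * (2 * B + 1)\<^sup>2" using reals_Archimedean2 by blast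
  with bound[of n] show False by simp
qed

lemma hardy_resolvent:
  assumes "cmod r < 1" "cmod s > 1" "cmod t > 1"
  shows "w \<notin> op_spectrum hardy_H2 circle_norm circle_ae_eq (hardy_toeplitz \<phi>)"
proof -
  have ne: "cis \<tau> - r \<noteq> 0" "cis \<tau> - s \<noteq> 0" "cis \<tau> - t \<noteq> 0" for \<tau>
    using assms norm_cis[of \<tau>] by auto
  have q0: "q (cis \<tau>) \<noteq> 0" for \<tau> using ne a_nz by (simp add: q_factor)
  \<comment> \<open>\<open>K g\<close> cancels the coefficient of index -1 of
    \<open>(z g + K g) / (z - r)\<close>; formally it is \<open>- r * g r\<close>.\<close>
  define K where "K = (\<lambda>g. - fourier_coeff (\<lambda>\<tau>. cis \<tau> * g \<tau> / (cis \<tau> - r)) (-1))"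
  define S where "S = (\<lambda>g \<tau>. (1 / q (cis \<tau>)) * (cis \<tau> * g \<tau> + K g))"
  have dL: "(\<lambda>\<tau>. cis \<tau> * g \<tau> / (cis \<tau> - r)) \<in> circle_L2" if "g \<in> hardy_H2" for g
    using that assms by (intro circle_L2_divide_linear circle_L2_shift hardy_H2_L2) auto
  have oL: "(\<lambda>\<tau>. 1 / (cis \<tau> - r)) \<in> circle_L2"
    using assms by (intro circle_L2_divide_linear circle_L2_one) auto
  have SH: "S g \<in> hardy_H2" if g: "g \<in> hardy_H2" for g
  proof -
    have "fourier_coeff (\<lambda>\<tau>. cis \<tau> * g \<tau> / (cis \<tau> - r) + K g * (1 / (cis \<tau> - r))) (-1) = 0"
      using fourier_coeff_add[OF dL[OF g] circle_L2_cmult[OF oL, of "K g"]]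
      unfolding fourier_coeff_cmult fourier_coeff_inverse_linear[OF assms(1)]
      by (simp add: K_def fourier_coeff_inverse_linear[OF assms(1)])
    then have "fourier_coeff (\<lambda>\<tau>. (cis \<tau> * g \<tau> + K g) / (cis \<tau> - r)) (-1) = 0"
      by (simp add: add_divide_distrib)
    then have "(\<lambda>\<tau>. (cis \<tau> * g \<tau> + K g) / (cis \<tau> - r)) \<in> hardy_H2"
      by (intro hardy_H2_divide_inner assms hardy_H2_add hardy_H2_shift hardy_H2_const g)
    then have "(\<lambda>\<tau>. (1 / a) * ((cis \<tau> * g \<tau> + K g) / (cis \<tau> - r) / (cis \<tau> - s) / (cis \<tau> - t))) \<in> hardy_H2"
      by (rule hardy_H2_cmult[OF hardy_H2_divide_outer[OF assms(3) hardy_H2_divide_outer[OF assms(2)]]])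
    then show ?thesis by (simp add: S_def q_factor mult_ac)
  qed
  have qS: "q (cis \<tau>) * S g \<tau> = cis \<tau> * g \<tau> + K g" for g \<tau>
    using q0 by (simp add: S_def)
  have T1: "circle_ae_eq (\<lambda>x. hardy_toeplitz \<phi> (S g) x - w * S g x) g" if "g \<in> hardy_H2" for g
    using that by (intro hardy_toeplitz_eqI(1)[of _ _ "K g"] SH circle_ae_eqI) (auto simp: qS)
  have T2: "circle_ae_eq (S (\<lambda>x. hardy_toeplitz \<phi> f x - w * f x)) f" if f: "f \<in> hardy_H2" for f
  proof -
    define g where "g = (\<lambda>x. hardy_toeplitz \<phi> f x - w * f x)"
    have g: "g \<in> hardy_H2" unfolding g_def by (rule hardy_toeplitz_shifted(1)[OF f])
    define k where "k = fourier_coeff f 0"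
    have eq: "circle_ae_eq (\<lambda>\<tau>. q (cis \<tau>) * f \<tau>) (\<lambda>\<tau>. cis \<tau> * g \<tau> + k)"
      using hardy_toeplitz_eq_iff[OF f g] by (simp add: g_def circle_ae_eq_refl k_def)
    \<comment> \<open>\<open>F\<close> is \<open>q f / (z - r)\<close> written without division,
      hence a member of the Hardy space. Its vanishing coefficient of index -1 identifies
      \<open>K g\<close> with the mean of \<open>f\<close>.\<close>
    define F where "F = (\<lambda>\<tau>. a * (cis \<tau> * (cis \<tau> * f \<tau>) - (s + t) * (cis \<tau> * f \<tau>) + s * t * f \<tau>))"
    have F: "F \<in> hardy_H2" unfolding F_def
      by (intro hardy_H2_cmult hardy_H2_add hardy_H2_diff hardy_H2_shift f)
    have Fq: "(cis \<tau> - r) * F \<tau> = q (cis \<tau>) * f \<tau>" for \<tau>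
      by (simp add: F_def q_factor algebra_simps)
    have "circle_ae_eq (\<lambda>\<tau>. cis \<tau> * g \<tau> / (cis \<tau> - r)) (\<lambda>\<tau>. F \<tau> - k * (1 / (cis \<tau> - r)))"
      using eq unfolding circle_ae_eq_def Fq[symmetric]
    proof (elim AE_mp, intro AE_I2 impI)
      fix x assume "x \<in> {0..2*pi} \<longrightarrow> (cis x - r) * F x = cis x * g x + k" "x \<in> {0..2*pi}"
      then show "cis x * g x / (cis x - r) = F x - k * (1 / (cis x - r))"
        using ne(1)[of x]
          nonzero_mult_div_cancel_left[of "cis x - r" "F x"]
        by (simp add: diff_divide_distrib[symmetric] add_divide_distrib eq_diff_eq)
    qed
    then have "fourier_coeff (\<lambda>\<tau>. cis \<tau> * g \<tau> / (cis \<tau> - r)) (-1) = fourier_coeff (\<lambda>\<tau>. F \<tau> - k * (1 / (cis \<tau> - r))) (-1)"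
      by (intro fourier_coeff_cong_ae dL g circle_L2_diff hardy_H2_L2 F circle_L2_cmult oL)
    also have "\<dots> = fourier_coeff F (-1) - k * fourier_coeff (\<lambda>\<tau>. 1 / (cis \<tau> - r)) (-1)"
      by (subst fourier_coeff_diff) (intro circle_L2_diff hardy_H2_L2 F circle_L2_cmult oL | simp only: fourier_coeff_cmult)+
    also have "fourier_coeff F (-1) = 0" using F by (simp add: hardy_H2_def)
    finally have Kk: "K g = k" by (simp add: K_def fourier_coeff_inverse_linear[OF assms(1)])
    show ?thesis using eq unfolding circle_ae_eq_def g_def[symmetric]
      by (elim AE_mp) (use q0 in \<open>auto simp: S_def Kk field_simps\<close>)
  qed
  have cong: "circle_ae_eq (S g) (S g')" if "g \<in> hardy_H2" "g' \<in> hardy_H2" "circle_ae_eq g g'" for g g'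
  proof -
    have "circle_ae_eq (\<lambda>\<tau>. cis \<tau> * g \<tau> / (cis \<tau> - r)) (\<lambda>\<tau>. cis \<tau> * g' \<tau> / (cis \<tau> - r))"
      using that(3) unfolding circle_ae_eq_def by (elim AE_mp) auto
    then have "K g = K g'" unfolding K_def using dL that by (simp add: fourier_coeff_cong_ae[of _ "\<lambda>\<tau>. cis \<tau> * g' \<tau> / (cis \<tau> - r)"])
    then show ?thesis
      using that(3) unfolding circle_ae_eq_def by (elim AE_mp) (auto simp: S_def)
  qed
  have cont: "continuous_on {0..2*pi} (\<lambda>\<tau>. 1 / q (cis \<tau>))" "continuous_on {0..2*pi} (\<lambda>\<tau>. cis \<tau> / (cis \<tau> - r))"
    using q0 ne by (auto intro!: continuous_intros simp: q_def p_def)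
  obtain B where B: "\<And>\<tau>. \<tau> \<in> {0..2*pi} \<Longrightarrow> cmod (1 / q (cis \<tau>)) \<le> B"
    using compact_imp_bounded[OF compact_continuous_image[OF cont(1)]]
    by (metis (mono_tags, lifting) bounded_iff compact_Icc imageI)
  obtain B' where B': "\<And>\<tau>. \<tau> \<in> {0..2*pi} \<Longrightarrow> cmod (cis \<tau> / (cis \<tau> - r)) \<le> B'"
    using compact_imp_bounded[OF compact_continuous_image[OF cont(2)]]
    by (metis (mono_tags, lifting) bounded_iff compact_Icc imageI)
  have bound: "circle_norm (S g) \<le> sqrt (B\<^sup>2 * (2 + 2 * B'\<^sup>2)) * circle_norm g" if g: "g \<in> hardy_H2" for g
  proof -
    have gL: "(\<lambda>\<tau>. cis \<tau> * g \<tau>) \<in> circle_L2" "(\<lambda>\<tau>. cis \<tau> * g \<tau> + K g) \<in> circle_L2" "(\<lambda>\<tau>. K g) \<in> circle_L2"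
      using g by (intro hardy_H2_L2 hardy_H2_add hardy_H2_shift hardy_H2_const; simp)+
    have "(cmod (K g))\<^sup>2 \<le> circle_sq (\<lambda>\<tau>. cis \<tau> / (cis \<tau> - r) * g \<tau>)"
      using fourier_coeff_le[OF dL[OF g], of "-1"] by (simp add: K_def)
    also have "\<dots> \<le> B'\<^sup>2 * circle_sq g" using B' g by (intro circle_sq_mult_le cont hardy_H2_L2)
    finally have K: "(cmod (K g))\<^sup>2 \<le> B'\<^sup>2 * circle_sq g" .
    have "circle_sq (S g) \<le> B\<^sup>2 * circle_sq (\<lambda>\<tau>. cis \<tau> * g \<tau> + K g)"
      unfolding S_def by (intro circle_sq_mult_le gL cont B)
    also have "\<dots> \<le> B\<^sup>2 * (2 * circle_sq (\<lambda>\<tau>. cis \<tau> * g \<tau>) + 2 * circle_sq (\<lambda>\<tau>. K g))"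
      by (intro mult_left_mono circle_sq_add gL) auto
    also have "circle_sq (\<lambda>\<tau>. cis \<tau> * g \<tau>) = circle_sq g" by (simp add: circle_sq_def norm_mult)
    also have "circle_sq (\<lambda>\<tau>. K g) = (cmod (K g))\<^sup>2" by (simp add: circle_sq_def set_lebesgue_integral_def)
    also have "B\<^sup>2 * (2 * circle_sq g + 2 * (cmod (K g))\<^sup>2) \<le> B\<^sup>2 * (2 * circle_sq g + 2 * (B'\<^sup>2 * circle_sq g))"
      using K by (intro mult_left_mono) auto
    also have "\<dots> = B\<^sup>2 * (2 + 2 * B'\<^sup>2) * circle_sq g" by (simp add: algebra_simps)
    finally show ?thesis unfolding circle_norm_sqrt real_sqrt_mult[symmetric] by (rule real_sqrt_le_mono)
  qed
  show ?thesis 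
    by (rule op_spectrum_notI[of hardy_H2 S circle_ae_eq circle_norm "sqrt (B\<^sup>2 * (2 + 2 * B'\<^sup>2))" "hardy_toeplitz \<phi>" w,
          OF SH cong bound T1 T2])
qed

end

section \<open>Finite linear systems\<close>

text \<open>Gaussian elimination on the last equation: either its coefficients all vanish, or one
  unknown \<open>l\<close> is expressed by the others, which leaves one equation and one unknown
  less.\<close>

lemma underdetermined_system_nontrivial:
  fixes M :: "nat \<Rightarrow> nat \<Rightarrow> complex"
  assumes "finite J" "card J > n"
  shows "\<exists>x. (\<exists>j\<in>J. x j \<noteq> 0) \<and> (\<forall>i<n. (\<Sum>j\<in>J. M i j * x j) = 0)"
  using assms
proof (induction n arbitrary: J M)
  case 0
  then show ?case by (intro exI[of _ "\<lambda>_. 1"]) (auto simp: card_gt_0_iff)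
next
  case (Suc n)
  show ?case
  proof (cases "\<forall>j\<in>J. M n j = 0")
    case True
    obtain x where "\<exists>j\<in>J. x j \<noteq> 0" "\<forall>i<n. (\<Sum>j\<in>J. M i j * x j) = 0"
      using Suc.IH[of J M] Suc.prems by auto
    then show ?thesis using True by (intro exI[of _ x]) (auto simp: less_Suc_eq)
  next
    case False
    then obtain l where l: "l \<in> J" "M n l \<noteq> 0" by blast
    define J' where "J' = J - {l}"
    have J': "finite J'" "card J' > n" "l \<notin> J'" "J = insert l J'"
      using Suc.prems l by (auto simp: J'_def)
    obtain x where x: "\<exists>j\<in>J'. x j \<noteq> 0"
        "\<forall>i<n. (\<Sum>j\<in>J'. (M i j - M i l * M n j / M n l) * x j) = 0"
      using Suc.IH[OF J'(1,2), of "\<lambda>i j. M i j - M i l * M n j / M n l"] by auto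
    define s where "s = (\<Sum>j\<in>J'. M n j * x j)"
    define y where "y = x(l := - s / M n l)"
    have sumJ: "(\<Sum>j\<in>J. M i j * y j) = - M i l * s / M n l + (\<Sum>j\<in>J'. M i j * x j)" for i
    proof -
      have "(\<Sum>j\<in>J'. M i j * y j) = (\<Sum>j\<in>J'. M i j * x j)"
        using J'(3) by (intro sum.cong) (auto simp: y_def)
      then show ?thesis unfolding J'(4) using J'(1,3) by (simp add: y_def)
    qed
    have "(\<Sum>j\<in>J. M i j * y j) = 0" if "i < Suc n" for i
    proof (cases "i = n")
      case True
      then show ?thesis unfolding sumJ using l by (simp add: s_def)
    next
      case False
      with that have "i < n" by simp
      have "(\<Sum>j\<in>J'. (M i j - M i l * M n j / M n l) * x j) = (\<Sum>j\<in>J'. M i j * x j) - M i l * s / M n l"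
        unfolding s_def left_diff_distrib sum_subtractf sum_distrib_left sum_divide_distrib by (simp add: mult_ac)
      with x(2) \<open>i < n\<close> show ?thesis unfolding sumJ by simp
    qed
    moreover have "\<exists>j\<in>J. y j \<noteq> 0" using x(1) J'(3,4) by (auto simp: y_def)
    ultimately show ?thesis by blast
  qed
qed

text \<open>The negated right-hand side joins the matrix as an extra column. In a non-trivial
  solution of the enlarged system injectivity forces the last unknown to be non-zero, so it can be
  scaled to 1. The solution operator is a matrix \<open>K\<close>, whose entries later enter a norm
  bound.\<close>

lemma square_system_solvable:
  fixes M :: "nat \<Rightarrow> nat \<Rightarrow> complex"
  assumes inj: "\<forall>x. (\<forall>i<m. (\<Sum>j<m. M i j * x j) = 0) \<longrightarrow> (\<forall>j<m. x j = 0)"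
  shows "\<exists>K :: nat \<Rightarrow> nat \<Rightarrow> complex. \<forall>y. \<forall>i<m. (\<Sum>j<m. M i j * (\<Sum>k<m. K j k * y k)) = y i"
proof -
  have "\<exists>x. \<forall>i<m. (\<Sum>j<m. M i j * x j) = v i" for v
  proof -
    obtain x where x: "\<exists>j\<in>{..<Suc m}. x j \<noteq> 0"
        "\<forall>i<m. (\<Sum>j<Suc m. (if j = m then - v i else M i j) * x j) = 0"
      using underdetermined_system_nontrivial[of "{..<Suc m}" m "\<lambda>i j. if j = m then - v i else M i j"] by auto
    have eq: "(\<Sum>j<m. M i j * x j) = v i * x m" if "i < m" for i
      using x(2)[rule_format, OF that] by simp
    have "x m \<noteq> 0"
    proof
      assume z: "x m = 0"
      have "x j = 0" if "j < m" for j
        using inj[THEN spec, of x] that by (simp add: eq z)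
      then have "x j = 0" if "j < Suc m" for j
        using that z by (cases "j = m") simp_all
      with x(1) show False by simp
    qed
    have "(\<Sum>j<m. M i j * (x j / x m)) = v i" if "i < m" for i
    proof -
      have "(\<Sum>j<m. M i j * (x j / x m)) = (\<Sum>j<m. M i j * x j) / x m"
        by (simp only: sum_divide_distrib times_divide_eq_right)
      then show ?thesis using eq[OF that] \<open>x m \<noteq> 0\<close> by simp
    qed
    then show ?thesis by (intro exI[of _ "\<lambda>j. x j / x m"] allI impI)
  qed
  then have "\<forall>k. \<exists>x. \<forall>i<m. (\<Sum>j<m. M i j * x j) = (if i = k then 1 else 0)" by (intro allI)
  from choice[OF this] obtain L
    where L': "\<forall>k. \<forall>i<m. (\<Sum>j<m. M i j * L k j) = (if i = k then 1 else 0)" ..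
  have L: "(\<Sum>j<m. M i j * L k j) = (if i = k then 1 else 0)" if "i < m" for i k
    using L' that by simp
  have "(\<Sum>j<m. M i j * (\<Sum>k<m. L k j * y k)) = y i" if "i < m" for y i
  proof -
    have "(\<Sum>j<m. M i j * (\<Sum>k<m. L k j * y k)) = (\<Sum>j<m. \<Sum>k<m. M i j * L k j * y k)"
      by (simp add: sum_distrib_left mult.assoc)
    also have "\<dots> = (\<Sum>k<m. (\<Sum>j<m. M i j * L k j) * y k)"
      by (subst sum.swap) (simp add: sum_distrib_right)
    also have "\<dots> = (\<Sum>k<m. if k = i then y k else 0)"
      by (intro sum.cong refl) (auto simp add: L[OF that])
    also have "\<dots> = y i" using that by simp
    finally show ?thesis .
  qed
  then show ?thesis by (intro exI[of _ "\<lambda>j k. L k j"] allI impI)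
qed

section \<open>Parseval's identity on the disk\<close>

text \<open>Both measures agree on boxes. The identification makes Fubini available for area
  integrals.\<close>

lemma lborel_complex_eq_distr:
  "(lborel :: complex measure) = distr (lborel \<Otimes>\<^sub>M lborel) borel (\<lambda>x. Complex (fst x) (snd x))"
proof (rule lborel_eqI)
  have [measurable]: "(\<lambda>x. Complex (fst x) (snd x)) \<in> borel_measurable (lborel \<Otimes>\<^sub>M lborel)"
    unfolding lborel_prod Complex_eq measurable_lborel2
    by (intro borel_measurable_continuous_onI continuous_intros)
  fix l u :: complex
  assume le: "\<And>b. b \<in> Basis \<Longrightarrow> l \<bullet> b \<le> u \<bullet> b"
  have le': "Re l \<le> Re u" "Im l \<le> Im u" using le[of 1] le[of \<i>] by (auto simp: Basis_complex_def)
  have "emeasure (distr (lborel \<Otimes>\<^sub>M lborel) borel (\<lambda>x. Complex (fst x) (snd x))) (box l u)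
     = emeasure (lborel \<Otimes>\<^sub>M lborel) ((\<lambda>x. Complex (fst x) (snd x)) -` box l u \<inter> space (lborel \<Otimes>\<^sub>M lborel))"
    by (intro emeasure_distr) auto
  also have "(\<lambda>x. Complex (fst x) (snd x)) -` box l u \<inter> space (lborel \<Otimes>\<^sub>M lborel) = {Re l<..<Re u} \<times> {Im l<..<Im u}"
    by (auto simp: in_box_complex_iff space_pair_measure)
  also have "emeasure (lborel \<Otimes>\<^sub>M lborel) \<dots> = ennreal (Re u - Re l) * ennreal (Im u - Im l)"
    using le' by (subst lborel.emeasure_pair_measure_Times) auto
  also have "\<dots> = (\<Prod>b\<in>Basis. (u - l) \<bullet> b)"
    using le' by (simp add: Basis_complex_def ennreal_mult)
  finally show "emeasure (distr (lborel \<Otimes>\<^sub>M lborel) borel (\<lambda>x. Complex (fst x) (snd x))) (box l u)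
     = (\<Prod>b\<in>Basis. (u - l) \<bullet> b)" .
qed simp

lemma nn_integral_complex_iterated:
  fixes f :: "complex \<Rightarrow> ennreal"
  assumes [measurable]: "f \<in> borel_measurable borel"
  shows "(\<integral>\<^sup>+z. f z \<partial>lborel) = (\<integral>\<^sup>+x. \<integral>\<^sup>+y. f (Complex x y) \<partial>lborel \<partial>lborel)"
    "(\<integral>\<^sup>+z. f z \<partial>lborel) = (\<integral>\<^sup>+y. \<integral>\<^sup>+x. f (Complex x y) \<partial>lborel \<partial>lborel)"
proof -
  have m[measurable]: "(\<lambda>x. Complex (fst x) (snd x)) \<in> borel_measurable (lborel \<Otimes>\<^sub>M lborel)"
    unfolding lborel_prod Complex_eq measurable_lborel2
    by (intro borel_measurable_continuous_onI continuous_intros)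
  have eq: "(\<integral>\<^sup>+z. f z \<partial>lborel) = (\<integral>\<^sup>+x. f (Complex (fst x) (snd x)) \<partial>(lborel \<Otimes>\<^sub>M lborel))"
    by (subst lborel_complex_eq_distr, subst nn_integral_distr) auto
  have mm: "(\<lambda>x. f (Complex (fst x) (snd x))) \<in> borel_measurable (lborel \<Otimes>\<^sub>M lborel)"
    by measurable
  show "(\<integral>\<^sup>+z. f z \<partial>lborel) = (\<integral>\<^sup>+x. \<integral>\<^sup>+y. f (Complex x y) \<partial>lborel \<partial>lborel)"
    unfolding eq by (subst lborel.nn_integral_fst[OF mm, symmetric]) simp
  show "(\<integral>\<^sup>+z. f z \<partial>lborel) = (\<integral>\<^sup>+y. \<integral>\<^sup>+x. f (Complex x y) \<partial>lborel \<partial>lborel)"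
    unfolding eq by (subst lborel_pair.nn_integral_snd[OF mm[unfolded case_prod_beta'[symmetric]], symmetric, simplified]) simp
qed

lemma nn_integral_shear_Re:
  fixes f :: "complex \<Rightarrow> ennreal"
  assumes [measurable]: "f \<in> borel_measurable borel"
  shows "(\<integral>\<^sup>+z. f (z + of_real (k * Im z)) \<partial>lborel) = (\<integral>\<^sup>+z. f z \<partial>lborel)"
proof -
  have [measurable]: "(\<lambda>x. Complex x y) \<in> borel_measurable borel" for y
    by (simp add: Complex_eq)
  have "(\<integral>\<^sup>+z. f (z + of_real (k * Im z)) \<partial>lborel)
     = (\<integral>\<^sup>+y. \<integral>\<^sup>+x. f (Complex x y + of_real (k * Im (Complex x y))) \<partial>lborel \<partial>lborel)"
    by (intro nn_integral_complex_iterated(2)) measurable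
  also have "\<dots> = (\<integral>\<^sup>+y. \<integral>\<^sup>+x. f (Complex (k * y + 1 * x) y) \<partial>lborel \<partial>lborel)"
    by (intro nn_integral_cong arg_cong[where f=f]) (simp add: complex_eq_iff)
  also have "\<dots> = (\<integral>\<^sup>+y. \<integral>\<^sup>+x. f (Complex x y) \<partial>lborel \<partial>lborel)"
    by (rule nn_integral_cong)
      (subst nn_integral_real_affine[of "\<lambda>x. f (Complex x y)" 1 "k * y" for y], simp_all)
  finally show ?thesis by (simp add: nn_integral_complex_iterated(2))
qed

lemma nn_integral_shear_Im:
  fixes f :: "complex \<Rightarrow> ennreal"
  assumes [measurable]: "f \<in> borel_measurable borel"
  shows "(\<integral>\<^sup>+z. f (z + \<i> * of_real (k * Re z)) \<partial>lborel) = (\<integral>\<^sup>+z. f z \<partial>lborel)"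
proof -
  have [measurable]: "(\<lambda>y. Complex x y) \<in> borel_measurable borel" for x
    by (simp add: Complex_eq)
  have "(\<integral>\<^sup>+z. f (z + \<i> * of_real (k * Re z)) \<partial>lborel)
     = (\<integral>\<^sup>+x. \<integral>\<^sup>+y. f (Complex x y + \<i> * of_real (k * Re (Complex x y))) \<partial>lborel \<partial>lborel)"
    by (intro nn_integral_complex_iterated(1)) measurable
  also have "\<dots> = (\<integral>\<^sup>+x. \<integral>\<^sup>+y. f (Complex x (k * x + 1 * y)) \<partial>lborel \<partial>lborel)"
    by (intro nn_integral_cong arg_cong[where f=f]) (simp add: complex_eq_iff)
  also have "\<dots> = (\<integral>\<^sup>+x. \<integral>\<^sup>+y. f (Complex x y) \<partial>lborel \<partial>lborel)"
    by (rule nn_integral_cong)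
      (subst nn_integral_real_affine[of "\<lambda>y. f (Complex x y)" 1 "k * x" for x], simp_all)
  finally show ?thesis by (simp add: nn_integral_complex_iterated(1))
qed

text \<open>Shears preserve area by Fubini, hence so do rotations; this replaces polar coordinates.\<close>

lemma rotation_as_shears:
  assumes "cos (\<theta> / 2) \<noteq> 0"
  shows "cis \<theta> * z = (let k = - tan (\<theta> / 2); z1 = z + of_real (k * Im z); z2 = z1 + \<i> * of_real (sin \<theta> * Re z1)
     in z2 + of_real (k * Im z2))"
proof -
  have s: "sin \<theta> = 2 * sin (\<theta>/2) * cos (\<theta>/2)" using sin_double[of "\<theta>/2"] by simp
  have c: "cos \<theta> = 1 - 2 * (sin (\<theta>/2))\<^sup>2" using cos_double_sin[of "\<theta>/2"] by simp
  have ts: "tan (\<theta>/2) * sin \<theta> = 1 - cos \<theta>" using assms by (simp add: s c tan_def power2_eq_square)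
  have tc: "tan (\<theta>/2) * (1 + cos \<theta>) = sin \<theta>"
  proof -
    have "1 + cos \<theta> = 2 * (cos (\<theta>/2))\<^sup>2" using cos_double_cos[of "\<theta>/2"] by simp
    then show ?thesis using assms by (simp add: s tan_def power2_eq_square)
  qed
  define T where "T = tan (\<theta>/2)"
  define x where "x = Re z" define y where "y = Im z"
  have "cos \<theta> = 1 - T * sin \<theta>" using ts by (simp add: T_def)
  then have cx: "cos \<theta> * u = u - T * sin \<theta> * u" for u by (simp add: left_diff_distrib)
  have "sin \<theta> * u = 2 * T * u - T * (T * sin \<theta>) * u" for u
  proof -
    have "2 - T * sin \<theta> = 1 + cos \<theta>" using ts by (simp add: T_def)
    then have "sin \<theta> = T * (2 - T * sin \<theta>)" using tc by (simp only: T_def)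
    then show ?thesis by (metis (no_types, opaque_lifting) left_diff_distrib mult.assoc mult.commute right_diff_distrib')
  qed
  note sx = this
  show ?thesis
    unfolding Let_def T_def[symmetric]
    by (rule complex_eqI; use cx[of x] cx[of y] sx[of y] in \<open>simp add: x_def[symmetric] y_def[symmetric] algebra_simps\<close>)
qed

text \<open>The condition excludes the half turn, where \<open>tan (\<theta> / 2)\<close> has its
  pole; the angles chosen for the orthogonality of monomials are at most
  \<open>pi / 2\<close>.\<close>

lemma nn_integral_rotation:
  fixes f :: "complex \<Rightarrow> ennreal"
  assumes [measurable]: "f \<in> borel_measurable borel" and c: "cos (\<theta> / 2) \<noteq> 0"
  shows "(\<integral>\<^sup>+z. f (cis \<theta> * z) \<partial>lborel) = (\<integral>\<^sup>+z. f z \<partial>lborel)"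
proof -
  define k where "k = - tan (\<theta> / 2)"
  define f1 where "f1 = (\<lambda>z. f (z + of_real (k * Im z)))"
  define f2 where "f2 = (\<lambda>z. f1 (z + \<i> * of_real (sin \<theta> * Re z)))"
  have m1[measurable]: "f1 \<in> borel_measurable borel" unfolding f1_def by measurable
  have m2[measurable]: "f2 \<in> borel_measurable borel" unfolding f2_def by measurable
  have "(\<integral>\<^sup>+z. f (cis \<theta> * z) \<partial>lborel) = (\<integral>\<^sup>+z. f2 (z + of_real (k * Im z)) \<partial>lborel)"
    unfolding f2_def f1_def rotation_as_shears[OF c] Let_def k_def ..
  also have "\<dots> = (\<integral>\<^sup>+z. f2 z \<partial>lborel)" by (rule nn_integral_shear_Re[OF m2])
  also have "\<dots> = (\<integral>\<^sup>+z. f1 z \<partial>lborel)" unfolding f2_def by (rule nn_integral_shear_Im[OF m1])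
  also have "\<dots> = (\<integral>\<^sup>+z. f z \<partial>lborel)" unfolding f1_def by (rule nn_integral_shear_Re) measurable
  finally show ?thesis .
qed

lemma lborel_distr_rotation:
  assumes c: "cos (\<theta> / 2) \<noteq> 0"
  shows "distr lborel borel ((*) (cis \<theta>)) = lborel"
proof (rule measure_eqI)
  fix A assume "A \<in> sets (distr lborel borel ((*) (cis \<theta>)))"
  then have [measurable]: "A \<in> sets borel" by simp
  have "emeasure (distr lborel borel ((*) (cis \<theta>))) A = (\<integral>\<^sup>+z. indicator A z \<partial>distr lborel borel ((*) (cis \<theta>)))"
    by simp
  also have "\<dots> = (\<integral>\<^sup>+z. indicator A (cis \<theta> * z) \<partial>lborel)"
    by (subst nn_integral_distr) auto
  also have "\<dots> = (\<integral>\<^sup>+z. indicator A z \<partial>lborel)"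
    by (rule nn_integral_rotation[OF _ c]) measurable
  finally show "emeasure (distr lborel borel ((*) (cis \<theta>))) A = emeasure lborel A" by simp
qed simp

lemma set_integral_ball_rotation:
  fixes f :: "complex \<Rightarrow> complex"
  assumes c: "cos (\<theta> / 2) \<noteq> 0" and [measurable]: "f \<in> borel_measurable borel"
  shows "(LINT z:ball 0 R|lborel. f (cis \<theta> * z)) = (LINT z:ball 0 R|lborel. f z)"
proof -
  have "(LINT z:ball 0 R|lborel. f z) = (LINT z|distr lborel borel ((*) (cis \<theta>)). indicator (ball 0 R) z *\<^sub>R f z)"
    by (simp add: set_lebesgue_integral_def lborel_distr_rotation[OF c])
  also have "\<dots> = (LINT z|lborel. indicator (ball 0 R) (cis \<theta> * z) *\<^sub>R f (cis \<theta> * z))"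
    by (subst integral_distr) (auto intro!: borel_measurable_scaleR borel_measurable_indicator)
  also have "\<dots> = (LINT z:ball 0 R|lborel. f (cis \<theta> * z))"
    by (simp add: set_lebesgue_integral_def indicator_def norm_mult)
  finally show ?thesis by simp
qed

text \<open>Rotation multiplies the integral by \<open>cis ((m - n) * \<theta>)\<close>. The angle
  is chosen so that this factor is \<open>\<i>\<close> or \<open>- \<i>\<close>, hence different
  from 1.\<close>

lemma disk_monomials_orthogonal:
  assumes "m \<noteq> n"
  shows "(LINT z:ball 0 R|lborel. z ^ m * cnj (z ^ n)) = 0"
proof -
  define k where "k = (int m - int n)"
  define \<theta> where "\<theta> = pi / (2 * of_int \<bar>k\<bar>)"
  have k1: "real_of_int \<bar>k\<bar> \<ge> 1" using assms by (simp add: k_def)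
  have \<theta>: "0 < \<theta>" "\<theta> \<le> pi / 2" using k1 by (auto simp: \<theta>_def field_simps)
  have c: "cos (\<theta> / 2) \<noteq> 0" using \<theta> cos_gt_zero_pi[of "\<theta> / 2"] by auto
  define J where "J = (LINT z:ball 0 R|lborel. z ^ m * cnj (z ^ n))"
  have [measurable]: "cnj \<in> borel_measurable borel"
    by (intro borel_measurable_continuous_onI continuous_intros)
  have "J = (LINT z:ball 0 R|lborel. (cis \<theta> * z) ^ m * cnj ((cis \<theta> * z) ^ n))"
    unfolding J_def by (rule set_integral_ball_rotation[OF c, symmetric]) measurable
  also have "\<dots> = (LINT z:ball 0 R|lborel. cis (of_int k * \<theta>) * (z ^ m * cnj (z ^ n)))"
  proof -
    have "(cis \<theta> * z) ^ m * cnj ((cis \<theta> * z) ^ n) = cis (of_int k * \<theta>) * (z ^ m * cnj (z ^ n))" for z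
    proof -
      have "cis \<theta> ^ m * cnj (cis \<theta> ^ n) = cis (of_int k * \<theta>)"
        unfolding complex_cnj_power cis_cnj Complex.DeMoivre cis_mult k_def by (rule arg_cong[where f=cis]) (simp add: algebra_simps)
      then show ?thesis by (simp add: power_mult_distrib algebra_simps)
    qed
    then show ?thesis by simp
  qed
  also have "\<dots> = cis (of_int k * \<theta>) * J" by (simp add: J_def)
  finally have J: "J = cis (of_int k * \<theta>) * J" .
  have "cis (of_int k * \<theta>) \<noteq> 1"
  proof
    assume "cis (of_int k * \<theta>) = 1"
    moreover have "of_int k * \<theta> = pi / 2 \<or> of_int k * \<theta> = - (pi / 2)"
      using k1 by (auto simp: \<theta>_def abs_if field_simps split: if_splits)
    from this have "cos (of_int k * \<theta>) = 0" by (elim disjE) (simp_all only: cos_minus cos_pi_half)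
    ultimately show False by (simp add: complex_eq_iff)
  qed
  with J have "J = 0" by auto
  then show ?thesis by (simp add: J_def)
qed

lemma set_integrable_ball_continuous:
  fixes f :: "complex \<Rightarrow> 'b::{banach, second_countable_topology}"
  assumes "continuous_on (cball 0 R) f"
  shows "set_integrable lborel (ball 0 R) f"
proof (rule set_integrable_subset[of _ "cball 0 R"])
  show "set_integrable lborel (cball 0 R) f"
    unfolding set_integrable_def by (rule borel_integrable_compact) (use assms in auto)
qed auto

text \<open>
  By scaling, the moment over the ball of radius \<open>\<rho>\<close> is \<open>\<rho> ^ (2 n + 2)\<close> times the moment \<open>I\<close> over the unit
  ball. On the annulus in between, \<open>cmod z ^ (2 n)\<close> lies between \<open>\<rho> ^ (2 n)\<close> and 1, and \<open>\<rho> \<rightarrow> 1\<close>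
  yields \<open>I\<close>.
\<close>

lemma disk_moment:
  assumes R: "R > 0"
  shows "(LINT z:ball (0::complex) R|lborel. cmod z ^ (2 * n)) = pi * R ^ (2 * n + 2) / (real n + 1)"
proof -
  define I where "I = (\<lambda>R. LINT z:ball (0::complex) R|lborel. cmod z ^ (2 * n))"
  have scale: "I c = c ^ (2 * n + 2) * I 1" if c: "c > 0" for c
  proof -
    have "I c = (LINT z|density (distr lborel borel (\<lambda>x::complex. 0 + c *\<^sub>R x)) (\<lambda>_. ennreal (c\<^sup>2)).
         indicator (ball 0 c) z *\<^sub>R cmod z ^ (2 * n))"
      unfolding I_def set_lebesgue_integral_def using lborel_affine[of c "0::complex"] c
      by (simp add: power2_eq_square)
    also have "\<dots> = (LINT z|lborel. c\<^sup>2 *\<^sub>R (indicator (ball 0 c) (c *\<^sub>R z) *\<^sub>R cmod (c *\<^sub>R z) ^ (2 * n)))"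
      by (subst integral_density; (subst integral_distr)?) (auto intro!: borel_measurable_scaleR borel_measurable_times borel_measurable_indicator)
    also have "\<dots> = (LINT z|lborel. c ^ (2 * n + 2) * (indicator (ball (0::complex) 1) z *\<^sub>R cmod z ^ (2 * n)))"
    proof (rule Bochner_Integration.integral_cong[OF refl])
      fix z :: complex
      have "indicator (ball 0 c) (c *\<^sub>R z) = (indicator (ball 0 1) z :: real)"
        using c by (auto simp: indicator_def)
      then show "c\<^sup>2 *\<^sub>R (indicator (ball 0 c) (c *\<^sub>R z) *\<^sub>R cmod (c *\<^sub>R z) ^ (2 * n))
         = c ^ (2 * n + 2) * (indicator (ball (0::complex) 1) z *\<^sub>R cmod z ^ (2 * n))"
        using c by (simp add: power_mult_distrib power_add power2_eq_square)
    qed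
    finally show ?thesis by (simp add: I_def set_lebesgue_integral_def)
  qed
  have sq: "I 1 * (\<Sum>k<Suc n. (\<rho>\<^sup>2) ^ k) \<le> pi \<and> \<rho> ^ (2 * n) * pi \<le> I 1 * (\<Sum>k<Suc n. (\<rho>\<^sup>2) ^ k)"
    if \<rho>: "0 < \<rho>" "\<rho> < 1" for \<rho>
  proof -
    let ?i = "\<lambda>r z. indicat_real (ball (0::complex) r) z"
    have int1: "integrable lborel (\<lambda>z. ?i r z * cmod z ^ (2 * n))" for r
      using set_integrable_ball_continuous[of r "\<lambda>z. cmod z ^ (2 * n)"]
      by (auto simp: set_integrable_def intro!: continuous_intros)
    have int0: "integrable lborel (?i r)" for r
      using set_integrable_ball_continuous[of r "\<lambda>z. 1::real"] by (simp add: set_integrable_def)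
    have m0: "(LINT z|lborel. ?i r z) = pi * r\<^sup>2" if "r > 0" for r
      using that content_ball[of r "0::complex"] by (simp add: unit_ball_vol_2)
    have Ir: "(LINT z|lborel. ?i r z * cmod z ^ (2 * n)) = I r" for r
      by (simp add: I_def set_lebesgue_integral_def)
    have D: "(LINT z|lborel. ?i 1 z * cmod z ^ (2 * n) - ?i \<rho> z * cmod z ^ (2 * n)) = I 1 - I \<rho>"
      using int1 by (subst Bochner_Integration.integral_diff) (auto simp: Ir)
    have E: "(LINT z|lborel. ?i 1 z - ?i \<rho> z) = pi - pi * \<rho>\<^sup>2"
      unfolding Bochner_Integration.integral_diff[OF int0 int0] m0[OF zero_less_one] m0[OF \<rho>(1)] by simp
    have pw: "\<rho> ^ (2 * n) * (?i 1 z - ?i \<rho> z) \<le> ?i 1 z * cmod z ^ (2 * n) - ?i \<rho> z * cmod z ^ (2 * n)"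
         "?i 1 z * cmod z ^ (2 * n) - ?i \<rho> z * cmod z ^ (2 * n) \<le> ?i 1 z - ?i \<rho> z" for z
      using \<rho> by (auto simp: indicator_def intro!: power_mono power_le_one)
    have up: "I 1 - I \<rho> \<le> pi - pi * \<rho>\<^sup>2"
      unfolding D[symmetric] E[symmetric] by (intro integral_mono pw Bochner_Integration.integrable_diff int1 int0)
    have "(LINT z|lborel. \<rho> ^ (2 * n) * (?i 1 z - ?i \<rho> z)) \<le> I 1 - I \<rho>"
      unfolding D[symmetric] by (intro integral_mono pw Bochner_Integration.integrable_diff int1 int0 integrable_mult_right)
    then have lo: "\<rho> ^ (2 * n) * (pi - pi * \<rho>\<^sup>2) \<le> I 1 - I \<rho>"
      by (simp only: integral_mult_right_zero E)
    \<comment> \<open>The factor \<open>1 - \<rho>^2\<close> occurs in all three terms and cancels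
      before the limit; the geometric sum that remains tends to \<open>n + 1\<close>.\<close>
    have geo: "1 - (\<rho>\<^sup>2) ^ Suc n = (1 - \<rho>\<^sup>2) * (\<Sum>k<Suc n. (\<rho>\<^sup>2) ^ k)"
      by (rule one_diff_power_eq)
    have "I 1 - I \<rho> = (1 - (\<rho>\<^sup>2) ^ Suc n) * I 1"
    proof -
      have "\<rho> ^ (2 * n + 2) = (\<rho>\<^sup>2) ^ Suc n" unfolding power_mult[symmetric] by simp
      then show ?thesis unfolding scale[OF \<rho>(1)] by (simp only: left_diff_distrib mult_1_left)
    qed
    then have d: "I 1 - I \<rho> = (1 - \<rho>\<^sup>2) * (I 1 * (\<Sum>k<Suc n. (\<rho>\<^sup>2) ^ k))"
      unfolding geo by (simp only: mult_ac)
    have pos: "1 - \<rho>\<^sup>2 > 0" using \<rho> by (simp add: power_less_one_iff)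
    have "(1 - \<rho>\<^sup>2) * (I 1 * (\<Sum>k<Suc n. (\<rho>\<^sup>2) ^ k)) \<le> (1 - \<rho>\<^sup>2) * pi"
      using up unfolding d by (simp add: algebra_simps)
    moreover have "(1 - \<rho>\<^sup>2) * (\<rho> ^ (2 * n) * pi) \<le> (1 - \<rho>\<^sup>2) * (I 1 * (\<Sum>k<Suc n. (\<rho>\<^sup>2) ^ k))"
      using lo unfolding d by (simp add: algebra_simps)
    ultimately show ?thesis using pos by (simp only: mult_le_cancel_left_pos)
  qed
  have ev: "\<forall>\<^sub>F \<rho> in at_left (1::real). 0 < \<rho> \<and> \<rho> < 1"
    by (auto simp: eventually_at_left_field intro!: exI[of _ 0])
  have lim1: "((\<lambda>\<rho>. I 1 * (\<Sum>k<Suc n. (\<rho>\<^sup>2) ^ k)) \<longlongrightarrow> I 1 * (\<Sum>k<Suc n. (1\<^sup>2) ^ k)) (at_left (1::real))"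
    by (intro tendsto_intros)
  have lim2: "((\<lambda>\<rho>. \<rho> ^ (2 * n) * pi) \<longlongrightarrow> 1 ^ (2 * n) * pi) (at_left (1::real))"
    by (intro tendsto_intros)
  have "I 1 * (\<Sum>k<Suc n. (1\<^sup>2) ^ k) \<le> pi"
    by (rule tendsto_upperbound[OF lim1]) (use ev sq in \<open>auto elim: eventually_mono\<close>)
  moreover have "1 ^ (2 * n) * pi \<le> I 1 * (\<Sum>k<Suc n. (1\<^sup>2) ^ k)"
    by (rule tendsto_le[OF _ lim1 lim2]) (use ev sq in \<open>auto elim: eventually_mono\<close>)
  ultimately have "I 1 * (real n + 1) = pi" by (simp add: algebra_simps)
  then have "I 1 = pi / (real n + 1)" by (simp add: field_simps)
  then show ?thesis using scale[OF R] by (simp add: I_def)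
qed

section \<open>Taylor coefficients of functions on the disk\<close>

definition tcoeff :: "(complex \<Rightarrow> complex) \<Rightarrow> nat \<Rightarrow> complex" where
  "tcoeff f n = (deriv ^^ n) f 0 / fact n"

lemma tcoeff_sums:
  assumes "f holomorphic_on ball 0 1" "cmod z < 1"
  shows "(\<lambda>n. tcoeff f n * z ^ n) sums f z"
  using holomorphic_power_series[OF assms(1), of z] assms(2) by (simp add: tcoeff_def)

lemma tcoeff_abs_summable:
  assumes f: "f holomorphic_on ball 0 1" and R: "0 \<le> R" "R < 1"
  shows "summable (\<lambda>n. cmod (tcoeff f n) * R ^ n)"
proof -
  obtain R' where R': "R < R'" "R' < 1" using R(2) dense by blast
  have "summable (\<lambda>n. tcoeff f n * of_real R' ^ n)"
    using tcoeff_sums[OF f, of "of_real R'"] R R' by (auto simp: sums_iff)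
  from powser_insidea[OF this, of "of_real R"] show ?thesis
    using R R' by (simp add: norm_mult norm_power)
qed

lemma disk_partial_sum_norm:
  assumes R: "0 < R"
  shows "(LINT z:ball 0 R|lborel. (cmod (\<Sum>n<N. c n * z ^ n))\<^sup>2)
     = (\<Sum>n<N. (cmod (c n))\<^sup>2 * (pi * R ^ (2 * n + 2) / (real n + 1)))"
proof -
  have int: "set_integrable lborel (ball 0 R) (\<lambda>z. c n * cnj (c m) * (z ^ n * cnj (z ^ m)))" for n m
    by (intro set_integrable_ball_continuous continuous_intros)
  have "complex_of_real (LINT z:ball 0 R|lborel. (cmod (\<Sum>n<N. c n * z ^ n))\<^sup>2)
     = (LINT z:ball 0 R|lborel. complex_of_real ((cmod (\<Sum>n<N. c n * z ^ n))\<^sup>2))"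
    by (rule set_integral_complex_of_real[symmetric])
  also have "\<dots> = (LINT z:ball 0 R|lborel. (\<Sum>n<N. \<Sum>m<N. c n * cnj (c m) * (z ^ n * cnj (z ^ m))))"
    unfolding complex_norm_square cnj_sum sum_product by (simp add: mult_ac)
  also have "\<dots> = (\<Sum>n<N. \<Sum>m<N. LINT z:ball 0 R|lborel. c n * cnj (c m) * (z ^ n * cnj (z ^ m)))"
    unfolding set_lebesgue_integral_def scaleR_sum_right
    by (simp only: Bochner_Integration.integral_sum Bochner_Integration.integrable_sum int[unfolded set_integrable_def])
  also have "\<dots> = (\<Sum>n<N. \<Sum>m<N. if m = n then c n * cnj (c n) * of_real (pi * R ^ (2 * n + 2) / (real n + 1)) else 0)"
  proof (intro sum.cong refl)
    fix n m
    have "(LINT z:ball 0 R|lborel. z ^ n * cnj (z ^ n)) = (LINT z:ball 0 R|lborel. complex_of_real (cmod z ^ (2 * n)))"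
      unfolding complex_norm_square[symmetric] norm_power power_mult[symmetric] by (simp only: mult.commute)
    also have "\<dots> = of_real (pi * R ^ (2 * n + 2) / (real n + 1))"
      by (simp only: set_integral_complex_of_real disk_moment[OF R])
    finally show "(LINT z:ball 0 R|lborel. c n * cnj (c m) * (z ^ n * cnj (z ^ m)))
       = (if m = n then c n * cnj (c n) * of_real (pi * R ^ (2 * n + 2) / (real n + 1)) else 0)"
      using disk_monomials_orthogonal[of n m R] by (auto simp del: complex_cnj_power)
  qed
  also have "\<dots> = (\<Sum>n<N. c n * cnj (c n) * of_real (pi * R ^ (2 * n + 2) / (real n + 1)))"
    by (simp add: sum.delta)
  also have "\<dots> = complex_of_real (\<Sum>n<N. (cmod (c n))\<^sup>2 * (pi * R ^ (2 * n + 2) / (real n + 1)))"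
    by (simp only: complex_norm_square[symmetric] of_real_mult[symmetric] of_real_sum)
  finally show ?thesis by (simp only: of_real_eq_iff)
qed

text \<open>For \<open>R < 1\<close> the Taylor polynomials are bounded uniformly by the absolutely
  convergent sum \<open>B\<close>, so dominated convergence carries the finite identity to the
  limit. At radius 1 such a bound may fail, hence the separate argument in
  \<open>parseval_disk\<close>.\<close>

lemma parseval_ball:
  assumes f: "f holomorphic_on ball 0 1" and R: "0 < R" "R < 1"
  shows "(\<lambda>n. (cmod (tcoeff f n))\<^sup>2 * (pi * R ^ (2 * n + 2) / (real n + 1))) sums
     (LINT z:ball 0 R|lborel. (cmod (f z))\<^sup>2)"
proof -
  define s where "s = (\<lambda>N z. \<Sum>n<N. tcoeff f n * z ^ n)"
  define B where "B = (\<Sum>n. cmod (tcoeff f n) * R ^ n)"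
  have sm: "summable (\<lambda>n. cmod (tcoeff f n) * R ^ n)" using tcoeff_abs_summable[OF f] R by simp
  have cont: "continuous_on (cball 0 R) f"
    using f R by (intro holomorphic_on_imp_continuous_on holomorphic_on_subset[OF f]) auto
  have sB: "cmod (s N z) \<le> B" if "cmod z < R" for N z
  proof -
    have "cmod (s N z) \<le> (\<Sum>n<N. cmod (tcoeff f n * z ^ n))" unfolding s_def by (rule norm_sum)
    also have "\<dots> \<le> (\<Sum>n<N. cmod (tcoeff f n) * R ^ n)"
      using that by (intro sum_mono) (auto simp: norm_mult norm_power intro!: mult_left_mono power_mono)
    also have "\<dots> \<le> B" unfolding B_def using R sm by (intro sum_le_suminf) auto
    finally show ?thesis .
  qed
  have "(\<lambda>N. LINT z|lborel. indicat_real (ball 0 R) z *\<^sub>R (cmod (s N z))\<^sup>2) \<longlonglongrightarrow>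
      (LINT z|lborel. indicat_real (ball 0 R) z *\<^sub>R (cmod (f z))\<^sup>2)"
  proof (rule integral_dominated_convergence[where w="\<lambda>z. indicator (ball 0 R) z * B\<^sup>2"])
    show "(\<lambda>z. indicat_real (ball 0 R) z *\<^sub>R (cmod (f z))\<^sup>2) \<in> borel_measurable lborel"
      by (rule borel_measurable_integrable, fold set_integrable_def)
        (intro set_integrable_ball_continuous continuous_intros cont)
    show "(\<lambda>z. indicat_real (ball 0 R) z *\<^sub>R (cmod (s N z))\<^sup>2) \<in> borel_measurable lborel" for N
      by (rule borel_measurable_integrable, fold set_integrable_def)
        (unfold s_def, intro set_integrable_ball_continuous continuous_intros)
    show "integrable lborel (\<lambda>z. indicat_real (ball (0::complex) R) z * B\<^sup>2)"
      using set_integrable_ball_continuous[of R "\<lambda>z. B\<^sup>2"] by (simp add: set_integrable_def)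
    show "AE z in lborel. (\<lambda>N. indicat_real (ball 0 R) z *\<^sub>R (cmod (s N z))\<^sup>2) \<longlonglongrightarrow> indicat_real (ball 0 R) z *\<^sub>R (cmod (f z))\<^sup>2"
    proof (rule AE_I2)
      fix z :: complex
      show "(\<lambda>N. indicat_real (ball 0 R) z *\<^sub>R (cmod (s N z))\<^sup>2) \<longlonglongrightarrow> indicat_real (ball 0 R) z *\<^sub>R (cmod (f z))\<^sup>2"
      proof (cases "z \<in> ball 0 R")
        case True
        then have "(\<lambda>N. s N z) \<longlonglongrightarrow> f z"
          using tcoeff_sums[OF f, of z] R by (simp add: sums_def s_def)
        then show ?thesis by (intro tendsto_intros)
      qed auto
    qed
    show "AE z in lborel. norm (indicat_real (ball 0 R) z *\<^sub>R (cmod (s N z))\<^sup>2) \<le> indicat_real (ball 0 R) z * B\<^sup>2" for N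
      using sB by (auto simp: indicator_def intro!: power_mono)
  qed
  then show ?thesis
    unfolding sums_def set_lebesgue_integral_def[symmetric] s_def disk_partial_sum_norm[OF R(1)] .
qed

text \<open>Both implications exhaust the disk by smaller balls. Given integrability, each partial
  sum is bounded and \<open>R\<close> tends to 1; given summability, monotone convergence yields
  integrability. The two resulting inequalities together give the value.\<close>

lemma parseval_disk:
  assumes f: "f holomorphic_on ball 0 1"
  shows parseval_disk_iff: "set_integrable lborel (ball 0 1) (\<lambda>z. (cmod (f z))\<^sup>2)
       \<longleftrightarrow> summable (\<lambda>n. (cmod (tcoeff f n))\<^sup>2 / (real n + 1))" (is "?A \<longleftrightarrow> ?B")
    and parseval_disk_sums: "set_integrable lborel (ball 0 1) (\<lambda>z. (cmod (f z))\<^sup>2) \<Longrightarrow>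
       (\<lambda>n. (cmod (tcoeff f n))\<^sup>2 / (real n + 1)) sums ((LINT z:ball 0 1|lborel. (cmod (f z))\<^sup>2) / pi)"
proof -
  let ?a = "\<lambda>n. (cmod (tcoeff f n))\<^sup>2 / (real n + 1)"
  have contR: "continuous_on (cball 0 R) f" if "R < 1" for R
    using f that by (intro holomorphic_on_imp_continuous_on holomorphic_on_subset[OF f]) auto
  have intR: "set_integrable lborel (ball 0 R) (\<lambda>z. (cmod (f z))\<^sup>2)" if "R < 1" for R
    using contR[OF that] by (intro set_integrable_ball_continuous continuous_intros)
  have 1: "summable ?a \<and> pi * suminf ?a \<le> (LINT z:ball 0 1|lborel. (cmod (f z))\<^sup>2)" if A: ?A
  proof -
    let ?L = "LINT z:ball 0 1|lborel. (cmod (f z))\<^sup>2"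
    have part: "pi * (\<Sum>n<N. ?a n) \<le> ?L" for N
    proof -
      have "(\<Sum>n<N. (cmod (tcoeff f n))\<^sup>2 * (pi * R ^ (2 * n + 2) / (real n + 1))) \<le> ?L" if R: "0 < R" "R < 1" for R
      proof -
        note P = parseval_ball[OF f R]
        have "(\<Sum>n<N. (cmod (tcoeff f n))\<^sup>2 * (pi * R ^ (2 * n + 2) / (real n + 1)))
          \<le> (LINT z:ball 0 R|lborel. (cmod (f z))\<^sup>2)"
          unfolding sums_unique[OF P] using R sums_summable[OF P] by (intro sum_le_suminf) auto
        also have "\<dots> \<le> ?L"
          using intR[OF R(2)] A R unfolding set_lebesgue_integral_def set_integrable_def
          by (intro integral_mono) (auto simp: indicator_def)
        finally show ?thesis .
      qed
      then have ev: "\<forall>\<^sub>F R in at_left (1::real). (\<Sum>n<N. (cmod (tcoeff f n))\<^sup>2 * (pi * R ^ (2 * n + 2) / (real n + 1))) \<le> ?L"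
        by (auto simp: eventually_at_left_field intro!: exI[of _ 0])
      have "((\<lambda>R. \<Sum>n<N. (cmod (tcoeff f n))\<^sup>2 * (pi * R ^ (2 * n + 2) / (real n + 1)))
          \<longlongrightarrow> (\<Sum>n<N. (cmod (tcoeff f n))\<^sup>2 * (pi * 1 ^ (2 * n + 2) / (real n + 1)))) (at_left (1::real))"
        by (intro tendsto_intros) auto
      from tendsto_upperbound[OF this ev] have "(\<Sum>n<N. (cmod (tcoeff f n))\<^sup>2 * (pi * 1 ^ (2 * n + 2) / (real n + 1))) \<le> ?L"
        by simp
      then show ?thesis by (simp add: sum_distrib_left mult_ac)
    qed
    have "summable ?a"
    proof (rule summableI_nonneg_bounded)
      show "(\<Sum>n<N. ?a n) \<le> ?L / pi" for N using part[of N] by (simp add: field_simps)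
    qed auto
    moreover from this have "suminf ?a \<le> ?L / pi"
      using part by (intro suminf_le_const) (auto simp: field_simps)
    ultimately show ?thesis by (simp add: field_simps)
  qed
  have 2: "?A \<and> (LINT z:ball 0 1|lborel. (cmod (f z))\<^sup>2) \<le> pi * suminf ?a" if B: ?B
  proof -
    \<comment> \<open>Increasing radii with limit 1; the 2 keeps \<open>r 0\<close>
      positive.\<close>
    define r where "r = (\<lambda>k. 1 - 1 / (real k + 2))"
    have r: "0 < r k" "r k < 1" for k by (auto simp: r_def field_simps)
    have rm: "r k \<le> r l" if "k \<le> l" for k l using that by (auto simp: r_def field_simps)
    have rl: "r \<longlonglongrightarrow> 1"
      unfolding r_def by real_asymp
    define J where "J = (\<lambda>k. LINT z|lborel. indicator (ball 0 (r k)) z *\<^sub>R (cmod (f z))\<^sup>2)"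
    have Jle: "J k \<le> pi * suminf ?a" for k
    proof -
      note P = parseval_ball[OF f r[of k]]
      have "J k = (\<Sum>n. (cmod (tcoeff f n))\<^sup>2 * (pi * r k ^ (2 * n + 2) / (real n + 1)))"
        using sums_unique[OF P] by (simp add: J_def set_lebesgue_integral_def)
      also have "\<dots> \<le> (\<Sum>n. pi * ?a n)"
      proof (rule suminf_le[OF _ sums_summable[OF P] summable_mult[OF B]])
        fix n
        have "r k ^ (2 * n + 2) \<le> 1" using r[of k] by (intro power_le_one) auto
        then have "pi * ?a n * r k ^ (2 * n + 2) \<le> pi * ?a n * 1"
          by (intro mult_left_mono) auto
        then show "(cmod (tcoeff f n))\<^sup>2 * (pi * r k ^ (2 * n + 2) / (real n + 1)) \<le> pi * ?a n"
          by (simp add: mult_ac)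
      qed
      also have "\<dots> = pi * suminf ?a" by (rule suminf_mult[OF B])
      finally show ?thesis .
    qed
    have Jm: "incseq J" unfolding J_def incseq_def
      using intR[OF r(2)] rm unfolding set_integrable_def
      by (auto intro!: integral_mono simp: indicator_def) (meson less_le_trans rm)
    obtain x where x: "J \<longlonglongrightarrow> x" "\<forall>i. J i \<le> x" using incseq_convergent[OF Jm] Jle by blast
    have xle: "x \<le> pi * suminf ?a" using x(1) Jle by (intro LIMSEQ_le_const2) auto
    have eqr: "(\<lambda>k. indicat_real (ball 0 (r k)) z *\<^sub>R (cmod (f z))\<^sup>2) \<longlonglongrightarrow> indicator (ball 0 1) z *\<^sub>R (cmod (f z))\<^sup>2" for z
    proof (cases "cmod z < 1")
      case True
      then have "\<forall>\<^sub>F k in sequentially. cmod z < r k" using order_tendstoD(1)[OF rl] by blast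
      then have "\<forall>\<^sub>F k in sequentially. indicat_real (ball 0 (r k)) z *\<^sub>R (cmod (f z))\<^sup>2 = indicator (ball 0 1) z *\<^sub>R (cmod (f z))\<^sup>2"
        by (rule eventually_mono) (use True in auto)
      then show ?thesis by (rule tendsto_eventually)
    next
      case False
      then have "\<not> cmod z < r k" for k using r(2)[of k] by linarith
      then show ?thesis using False by simp
    qed
    have meas: "(\<lambda>z. indicat_real (ball 0 1) z *\<^sub>R (cmod (f z))\<^sup>2) \<in> borel_measurable lborel"
    proof (rule borel_measurable_LIMSEQ_real)
      show "(\<lambda>z. indicat_real (ball 0 (r k)) z *\<^sub>R (cmod (f z))\<^sup>2) \<in> borel_measurable lborel" for k
        using intR[OF r(2)[of k]] by (auto simp: set_integrable_def)
    qed (rule eqr)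
    note mc = integral_monotone_convergence_nonneg[OF _ _ _ _ x(1)[unfolded J_def] meas]
    have "mono (\<lambda>n. indicat_real (ball 0 (r n)) z *\<^sub>R (cmod (f z))\<^sup>2)" for z
      by (auto simp: mono_def indicator_def) (meson less_le_trans rm)
    then have "integrable lborel (\<lambda>z. indicat_real (ball 0 1) z *\<^sub>R (cmod (f z))\<^sup>2)"
      "(LINT z|lborel. indicat_real (ball 0 1) z *\<^sub>R (cmod (f z))\<^sup>2) = x"
      using eqr intR[OF r(2), unfolded set_integrable_def] by (intro mc; simp)+
    then show ?thesis using xle by (simp add: set_integrable_def set_lebesgue_integral_def)
  qed
  show "?A \<longleftrightarrow> ?B" using 1 2 by blast
  show "?a sums ((LINT z:ball 0 1|lborel. (cmod (f z))\<^sup>2) / pi)" if ?A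
  proof -
    have "suminf ?a = (LINT z:ball 0 1|lborel. (cmod (f z))\<^sup>2) / pi"
      using 1[OF that] 2 by (auto simp: field_simps)
    then show ?thesis using 1[OF that] summable_sums by metis
  qed
qed

section \<open>The Bergman space\<close>

lemma tcoeff_unique:
  assumes "\<And>z. cmod z < 1 \<Longrightarrow> (\<lambda>n. c n * z ^ n) sums f z"
  shows "tcoeff f n = c n"
proof -
  \<comment> \<open>Convergence at the single point 1/2 already makes the radius of convergence
    positive.\<close>
  have "conv_radius c \<ge> ereal (norm (1/2 :: complex))"
    by (rule conv_radius_geI) (use assms[of "1/2"] in \<open>auto simp: sums_iff\<close>)
  then have "fps_conv_radius (Abs_fps c) > 0"
    unfolding fps_conv_radius_def by (simp add: order.strict_trans2[of 0 "ereal (1/2)"])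
  moreover have "eventually (\<lambda>z. z \<in> ball 0 1) (nhds (0::complex))"
    by (rule eventually_nhds_in_open) auto
  then have "eventually (\<lambda>z. eval_fps (Abs_fps c) z = f z) (nhds 0)"
    by (rule eventually_mono) (use assms in \<open>auto simp: eval_fps_def sums_iff\<close>)
  ultimately have "f has_fps_expansion Abs_fps c" by (simp add: has_fps_expansion_def)
  from fps_nth_fps_expansion[OF this, of n] show ?thesis by (simp add: tcoeff_def)
qed

lemma tcoeff_add:
  "f holomorphic_on ball 0 1 \<Longrightarrow> g holomorphic_on ball 0 1 \<Longrightarrow> tcoeff (\<lambda>z. f z + g z) n = tcoeff f n + tcoeff g n"
  by (simp add: tcoeff_def higher_deriv_add[of f "ball 0 1" g 0] add_divide_distrib)

lemma tcoeff_cmult: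
  "f holomorphic_on ball 0 1 \<Longrightarrow> tcoeff (\<lambda>z. k * f z) n = k * tcoeff f n"
  by (simp add: tcoeff_def higher_deriv_cmult[of f "ball 0 1" 0])

lemma tcoeff_diff:
  "f holomorphic_on ball 0 1 \<Longrightarrow> g holomorphic_on ball 0 1 \<Longrightarrow> tcoeff (\<lambda>z. f z - g z) n = tcoeff f n - tcoeff g n"
  by (simp add: tcoeff_def higher_deriv_diff[of f "ball 0 1" g 0] diff_divide_distrib)

lemma tcoeff_0: "tcoeff f 0 = f 0" by (simp add: tcoeff_def)

lemma tcoeff_shift:
  assumes f: "f holomorphic_on ball 0 1"
  shows "tcoeff (\<lambda>z. z * f z) n = (if n = 0 then 0 else tcoeff f (n - 1))"
proof (rule tcoeff_unique)
  fix z :: complex assume "cmod z < 1"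
  then have "(\<lambda>n. z * (tcoeff f n * z ^ n)) sums (z * f z)" by (intro sums_mult tcoeff_sums f)
  then have "(\<lambda>n. (if Suc n = 0 then 0 else tcoeff f (Suc n - 1)) * z ^ Suc n) sums (z * f z)"
    by (simp add: mult_ac)
  from sums_Suc[OF this] show "(\<lambda>n. (if n = 0 then 0 else tcoeff f (n - 1)) * z ^ n) sums (z * f z)"
    by simp
qed

lemma bergman_holomorphic: "f \<in> bergman_space \<Longrightarrow> f holomorphic_on ball 0 1"
  by (simp add: bergman_space_def)

lemma bergman_outside: "f \<in> bergman_space \<Longrightarrow> \<not> cmod z < 1 \<Longrightarrow> f z = 0"
  by (auto simp: bergman_space_def)

lemma bergman_sq_integrable:
  "f \<in> bergman_space \<Longrightarrow> set_integrable lborel (ball 0 1) (\<lambda>z. (cmod (f z))\<^sup>2)"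
  by (simp add: bergman_space_def)

lemma bergman_eqI:
  "f \<in> bergman_space \<Longrightarrow> g \<in> bergman_space \<Longrightarrow> (\<And>z. cmod z < 1 \<Longrightarrow> f z = g z) \<Longrightarrow> f = g"
  by (rule ext) (metis bergman_outside)

lemma bergman_eqI_tcoeff:
  assumes "f \<in> bergman_space" "g \<in> bergman_space" "\<And>n. tcoeff f n = tcoeff g n"
  shows "f = g"
proof (rule bergman_eqI[OF assms(1,2)])
  fix z :: complex assume "cmod z < 1"
  then show "f z = g z"
    using tcoeff_sums[OF bergman_holomorphic[OF assms(1)], of z] tcoeff_sums[OF bergman_holomorphic[OF assms(2)], of z] assms(3)
    by (simp add: sums_iff)
qed

text \<open>By Parseval the integrability condition becomes a weighted square summability condition,
  under which operators can be defined coefficientwise.\<close>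

lemma bergman_iff:
  "f \<in> bergman_space \<longleftrightarrow> f holomorphic_on ball 0 1 \<and> (\<forall>z. \<not> cmod z < 1 \<longrightarrow> f z = 0) \<and>
     summable (\<lambda>n. (cmod (tcoeff f n))\<^sup>2 / (real n + 1))"
  unfolding bergman_space_def using parseval_disk_iff by auto

lemma disk_norm_nonneg: "disk_norm f \<ge> 0"
  by (simp add: disk_norm_def set_lebesgue_integral_def)

lemma disk_norm_sq: "(disk_norm f)\<^sup>2 = (LINT z:ball 0 1|lborel. (cmod (f z))\<^sup>2) / pi"
  by (simp add: disk_norm_def set_lebesgue_integral_def)

lemma disk_norm_sums:
  "f \<in> bergman_space \<Longrightarrow> (\<lambda>n. (cmod (tcoeff f n))\<^sup>2 / (real n + 1)) sums (disk_norm f)\<^sup>2"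
  unfolding disk_norm_sq by (rule parseval_disk_sums) (auto simp: bergman_space_def)

lemma tcoeff_le_disk_norm:
  assumes "f \<in> bergman_space"
  shows "cmod (tcoeff f n) \<le> sqrt (real n + 1) * disk_norm f"
proof -
  have "(cmod (tcoeff f n))\<^sup>2 / (real n + 1) \<le> (disk_norm f)\<^sup>2"
    unfolding sums_unique[OF disk_norm_sums[OF assms]]
    using sum_le_suminf[OF sums_summable[OF disk_norm_sums[OF assms]], of "{n}"] by simp
  then have "(cmod (tcoeff f n))\<^sup>2 \<le> (sqrt (real n + 1) * disk_norm f)\<^sup>2"
    by (simp add: power_mult_distrib field_simps)
  then show ?thesis by (rule power2_le_imp_le) (simp add: disk_norm_nonneg)
qed

lemma disk_norm_leI:
  assumes "f \<in> bergman_space" "\<And>m. (\<Sum>n<m. (cmod (tcoeff f n))\<^sup>2 / (real n + 1)) \<le> K\<^sup>2" "K \<ge> 0"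
  shows "disk_norm f \<le> K"
proof -
  have "(disk_norm f)\<^sup>2 \<le> K\<^sup>2"
    unfolding sums_unique[OF disk_norm_sums[OF assms(1)]]
    by (rule suminf_le_const[OF sums_summable[OF disk_norm_sums[OF assms(1)]] assms(2)])
  then show ?thesis using assms(3) by (rule power2_le_imp_le)
qed

definition bfun :: "(nat \<Rightarrow> complex) \<Rightarrow> complex \<Rightarrow> complex" where
  "bfun c z = (if cmod z < 1 then (\<Sum>n. c n * z ^ n) else 0)"

text \<open>Weighted square summability forces at most linear growth of the coefficients, so the
  power series converges in the whole disk. The lemma takes the place of completeness: limits are
  built from their coefficients.\<close>

lemma bfun:
  assumes sm: "summable (\<lambda>n. (cmod (c n))\<^sup>2 / (real n + 1))"
  shows bfun_bergman: "bfun c \<in> bergman_space"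
    and tcoeff_bfun: "tcoeff (bfun c) n = c n"
proof -
  define K where "K = (\<Sum>n. (cmod (c n))\<^sup>2 / (real n + 1))"
  have K0: "K \<ge> 0" unfolding K_def using sm by (intro suminf_nonneg) auto
  have ck: "cmod (c n) \<le> sqrt K * (real n + 1)" for n
  proof -
    have "(cmod (c n))\<^sup>2 / (real n + 1) \<le> K"
      unfolding K_def using sum_le_suminf[OF sm, of "{n}"] by simp
    then have "(cmod (c n))\<^sup>2 \<le> K * (real n + 1)" by (simp add: field_simps)
    also have "\<dots> \<le> K * (real n + 1)\<^sup>2"
      using K0 by (intro mult_left_mono) (auto simp: power2_eq_square)
    finally have "(cmod (c n))\<^sup>2 \<le> (sqrt K * (real n + 1))\<^sup>2"
      using K0 by (simp add: power_mult_distrib)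
    then show ?thesis by (rule power2_le_imp_le) (use K0 in auto)
  qed
  have sums: "(\<lambda>n. c n * z ^ n) sums bfun c z" if z: "cmod z < 1" for z
  proof -
    have "summable (\<lambda>n. sqrt K * (real (Suc n) * cmod z ^ n))"
      using geometric_deriv_sums[of "cmod z"] z by (intro summable_mult) (auto simp: sums_iff)
    then have "summable (\<lambda>n. c n * z ^ n)"
      by (rule summable_comparison_test'[where N=0])
         (use ck in \<open>auto simp: norm_mult norm_power mult.assoc[symmetric] add.commute intro!: mult_right_mono\<close>)
    then show ?thesis using z by (simp add: bfun_def summable_sums)
  qed
  show t: "tcoeff (bfun c) n = c n" for n by (rule tcoeff_unique) (rule sums)
  have "bfun c holomorphic_on ball 0 1"
    by (rule power_series_holomorphic[of _ _ c]) (use sums in auto)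
  then show "bfun c \<in> bergman_space"
    unfolding bergman_iff using sm by (simp add: t bfun_def)
qed

lemma bergman_cmult:
  assumes f: "f \<in> bergman_space"
  shows "(\<lambda>z. k * f z) \<in> bergman_space" "disk_norm (\<lambda>z. k * f z) = cmod k * disk_norm f"
proof -
  show "(\<lambda>z. k * f z) \<in> bergman_space"
    using f by (auto simp: bergman_space_def norm_mult power_mult_distrib intro!: holomorphic_intros)
  have "(disk_norm (\<lambda>z. k * f z))\<^sup>2 = (cmod k * disk_norm f)\<^sup>2"
    unfolding power_mult_distrib disk_norm_sq by (simp add: norm_mult power_mult_distrib)
  then show "disk_norm (\<lambda>z. k * f z) = cmod k * disk_norm f"
    using disk_norm_nonneg by (metis abs_of_nonneg mult_nonneg_nonneg norm_ge_zero power2_eq_imp_eq)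
qed

text \<open>Minkowski's inequality for finitely many weighted coefficients gives a bound on partial
  sums from which both membership and the triangle inequality follow.\<close>

lemma bergman_add:
  assumes f: "f \<in> bergman_space" and g: "g \<in> bergman_space"
  shows "(\<lambda>z. f z + g z) \<in> bergman_space" "disk_norm (\<lambda>z. f z + g z) \<le> disk_norm f + disk_norm g"
proof -
  have hol: "(\<lambda>z. f z + g z) holomorphic_on ball 0 1"
    using f g by (intro holomorphic_intros bergman_holomorphic)
  have t: "tcoeff (\<lambda>z. f z + g z) n = tcoeff f n + tcoeff g n" for n
    by (intro tcoeff_add bergman_holomorphic f g)
  have le: "(\<Sum>n<m. (cmod (tcoeff (\<lambda>z. f z + g z) n))\<^sup>2 / (real n + 1)) \<le> (disk_norm f + disk_norm g)\<^sup>2" for m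
  proof -
    define L where "L = (\<lambda>h. L2_set (\<lambda>n. cmod (tcoeff h n) / sqrt (real n + 1)) {..<m})"
    have Lsq: "(L h)\<^sup>2 = (\<Sum>n<m. (cmod (tcoeff h n))\<^sup>2 / (real n + 1))" for h
      by (simp add: L_def L2_set_def sum_nonneg power_divide)
    have LN: "L h \<le> disk_norm h" if "h \<in> bergman_space" for h
    proof (rule power2_le_imp_le[OF _ disk_norm_nonneg])
      show "(L h)\<^sup>2 \<le> (disk_norm h)\<^sup>2"
        unfolding Lsq sums_unique[OF disk_norm_sums[OF that]]
        by (intro sum_le_suminf sums_summable[OF disk_norm_sums[OF that]]) auto
    qed
    have "L (\<lambda>z. f z + g z) \<le> L2_set (\<lambda>n. cmod (tcoeff f n) / sqrt (real n + 1) + cmod (tcoeff g n) / sqrt (real n + 1)) {..<m}"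
      unfolding L_def t add_divide_distrib[symmetric]
      by (intro L2_set_mono divide_right_mono norm_triangle_ineq) auto
    also have "\<dots> \<le> L f + L g" unfolding L_def by (rule L2_set_triangle_ineq)
    also have "\<dots> \<le> disk_norm f + disk_norm g" by (intro add_mono LN f g)
    finally have "(L (\<lambda>z. f z + g z))\<^sup>2 \<le> (disk_norm f + disk_norm g)\<^sup>2"
      by (rule power_mono) (simp add: L_def)
    then show ?thesis unfolding Lsq .
  qed
  have "summable (\<lambda>n. (cmod (tcoeff (\<lambda>z. f z + g z) n))\<^sup>2 / (real n + 1))"
    by (rule summableI_nonneg_bounded[OF _ le]) auto
  then show fg: "(\<lambda>z. f z + g z) \<in> bergman_space"
    unfolding bergman_iff using hol f g by (auto simp: bergman_outside)
  show "disk_norm (\<lambda>z. f z + g z) \<le> disk_norm f + disk_norm g"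
    by (rule disk_norm_leI[OF fg le]) (simp add: disk_norm_nonneg)
qed

lemma bergman_diff:
  assumes f: "f \<in> bergman_space" and g: "g \<in> bergman_space"
  shows "(\<lambda>z. f z - g z) \<in> bergman_space" "disk_norm (\<lambda>z. f z - g z) \<le> disk_norm f + disk_norm g"
  using bergman_add[OF f bergman_cmult(1)[OF g, of "-1"]] bergman_cmult(2)[OF g, of "-1"] by simp_all

lemma bergman_zero: "(\<lambda>z. 0) \<in> bergman_space" "disk_norm (\<lambda>z. 0) = 0"
  by (auto simp: bergman_space_def disk_norm_def set_integrable_def)

lemma bergman_sum:
  assumes "finite I" "\<And>i. i \<in> I \<Longrightarrow> f i \<in> bergman_space"
  shows "(\<lambda>z. \<Sum>i\<in>I. f i z) \<in> bergman_space \<and> disk_norm (\<lambda>z. \<Sum>i\<in>I. f i z) \<le> (\<Sum>i\<in>I. disk_norm (f i))"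
  using assms
proof (induction I rule: finite_induct)
  case empty
  then show ?case by (simp add: bergman_zero)
next
  case (insert x F)
  then show ?case using bergman_add[of "f x" "\<lambda>z. \<Sum>i\<in>F. f i z"] by auto
qed

lemma tcoeff_sum:
  assumes "finite I" "\<And>i. i \<in> I \<Longrightarrow> f i \<in> bergman_space"
  shows "tcoeff (\<lambda>z. \<Sum>i\<in>I. f i z) n = (\<Sum>i\<in>I. tcoeff (f i) n)"
  using assms
proof (induction I rule: finite_induct)
  case empty
  then show ?case using tcoeff_cmult[of "\<lambda>z. 0" 0 n] by simp
next
  case (insert x F)
  then show ?case using tcoeff_add[of "f x" "\<lambda>z. \<Sum>i\<in>F. f i z" n] bergman_sum[of F f]
    by (auto simp: bergman_holomorphic)
qed

lemma disk_norm_eq_0: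
  assumes "f \<in> bergman_space" "disk_norm f \<le> 0"
  shows "f = (\<lambda>z. 0)"
proof (rule bergman_eqI_tcoeff[OF assms(1) bergman_zero(1)])
  have "disk_norm f = 0" using assms(2) disk_norm_nonneg[of f] by simp
  then show "tcoeff f n = tcoeff (\<lambda>z. 0) n" for n
    using tcoeff_le_disk_norm[OF assms(1), of n] tcoeff_cmult[of "\<lambda>z. 0" 0 n] by simp
qed

text \<open>Parseval bounds the coefficient of index \<open>n\<close> by \<open>sqrt (n + 1)\<close>
  times the norm; the cruder \<open>n + 1\<close> suffices, because the sum of
  \<open>(n + 1) * cmod r ^ n\<close> converges.\<close>

lemma bergman_eval_bound:
  assumes r: "cmod r < 1"
  shows "\<exists>C\<ge>0. \<forall>f\<in>bergman_space. cmod (f r) \<le> C * disk_norm f"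
proof -
  have sm: "summable (\<lambda>n. real (Suc n) * cmod r ^ n)"
    using geometric_deriv_sums[of "cmod r"] r by (auto simp: sums_iff)
  define C where "C = (\<Sum>n. real (Suc n) * cmod r ^ n)"
  have C0: "C \<ge> 0" unfolding C_def by (intro suminf_nonneg sm) auto
  have "cmod (f r) \<le> C * disk_norm f" if f: "f \<in> bergman_space" for f
  proof -
    have le: "cmod (tcoeff f n * r ^ n) \<le> real (Suc n) * cmod r ^ n * disk_norm f" for n
    proof -
      have "sqrt (real n + 1) \<le> real n + 1" by (rule real_le_lsqrt) (auto simp: power2_eq_square)
      then have "cmod (tcoeff f n) \<le> (real n + 1) * disk_norm f"
        using tcoeff_le_disk_norm[OF f, of n] mult_right_mono[OF _ disk_norm_nonneg] order.trans by blast
      then show ?thesis using mult_right_mono[of _ _ "cmod r ^ n"] by (fastforce simp: norm_mult norm_power mult_ac add.commute)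
    qed
    have sm': "summable (\<lambda>n. real (Suc n) * cmod r ^ n * disk_norm f)" by (intro summable_mult2 sm)
    have smn: "summable (\<lambda>n. cmod (tcoeff f n * r ^ n))"
      by (rule summable_comparison_test'[OF sm', where N=0]) (use le in auto)
    have "cmod (f r) = cmod (\<Sum>n. tcoeff f n * r ^ n)"
      using sums_unique[OF tcoeff_sums[OF bergman_holomorphic[OF f] r]] by simp
    also have "\<dots> \<le> (\<Sum>n. cmod (tcoeff f n * r ^ n))" by (rule summable_norm[OF smn])
    also have "\<dots> \<le> (\<Sum>n. real (Suc n) * cmod r ^ n * disk_norm f)"
      by (rule suminf_le[OF le smn sm'])
    also have "\<dots> = C * disk_norm f" unfolding C_def by (rule suminf_mult2[OF sm, symmetric])
    finally show ?thesis .
  qed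
  with C0 show ?thesis by blast
qed

lemma bergman_mult_bounded:
  assumes f: "f \<in> bergman_space" and m: "m holomorphic_on ball 0 1"
    and B: "\<And>z. cmod z < 1 \<Longrightarrow> cmod (m z) \<le> B" "B \<ge> 0"
  shows "(\<lambda>z. m z * f z) \<in> bergman_space" "disk_norm (\<lambda>z. m z * f z) \<le> B * disk_norm f"
proof -
  have hol: "(\<lambda>z. m z * f z) holomorphic_on ball 0 1"
    by (rule holomorphic_on_mult[OF m bergman_holomorphic[OF f]])
  have le: "(cmod (m z * f z))\<^sup>2 \<le> B\<^sup>2 * (cmod (f z))\<^sup>2" if "cmod z < 1" for z
    using B(1)[OF that] by (auto simp: norm_mult power_mult_distrib intro!: mult_right_mono power_mono)
  have "set_integrable lborel (ball 0 1) (\<lambda>z. (cmod (m z * f z))\<^sup>2)"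
  proof (rule set_integrable_bound)
    show "set_integrable lborel (ball 0 1) (\<lambda>z. B\<^sup>2 * (cmod (f z))\<^sup>2)"
      using bergman_sq_integrable[OF f] by auto
    show "set_borel_measurable lborel (ball 0 1) (\<lambda>z. (cmod (m z * f z))\<^sup>2)"
      unfolding set_borel_measurable_def measurable_lborel2
      by (rule borel_measurable_continuous_on_indicator)
         (use holomorphic_on_imp_continuous_on[OF hol] in \<open>auto intro!: continuous_intros\<close>)
    show "AE z in lborel. z \<in> ball 0 1 \<longrightarrow> norm ((cmod (m z * f z))\<^sup>2) \<le> norm (B\<^sup>2 * (cmod (f z))\<^sup>2)"
      using le by auto
  qed
  then show mf: "(\<lambda>z. m z * f z) \<in> bergman_space"
    using hol f by (auto simp: bergman_space_def)
  have "(disk_norm (\<lambda>z. m z * f z))\<^sup>2 \<le> (LINT z:ball 0 1|lborel. B\<^sup>2 * (cmod (f z))\<^sup>2) / pi"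
    unfolding disk_norm_sq using le bergman_sq_integrable[OF mf] bergman_sq_integrable[OF f]
    by (intro divide_right_mono set_integral_mono) auto
  also have "\<dots> = (B * disk_norm f)\<^sup>2" by (simp add: power_mult_distrib disk_norm_sq)
  finally show "disk_norm (\<lambda>z. m z * f z) \<le> B * disk_norm f"
    by (rule power2_le_imp_le) (use B disk_norm_nonneg in auto)
qed

lemma bergman_shift:
  assumes f: "f \<in> bergman_space"
  shows "(\<lambda>z. z * f z) \<in> bergman_space" "disk_norm (\<lambda>z. z * f z) \<le> disk_norm f"
  using bergman_mult_bounded[OF f, of "\<lambda>z. z" 1] by (auto intro!: holomorphic_intros)

section \<open>The inner product in terms of Taylor coefficients\<close>

lemma disk_mult_cnj_integrable:
  assumes f: "f \<in> bergman_space" and g: "g \<in> bergman_space"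
  shows "set_integrable lborel (ball 0 1) (\<lambda>z. f z * cnj (g z))"
proof (rule set_integrable_bound)
  show "set_integrable lborel (ball 0 1) (\<lambda>z. (cmod (f z))\<^sup>2 + (cmod (g z))\<^sup>2)"
    using bergman_sq_integrable[OF f] bergman_sq_integrable[OF g] by auto
  show "set_borel_measurable lborel (ball 0 1) (\<lambda>z. f z * cnj (g z))"
    unfolding set_borel_measurable_def measurable_lborel2
    by (rule borel_measurable_continuous_on_indicator)
       (use holomorphic_on_imp_continuous_on[OF bergman_holomorphic[OF f]]
          holomorphic_on_imp_continuous_on[OF bergman_holomorphic[OF g]] in \<open>auto intro!: continuous_intros\<close>)
  show "AE z in lborel. z \<in> ball 0 1 \<longrightarrow> norm (f z * cnj (g z)) \<le> norm ((cmod (f z))\<^sup>2 + (cmod (g z))\<^sup>2)"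
    using norm_mult_cnj_le by auto
qed

lemma complex_polarization:
  "4 * (u * cnj v) = of_real ((cmod (u + v))\<^sup>2) - of_real ((cmod (u - v))\<^sup>2)
     + \<i> * of_real ((cmod (u + \<i> * v))\<^sup>2) - \<i> * of_real ((cmod (u - \<i> * v))\<^sup>2)"
  unfolding complex_norm_square by (simp add: algebra_simps)

lemma disk_inner_polarization:
  assumes f: "f \<in> bergman_space" and g: "g \<in> bergman_space"
  shows "4 * disk_inner f g = of_real ((disk_norm (\<lambda>z. f z + g z))\<^sup>2) - of_real ((disk_norm (\<lambda>z. f z - g z))\<^sup>2)
     + \<i> * of_real ((disk_norm (\<lambda>z. f z + \<i> * g z))\<^sup>2) - \<i> * of_real ((disk_norm (\<lambda>z. f z - \<i> * g z))\<^sup>2)"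
proof -
  have i: "set_integrable lborel (ball 0 1) (\<lambda>z. complex_of_real ((cmod (h z))\<^sup>2))" if "h \<in> bergman_space" for h
    using bergman_sq_integrable[OF that] unfolding set_integrable_def
    by (drule_tac integrable_of_real[where 'a=complex]) (simp add: scaleR_conv_of_real)
  note ig = bergman_cmult(1)[OF g, of \<i>]
  note i1 = i[OF bergman_add(1)[OF f g]] and i2 = i[OF bergman_diff(1)[OF f g]]
    and i3 = i[OF bergman_add(1)[OF f ig]] and i4 = i[OF bergman_diff(1)[OF f ig]]
  have d: "of_real ((disk_norm h)\<^sup>2) = (LINT z:ball 0 1|lborel. complex_of_real ((cmod (h z))\<^sup>2)) / of_real pi" for h
    unfolding disk_norm_sq set_integral_complex_of_real by simp
  have "4 * disk_inner f g = (LINT z:ball 0 1|lborel. 4 * (f z * cnj (g z))) / of_real pi"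
    by (simp add: disk_inner_def)
  also have "(LINT z:ball 0 1|lborel. 4 * (f z * cnj (g z)))
     = (LINT z:ball 0 1|lborel. complex_of_real ((cmod (f z + g z))\<^sup>2)) - (LINT z:ball 0 1|lborel. complex_of_real ((cmod (f z - g z))\<^sup>2))
      + \<i> * (LINT z:ball 0 1|lborel. complex_of_real ((cmod (f z + \<i> * g z))\<^sup>2)) - \<i> * (LINT z:ball 0 1|lborel. complex_of_real ((cmod (f z - \<i> * g z))\<^sup>2))"
    unfolding complex_polarization using i1 i2 i3 i4
    by (simp only: set_integral_add set_integral_diff set_integrable_mult_right set_integral_mult_right)
  finally show ?thesis unfolding d by (simp add: diff_divide_distrib add_divide_distrib)
qed

text \<open>Polarization of Parseval's identity: the same combination of four squares is formed for
  the integrals and for each coefficient.\<close>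

lemma disk_inner_sums:
  assumes f: "f \<in> bergman_space" and g: "g \<in> bergman_space"
  shows "(\<lambda>n. tcoeff f n * cnj (tcoeff g n) / of_nat (n + 1)) sums disk_inner f g"
proof -
  note ig = bergman_cmult(1)[OF g, of \<i>]
  note h = bergman_holomorphic[OF f] bergman_holomorphic[OF g] bergman_holomorphic[OF ig]
  have s: "(\<lambda>n. complex_of_real ((cmod (tcoeff k n))\<^sup>2) / of_nat (n + 1)) sums of_real ((disk_norm k)\<^sup>2)" if "k \<in> bergman_space" for k
    using sums_of_real[OF disk_norm_sums[OF that], where 'a=complex] by (simp add: add.commute)
  have "(\<lambda>n. 4 * (tcoeff f n * cnj (tcoeff g n) / of_nat (n + 1))) sums (4 * disk_inner f g)"
  proof -
    have "4 * (tcoeff f n * cnj (tcoeff g n) / of_nat (n + 1)) =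
       of_real ((cmod (tcoeff (\<lambda>z. f z + g z) n))\<^sup>2) / of_nat (n + 1) - of_real ((cmod (tcoeff (\<lambda>z. f z - g z) n))\<^sup>2) / of_nat (n + 1)
       + \<i> * (of_real ((cmod (tcoeff (\<lambda>z. f z + \<i> * g z) n))\<^sup>2) / of_nat (n + 1))
       - \<i> * (of_real ((cmod (tcoeff (\<lambda>z. f z - \<i> * g z) n))\<^sup>2) / of_nat (n + 1))" for n
      unfolding tcoeff_add[OF h(1,2)] tcoeff_diff[OF h(1,2)] tcoeff_add[OF h(1,3)] tcoeff_diff[OF h(1,3)] tcoeff_cmult[OF h(2)]
        times_divide_eq_right complex_polarization by (simp add: diff_divide_distrib add_divide_distrib)
    then show ?thesis unfolding disk_inner_polarization[OF f g]
      by (simp only:) (intro sums_add sums_diff sums_mult s bergman_add bergman_diff f g ig)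
  qed
  from sums_mult[OF this, of "1/4"] show ?thesis by simp
qed

section \<open>The Fredholm alternative on the Bergman space\<close>

lemma bergman_tcoeff_Suc_summable:
  assumes f: "f \<in> bergman_space"
  shows "summable (\<lambda>n. (cmod (tcoeff f (Suc n)))\<^sup>2 / (real n + 2))"
    "(\<Sum>n. (cmod (tcoeff f (Suc n)))\<^sup>2 / (real n + 2)) \<le> (disk_norm f)\<^sup>2"
proof -
  let ?a = "\<lambda>n. (cmod (tcoeff f n))\<^sup>2 / (real n + 1)"
  note s = disk_norm_sums[OF f]
  have eq: "(\<lambda>n. (cmod (tcoeff f (Suc n)))\<^sup>2 / (real n + 2)) = (\<lambda>n. ?a (Suc n))"
    by (simp add: add.commute)
  show "summable (\<lambda>n. (cmod (tcoeff f (Suc n)))\<^sup>2 / (real n + 2))"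
    unfolding eq using sums_summable[OF s] by (subst summable_Suc_iff)
  have "(\<Sum>n. ?a (Suc n)) = (disk_norm f)\<^sup>2 - ?a 0"
    unfolding sums_unique[OF s] by (rule suminf_split_head[OF sums_summable[OF s]])
  then show "(\<Sum>n. (cmod (tcoeff f (Suc n)))\<^sup>2 / (real n + 2)) \<le> (disk_norm f)\<^sup>2"
    unfolding eq by simp
qed

text \<open>
  The function \<open>f 0 + z * bW f z\<close> is the mean \<open>1/z * (integral of f from 0 to z)\<close>; see
  \<open>bW_antiderivative\<close>.
\<close>

definition bW :: "(complex \<Rightarrow> complex) \<Rightarrow> complex \<Rightarrow> complex" where
  "bW f = bfun (\<lambda>n. tcoeff f (Suc n) / of_nat (n + 2))"

text \<open>Against its old weight \<open>1 / (n + 2)\<close> the coefficient moved from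
  \<open>Suc n\<close> to \<open>n\<close> gains the factor \<open>1 / ((n + 2) * (n + 1))\<close>.
  Unless it vanishes by assumption, \<open>m\<close> is at most \<open>Suc n\<close>, and the gain
  is at most \<open>1 / (m + 1)\<close>.\<close>

lemma bW_summable_bound:
  assumes f: "f \<in> bergman_space" and z: "\<And>n. n < m \<Longrightarrow> tcoeff f n = 0"
  shows "(cmod (tcoeff f (Suc n) / of_nat (n + 2)))\<^sup>2 / (real n + 1)
    \<le> (cmod (tcoeff f (Suc n)))\<^sup>2 / (real n + 2) / (real m + 1)"
proof (cases "Suc n < m")
  case True
  then show ?thesis using z by simp
next
  case False
  then have m: "real m + 1 \<le> (real n + 2) * (real n + 1)"
  proof -
    have "real m \<le> real n + 1" using False by simp
    also have "\<dots> \<le> (real n + 2) * (real n + 1) - 1" by (simp add: algebra_simps)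
    finally show ?thesis by simp
  qed
  have "(cmod (tcoeff f (Suc n) / of_nat (n + 2)))\<^sup>2 / (real n + 1)
     = (cmod (tcoeff f (Suc n)))\<^sup>2 / (real n + 2) / ((real n + 2) * (real n + 1))"
    by (simp only: norm_divide norm_of_nat power_divide) (simp add: power2_eq_square add.commute)
  also have "\<dots> \<le> (cmod (tcoeff f (Suc n)))\<^sup>2 / (real n + 2) / (real m + 1)"
    using m by (intro divide_left_mono) auto
  finally show ?thesis .
qed

lemma bW:
  assumes f: "f \<in> bergman_space"
  shows bW_bergman: "bW f \<in> bergman_space"
    and tcoeff_bW: "tcoeff (bW f) n = tcoeff f (Suc n) / of_nat (n + 2)"
proof -
  have "summable (\<lambda>n. (cmod (tcoeff f (Suc n) / of_nat (n + 2)))\<^sup>2 / (real n + 1))"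
    by (rule summable_comparison_test'[OF bergman_tcoeff_Suc_summable(1)[OF f], where N=0])
       (use bW_summable_bound[OF f, of 0] in auto)
  from bfun[OF this] show "bW f \<in> bergman_space" "tcoeff (bW f) n = tcoeff f (Suc n) / of_nat (n + 2)"
    unfolding bW_def by auto
qed

text \<open>Compactness of \<open>bW\<close> in quantitative form: its norm on functions vanishing
  to order \<open>m\<close> at 0 tends to 0 as \<open>m\<close> grows.\<close>

lemma bW_norm_tail:
  assumes f: "f \<in> bergman_space" and z: "\<And>n. n < m \<Longrightarrow> tcoeff f n = 0"
  shows "disk_norm (bW f) \<le> disk_norm f / sqrt (real m + 1)"
proof (rule disk_norm_leI[OF bW_bergman[OF f]])
  fix k
  have "(\<Sum>n<k. (cmod (tcoeff (bW f) n))\<^sup>2 / (real n + 1))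
     \<le> (\<Sum>n<k. (cmod (tcoeff f (Suc n)))\<^sup>2 / (real n + 2) / (real m + 1))"
    unfolding tcoeff_bW[OF f] by (intro sum_mono bW_summable_bound[OF f z])
  also have "\<dots> = (\<Sum>n<k. (cmod (tcoeff f (Suc n)))\<^sup>2 / (real n + 2)) / (real m + 1)"
    by (rule sum_divide_distrib[symmetric])
  also have "\<dots> \<le> (disk_norm f)\<^sup>2 / (real m + 1)"
    by (intro divide_right_mono order.trans[OF _ bergman_tcoeff_Suc_summable(2)[OF f]]
        sum_le_suminf bergman_tcoeff_Suc_summable(1)[OF f]) auto
  also have "\<dots> = (disk_norm f / sqrt (real m + 1))\<^sup>2"
    by (simp add: power_divide)
  finally show "(\<Sum>n<k. (cmod (tcoeff (bW f) n))\<^sup>2 / (real n + 1)) \<le> (disk_norm f / sqrt (real m + 1))\<^sup>2" .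
qed (simp add: disk_norm_nonneg)

text \<open>Boundedness is kept apart, as an explicit constant, because the Fredholm argument
  computes with it.\<close>

definition bergman_linear :: "((complex \<Rightarrow> complex) \<Rightarrow> complex \<Rightarrow> complex) \<Rightarrow> bool" where
  "bergman_linear A \<longleftrightarrow> (\<forall>f\<in>bergman_space. A f \<in> bergman_space) \<and>
     (\<forall>f\<in>bergman_space. \<forall>g\<in>bergman_space. A (\<lambda>z. f z + g z) = (\<lambda>z. A f z + A g z)) \<and>
     (\<forall>k. \<forall>f\<in>bergman_space. A (\<lambda>z. k * f z) = (\<lambda>z. k * A f z))"

lemma bergman_linearD:
  assumes "bergman_linear A"
  shows bergman_linear_maps: "f \<in> bergman_space \<Longrightarrow> A f \<in> bergman_space"
    and bergman_linear_add: "f \<in> bergman_space \<Longrightarrow> g \<in> bergman_space \<Longrightarrow> A (\<lambda>z. f z + g z) = (\<lambda>z. A f z + A g z)"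
    and bergman_linear_cmult: "f \<in> bergman_space \<Longrightarrow> A (\<lambda>z. k * f z) = (\<lambda>z. k * A f z)"
  using assms by (auto simp: bergman_linear_def)

lemma bergman_linear_diff:
  assumes A: "bergman_linear A" and f: "f \<in> bergman_space" and g: "g \<in> bergman_space"
  shows "A (\<lambda>z. f z - g z) = (\<lambda>z. A f z - A g z)"
  using bergman_linear_add[OF A f bergman_cmult(1)[OF g, of "-1"]] bergman_linear_cmult[OF A g, of "-1"]
  by simp

lemma bergman_linear_zero: "bergman_linear A \<Longrightarrow> A (\<lambda>z. 0) = (\<lambda>z. 0)"
  using bergman_linear_cmult[OF _ bergman_zero(1), of A 0] by simp

lemma bergman_linear_sum:
  assumes A: "bergman_linear A" and "finite I" "\<And>i. i \<in> I \<Longrightarrow> f i \<in> bergman_space"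
  shows "A (\<lambda>z. \<Sum>i\<in>I. f i z) = (\<lambda>z. \<Sum>i\<in>I. A (f i) z)"
  using assms(2,3)
proof (induction I rule: finite_induct)
  case empty
  then show ?case by (simp add: bergman_linear_zero[OF A])
next
  case (insert x F)
  then show ?case
    using bergman_linear_add[OF A, of "f x" "\<lambda>z. \<Sum>i\<in>F. f i z"] bergman_sum[of F f] by auto
qed

lemma bW_linear: "bergman_linear bW"
  unfolding bergman_linear_def
proof (intro conjI ballI allI)
  fix f g k assume f: "f \<in> bergman_space"
  show "bW f \<in> bergman_space" by (rule bW_bergman[OF f])
  show "bW (\<lambda>z. k * f z) = (\<lambda>z. k * bW f z)"
    by (rule bergman_eqI_tcoeff)
       (simp_all add: f bW_bergman bergman_cmult tcoeff_bW tcoeff_cmult bergman_holomorphic)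
  assume g: "g \<in> bergman_space"
  show "bW (\<lambda>z. f z + g z) = (\<lambda>z. bW f z + bW g z)"
    by (rule bergman_eqI_tcoeff)
       (simp_all add: f g bW_bergman bergman_add tcoeff_bW tcoeff_add bergman_holomorphic add_divide_distrib)
qed

text \<open>The solution is the sum of the iterates \<open>(B ^^ k) h\<close>, whose norms decay
  like \<open>(1/2)^k\<close>. The limit is formed coefficientwise and realised by
  \<open>bfun\<close>.\<close>

lemma bergman_neumann:
  assumes B: "bergman_linear B" and half: "\<And>f. f \<in> bergman_space \<Longrightarrow> disk_norm (B f) \<le> disk_norm f / 2"
    and h: "h \<in> bergman_space"
  shows "\<exists>f\<in>bergman_space. (\<lambda>z. f z - B f z) = h"
proof -
  define u where "u = (\<lambda>k. (B ^^ k) h)"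
  have u: "u k \<in> bergman_space \<and> disk_norm (u k) \<le> (1/2)^k * disk_norm h" for k
  proof (induction k)
    case (Suc k)
    then show ?case using half[of "u k"] bergman_linear_maps[OF B, of "u k"] by (auto simp: u_def)
  qed (simp add: u_def h)
  define S where "S = (\<lambda>K z. \<Sum>k<K. u k z)"
  have S: "S K \<in> bergman_space" for K unfolding S_def using bergman_sum[of "{..<K}" u] u by blast
  have Srec: "S (Suc K) = (\<lambda>z. h z + B (S K) z)" for K
  proof -
    have "B (S K) = (\<lambda>z. \<Sum>k<K. u (Suc k) z)"
      unfolding S_def using u by (subst bergman_linear_sum[OF B]) (auto simp: u_def)
    then show ?thesis unfolding S_def by (subst sum.lessThan_Suc_shift) (simp add: u_def)
  qed
  have tail: "disk_norm (\<lambda>z. S K' z - S K z) \<le> 2 * (1/2)^K * disk_norm h" if "K \<le> K'" for K K'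
  proof -
    have eq: "(\<lambda>z. S K' z - S K z) = (\<lambda>z. \<Sum>k\<in>{K..<K'}. u k z)"
    proof
      fix z
      have "S K' z = S K z + (\<Sum>k\<in>{K..<K'}. u k z)"
        unfolding S_def using sum.atLeastLessThan_concat[of 0 K K' "\<lambda>k. u k z"] that by (simp add: atLeast0LessThan)
      then show "S K' z - S K z = (\<Sum>k\<in>{K..<K'}. u k z)" by simp
    qed
    have "disk_norm (\<lambda>z. S K' z - S K z) \<le> (\<Sum>k\<in>{K..<K'}. disk_norm (u k))"
      unfolding eq using bergman_sum[of "{K..<K'}" u] u by blast
    also have "\<dots> \<le> (\<Sum>k\<in>{K..<K'}. (1/2)^k * disk_norm h)" using u by (intro sum_mono) auto
    also have "\<dots> = (\<Sum>k\<in>{K..<K'}. (1/2)^k) * disk_norm h" by (simp add: sum_distrib_right)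
    also have "\<dots> \<le> (2 * (1/2)^K) * disk_norm h"
    proof (rule mult_right_mono[OF _ disk_norm_nonneg])
      have "(\<Sum>k\<in>{K..<K'}. (1/2::real)^k) = 2 * (1/2)^K - 2 * (1/2)^K'"
        using that by (induction K' rule: dec_induct) simp_all
      then show "(\<Sum>k\<in>{K..<K'}. (1/2::real)^k) \<le> 2 * (1/2)^K" by simp
    qed
    finally show ?thesis .
  qed
  \<comment> \<open>Each Taylor coefficient is bounded by the norm, so every coefficient of the
    partial sums converges.\<close>
  define c where "c = (\<lambda>n. \<Sum>k. tcoeff (u k) n)"
  have tS: "tcoeff (S K) n = (\<Sum>k<K. tcoeff (u k) n)" for K n
    unfolding S_def using u by (intro tcoeff_sum) auto
  have lim: "(\<lambda>K. tcoeff (S K) n) \<longlonglongrightarrow> c n" for n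
  proof -
    have "summable (\<lambda>k. (sqrt (real n + 1) * disk_norm h) * (1/2)^k)"
      by (intro summable_mult summable_geometric) simp
    then have "summable (\<lambda>k. tcoeff (u k) n)"
    proof (rule summable_comparison_test'[where N=0])
      fix k
      have "cmod (tcoeff (u k) n) \<le> sqrt (real n + 1) * disk_norm (u k)"
        using u by (intro tcoeff_le_disk_norm) auto
      also have "\<dots> \<le> sqrt (real n + 1) * ((1/2)^k * disk_norm h)"
        using u by (intro mult_left_mono) auto
      finally show "norm (tcoeff (u k) n) \<le> (sqrt (real n + 1) * disk_norm h) * (1/2)^k"
        by (simp add: mult_ac)
    qed
    then show ?thesis unfolding tS c_def by (rule summable_LIMSEQ)
  qed
  \<comment> \<open>The tail estimate is restricted to finitely many coefficients, where
    \<open>K'\<close> can tend to infinity; afterwards \<open>m\<close> is arbitrary. At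
    \<open>K = 0\<close> this gives membership of the limit, for general \<open>K\<close> the rate
    of convergence.\<close>
  have partial: "(\<Sum>n<m. (cmod (c n - tcoeff (S K) n))\<^sup>2 / (real n + 1)) \<le> (2 * (1/2)^K * disk_norm h)\<^sup>2" for m K
  proof (rule tendsto_upperbound)
    show "(\<lambda>K'. \<Sum>n<m. (cmod (tcoeff (S K') n - tcoeff (S K) n))\<^sup>2 / (real n + 1)) \<longlonglongrightarrow>
        (\<Sum>n<m. (cmod (c n - tcoeff (S K) n))\<^sup>2 / (real n + 1))"
      by (intro tendsto_intros lim) auto
    have "(\<Sum>n<m. (cmod (tcoeff (S K') n - tcoeff (S K) n))\<^sup>2 / (real n + 1)) \<le> (2 * (1/2)^K * disk_norm h)\<^sup>2"
      if K: "K \<le> K'" for K'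
    proof -
      note d = bergman_diff(1)[OF S[of K'] S[of K]]
      have "(\<Sum>n<m. (cmod (tcoeff (S K') n - tcoeff (S K) n))\<^sup>2 / (real n + 1))
         = (\<Sum>n<m. (cmod (tcoeff (\<lambda>z. S K' z - S K z) n))\<^sup>2 / (real n + 1))"
        by (simp add: tcoeff_diff bergman_holomorphic S)
      also have "\<dots> \<le> (disk_norm (\<lambda>z. S K' z - S K z))\<^sup>2"
        unfolding sums_unique[OF disk_norm_sums[OF d]]
        by (intro sum_le_suminf sums_summable[OF disk_norm_sums[OF d]]) auto
      also have "\<dots> \<le> (2 * (1/2)^K * disk_norm h)\<^sup>2"
        by (intro power_mono tail K disk_norm_nonneg)
      finally show ?thesis .
    qed
    then show "\<forall>\<^sub>F K' in sequentially. (\<Sum>n<m. (cmod (tcoeff (S K') n - tcoeff (S K) n))\<^sup>2 / (real n + 1)) \<le> (2 * (1/2)^K * disk_norm h)\<^sup>2"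
      by (auto simp: eventually_sequentially)
  qed simp
  have "summable (\<lambda>n. (cmod (c n))\<^sup>2 / (real n + 1))"
  proof (rule summableI_nonneg_bounded)
    show "(\<Sum>n<m. (cmod (c n))\<^sup>2 / (real n + 1)) \<le> (2 * (1/2)^0 * disk_norm h)\<^sup>2" for m
      using partial[where K=0 and m=m] by (simp add: tS)
  qed auto
  note cf = bfun[OF this]
  define f where "f = bfun c"
  have f: "f \<in> bergman_space" and tf: "\<And>n. tcoeff f n = c n" unfolding f_def using cf by auto
  have close: "disk_norm (\<lambda>z. f z - S K z) \<le> 2 * (1/2)^K * disk_norm h" for K
  proof (rule disk_norm_leI[OF bergman_diff(1)[OF f S]])
    show "(\<Sum>n<m. (cmod (tcoeff (\<lambda>z. f z - S K z) n))\<^sup>2 / (real n + 1)) \<le> (2 * (1/2)^K * disk_norm h)\<^sup>2" for m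
      using partial[where K=K and m=m] by (simp add: tcoeff_diff bergman_holomorphic S f tf)
  qed (simp add: disk_norm_nonneg)
  define d where "d = (\<lambda>z. (f z - B f z) - h z)"
  have Bf: "B f \<in> bergman_space" by (rule bergman_linear_maps[OF B f])
  have d: "d \<in> bergman_space" unfolding d_def by (intro bergman_diff f h Bf)
  \<comment> \<open>By the recursion for \<open>S\<close>, the defect \<open>d\<close> is a
    combination of two approximation errors for every \<open>K\<close>; hence its norm is 0.\<close>
  have "disk_norm d \<le> (1/2)^K * (2 * disk_norm h)" for K
  proof -
    note e1 = bergman_diff(1)[OF f S[of "Suc K"]] and e2 = bergman_diff(1)[OF f S[of K]]
    have "d = (\<lambda>z. (f z - S (Suc K) z) - B (\<lambda>z. f z - S K z) z)"
      unfolding d_def bergman_linear_diff[OF B f S] Srec by (auto simp: fun_eq_iff)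
    then have "disk_norm d \<le> disk_norm (\<lambda>z. f z - S (Suc K) z) + disk_norm (B (\<lambda>z. f z - S K z))"
      using bergman_diff(2)[OF e1 bergman_linear_maps[OF B e2]] by simp
    also have "\<dots> \<le> 2 * (1/2)^Suc K * disk_norm h + (2 * (1/2)^K * disk_norm h) / 2"
      by (intro add_mono close order.trans[OF half[OF e2]] divide_right_mono) auto
    finally show ?thesis by (simp add: field_simps)
  qed
  moreover have "(\<lambda>K. (1/2)^K * (2 * disk_norm h)) \<longlonglongrightarrow> 0 * (2 * disk_norm h)"
    by (intro tendsto_intros LIMSEQ_power_zero) simp
  ultimately have "disk_norm d \<le> 0 * (2 * disk_norm h)"
    by (intro LIMSEQ_le_const[of _ _ "disk_norm d"]) auto
  then have "d = (\<lambda>z. 0)" using disk_norm_eq_0[OF d] by simp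
  then have "(\<lambda>z. f z - B f z) = h" unfolding d_def by (auto simp: fun_eq_iff)
  with f show ?thesis by blast
qed

text \<open>
  Up to finitely many Taylor coefficients \<open>A \<circ> bW\<close> has norm at most 1/2, so that the equation is solved by
  a Neumann series \<open>R\<close>, up to a square linear system for these coefficients.
\<close>

lemma bergman_fredholm:
  assumes A: "bergman_linear A" and C: "\<And>f. f \<in> bergman_space \<Longrightarrow> disk_norm (A f) \<le> C * disk_norm f"
    and inj: "\<And>f. f \<in> bergman_space \<Longrightarrow> A (bW f) = f \<Longrightarrow> f = (\<lambda>z. 0)"
  shows "\<exists>C'. \<forall>h\<in>bergman_space. \<exists>f\<in>bergman_space. (\<lambda>z. f z - A (bW f) z) = h \<and> disk_norm f \<le> C' * disk_norm h"
proof -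
  \<comment> \<open>With this \<open>m\<close>, \<open>\<bar>C\<bar> / sqrt (m + 1)\<close> is at
    most 1/2, which bounds \<open>A \<circ> bW\<close> on functions vanishing to order
    \<open>m\<close>.\<close>
  obtain m :: nat where m: "real m \<ge> 4 * C\<^sup>2" using real_arch_simple by blast
  define e where "e = (\<lambda>j. bfun (\<lambda>n. if n = j then 1 else 0))"
  have e: "e j \<in> bergman_space" "tcoeff (e j) n = (if n = j then 1 else 0)" for j n
  proof -
    have "summable (\<lambda>n. (cmod (if n = j then 1 else 0))\<^sup>2 / (real n + 1))"
      by (rule summable_finite[of "{j}"]) auto
    from bfun[OF this] show "e j \<in> bergman_space" "tcoeff (e j) n = (if n = j then 1 else 0)"
      unfolding e_def by auto
  qed
  define P where "P = (\<lambda>f z. \<Sum>j<m. tcoeff f j * e j z)"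
  have P: "P f \<in> bergman_space" "tcoeff (P f) n = (if n < m then tcoeff f n else 0)" for f n
  proof -
    show "P f \<in> bergman_space" unfolding P_def using bergman_sum[of "{..<m}" "\<lambda>j z. tcoeff f j * e j z"] e
      by (auto simp: bergman_cmult)
    have "tcoeff (P f) n = (\<Sum>j<m. tcoeff f j * tcoeff (e j) n)"
      unfolding P_def using e by (subst tcoeff_sum) (auto simp: bergman_cmult tcoeff_cmult bergman_holomorphic)
    also have "\<dots> = (\<Sum>j<m. if j = n then tcoeff f j else 0)" by (intro sum.cong) (auto simp: e)
    finally show "tcoeff (P f) n = (if n < m then tcoeff f n else 0)" by simp
  qed
  have fP: "(\<lambda>z. f z - P f z) \<in> bergman_space" if "f \<in> bergman_space" for f
    by (intro bergman_diff that P)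
  have tfP: "tcoeff (\<lambda>z. f z - P f z) n = (if n < m then 0 else tcoeff f n)" if "f \<in> bergman_space" for f n
    using that P by (simp add: tcoeff_diff bergman_holomorphic)
  define B where "B = (\<lambda>f. A (bW (\<lambda>z. f z - P f z)))"
  define a where "a = (\<lambda>j. A (bW (e j)))"
  have a: "a j \<in> bergman_space" for j unfolding a_def by (intro bergman_linear_maps[OF A] bW_bergman e)
  have AW: "bergman_linear (\<lambda>f. A (bW f))"
    using A bW_linear unfolding bergman_linear_def by auto
  have split: "A (bW f) = (\<lambda>z. B f z + (\<Sum>j<m. tcoeff f j * a j z))" if f: "f \<in> bergman_space" for f
  proof -
    have "A (bW (P f)) = (\<lambda>z. \<Sum>j<m. tcoeff f j * a j z)"
      unfolding P_def a_def using e by (subst bergman_linear_sum[OF AW]) (auto simp: bergman_cmult bergman_linear_cmult[OF AW])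
    moreover have "B f = (\<lambda>z. A (bW f) z - A (bW (P f)) z)"
      unfolding B_def by (rule bergman_linear_diff[OF AW f P(1)])
    ultimately show ?thesis by simp
  qed
  have PL: "P (\<lambda>z. f z + g z) = (\<lambda>z. P f z + P g z)" "P (\<lambda>z. k * f z) = (\<lambda>z. k * P f z)"
    if "f \<in> bergman_space" "g \<in> bergman_space" for f g k
    using that by (auto simp: P_def tcoeff_add tcoeff_cmult bergman_holomorphic sum.distrib distrib_right sum_distrib_left mult.assoc)
  have B: "bergman_linear B"
    unfolding bergman_linear_def
  proof (intro conjI ballI allI)
    fix f g k assume f: "f \<in> bergman_space"
    show "B f \<in> bergman_space" unfolding B_def by (intro bergman_linear_maps[OF AW] fP f)
    have "(\<lambda>z. k * f z - k * P f z) = (\<lambda>z. k * (f z - P f z))" by (simp add: algebra_simps)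
    then show "B (\<lambda>z. k * f z) = (\<lambda>z. k * B f z)"
      unfolding B_def PL(2)[OF f f] using bergman_linear_cmult[OF AW fP[OF f], of k] by simp
    assume g: "g \<in> bergman_space"
    have "(\<lambda>z. f z + g z - (P f z + P g z)) = (\<lambda>z. (f z - P f z) + (g z - P g z))" by (simp add: algebra_simps)
    then show "B (\<lambda>z. f z + g z) = (\<lambda>z. B f z + B g z)"
      unfolding B_def PL(1)[OF f g] using bergman_linear_add[OF AW fP[OF f] fP[OF g]] by simp
  qed
  have half: "disk_norm (B f) \<le> disk_norm f / 2" if f: "f \<in> bergman_space" for f
  proof -
    have n: "disk_norm (\<lambda>z. f z - P f z) \<le> disk_norm f"
    proof (rule disk_norm_leI[OF fP[OF f] _ disk_norm_nonneg])
      fix k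
      have "(\<Sum>n<k. (cmod (tcoeff (\<lambda>z. f z - P f z) n))\<^sup>2 / (real n + 1)) \<le> (\<Sum>n<k. (cmod (tcoeff f n))\<^sup>2 / (real n + 1))"
        by (intro sum_mono) (auto simp: tfP f)
      also have "\<dots> \<le> (disk_norm f)\<^sup>2"
        unfolding sums_unique[OF disk_norm_sums[OF f]]
        by (intro sum_le_suminf sums_summable[OF disk_norm_sums[OF f]]) auto
      finally show "(\<Sum>n<k. (cmod (tcoeff (\<lambda>z. f z - P f z) n))\<^sup>2 / (real n + 1)) \<le> (disk_norm f)\<^sup>2" .
    qed
    have "disk_norm (B f) \<le> C * disk_norm (bW (\<lambda>z. f z - P f z))"
      unfolding B_def by (intro C bW_bergman fP f)
    also have "\<dots> \<le> \<bar>C\<bar> * disk_norm (bW (\<lambda>z. f z - P f z))"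
      by (intro mult_right_mono disk_norm_nonneg) auto
    also have "\<dots> \<le> \<bar>C\<bar> * (disk_norm f / sqrt (real m + 1))"
    proof (intro mult_left_mono)
      have "disk_norm (bW (\<lambda>z. f z - P f z)) \<le> disk_norm (\<lambda>z. f z - P f z) / sqrt (real m + 1)"
        by (rule bW_norm_tail[OF fP[OF f]]) (simp add: tfP f)
      also have "\<dots> \<le> disk_norm f / sqrt (real m + 1)" using n by (intro divide_right_mono) auto
      finally show "disk_norm (bW (\<lambda>z. f z - P f z)) \<le> disk_norm f / sqrt (real m + 1)" .
    qed auto
    also have "\<dots> = (\<bar>C\<bar> / sqrt (real m + 1)) * disk_norm f" by simp
    also have "\<dots> \<le> 1/2 * disk_norm f"
    proof (intro mult_right_mono disk_norm_nonneg)
      have "(2 * \<bar>C\<bar>)\<^sup>2 \<le> real m + 1" using m by (simp add: power_mult_distrib)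
      then have "2 * \<bar>C\<bar> \<le> sqrt (real m + 1)" by (rule real_le_rsqrt)
      then show "\<bar>C\<bar> / sqrt (real m + 1) \<le> 1/2" by (simp add: field_simps)
    qed
    finally show ?thesis by simp
  qed
  have B0: "f = (\<lambda>z. 0)" if f: "f \<in> bergman_space" and eq: "B f = f" for f
  proof (rule disk_norm_eq_0[OF f])
    have "disk_norm f \<le> disk_norm f / 2" using half[OF f] by (simp add: eq)
    then show "disk_norm f \<le> 0" by simp
  qed
  have "\<forall>h\<in>bergman_space. \<exists>f. f \<in> bergman_space \<and> (\<lambda>z. f z - B f z) = h"
    using bergman_neumann[OF B half] by blast
  from bchoice[OF this] obtain R where R: "\<And>h. h \<in> bergman_space \<Longrightarrow> R h \<in> bergman_space"
    and RB: "\<And>h. h \<in> bergman_space \<Longrightarrow> (\<lambda>z. R h z - B (R h) z) = h" by blast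
  have Rn: "disk_norm (R h) \<le> 2 * disk_norm h" if h: "h \<in> bergman_space" for h
  proof -
    have "R h = (\<lambda>z. h z + B (R h) z)" using RB[OF h] by (auto simp: fun_eq_iff algebra_simps)
    then have "disk_norm (R h) \<le> disk_norm h + disk_norm (B (R h))"
      using bergman_add(2)[OF h bergman_linear_maps[OF B R[OF h]]] by simp
    then show ?thesis using half[OF R[OF h]] by simp
  qed
  \<comment> \<open>Applying \<open>R\<close> turns the equation into
    \<open>f = R h + x 0 * R (a 0) + x 1 * R (a 1) + ...\<close>, where the \<open>x j\<close> are
    the first \<open>m\<close> Taylor coefficients of \<open>f\<close> itself. Comparing these
    coefficients gives the system with matrix \<open>M\<close>.\<close>
  define M where "M = (\<lambda>i j. (if i = j then 1 else 0) - tcoeff (R (a j)) i)"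
  have comb: "(\<lambda>z. \<Sum>j<m. x j * R (a j) z) \<in> bergman_space" "disk_norm (\<lambda>z. \<Sum>j<m. x j * R (a j) z) \<le> (\<Sum>j<m. cmod (x j) * disk_norm (R (a j)))"
    "tcoeff (\<lambda>z. \<Sum>j<m. x j * R (a j) z) n = (\<Sum>j<m. x j * tcoeff (R (a j)) n)" for x n
    using bergman_sum[of "{..<m}" "\<lambda>j z. x j * R (a j) z"] R[OF a] tcoeff_sum[of "{..<m}" "\<lambda>j z. x j * R (a j) z" n]
    by (auto simp: bergman_cmult tcoeff_cmult bergman_holomorphic)
  have Bcomb: "(\<Sum>j<m. x j * R (a j) z) - B (\<lambda>z. \<Sum>j<m. x j * R (a j) z) z = (\<Sum>j<m. x j * a j z)" for x z
  proof -
    have "B (\<lambda>z. \<Sum>j<m. x j * R (a j) z) = (\<lambda>z. \<Sum>j<m. x j * B (R (a j)) z)"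
      using R[OF a] by (subst bergman_linear_sum[OF B]) (auto simp: bergman_cmult bergman_linear_cmult[OF B])
    moreover have "x j * R (a j) z - x j * B (R (a j)) z = x j * a j z" for j
      using fun_cong[OF RB[OF a[of j]], of z] by (simp add: right_diff_distrib[symmetric])
    ultimately show ?thesis by (simp add: sum_subtractf[symmetric])
  qed
  have Mx: "(\<Sum>j<m. M i j * x j) = x i - (\<Sum>j<m. x j * tcoeff (R (a j)) i)" if "i < m" for i x
  proof -
    have "(\<Sum>j<m. M i j * x j) = (\<Sum>j<m. (if j = i then x j else 0)) - (\<Sum>j<m. x j * tcoeff (R (a j)) i)"
      unfolding sum_subtractf[symmetric] by (intro sum.cong) (auto simp: M_def algebra_simps)
    then show ?thesis using that by simp
  qed
  have "x j = 0" if hyp: "\<And>i. i < m \<Longrightarrow> (\<Sum>j<m. M i j * x j) = 0" and j: "j < m" for x j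
  proof -
    define f where "f = (\<lambda>z. \<Sum>j<m. x j * R (a j) z)"
    have f: "f \<in> bergman_space" unfolding f_def by (rule comb)
    have tf: "tcoeff f i = x i" if "i < m" for i
      using hyp[OF that] Mx[OF that, of x] by (simp add: f_def comb)
    have "A (bW f) = f"
      unfolding split[OF f]
    proof
      fix z
      have "(\<Sum>j<m. tcoeff f j * a j z) = (\<Sum>j<m. x j * a j z)" by (intro sum.cong) (auto simp: tf)
      then show "B f z + (\<Sum>j<m. tcoeff f j * a j z) = f z"
        using Bcomb[of x z] unfolding f_def[symmetric] by (simp add: f_def algebra_simps)
    qed
    from inj[OF f this] have "f = (\<lambda>z. 0)" .
    then have "tcoeff f j = 0" using tcoeff_cmult[of "\<lambda>z. 0" 0 j] by simp
    then show ?thesis using tf[OF j] by simp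
  qed
  then have "\<forall>x. (\<forall>i<m. (\<Sum>j<m. M i j * x j) = 0) \<longrightarrow> (\<forall>j<m. x j = 0)" by simp
  from square_system_solvable[OF this] obtain K
    where K: "\<And>y i. i < m \<Longrightarrow> (\<Sum>j<m. M i j * (\<Sum>k<m. K j k * y k)) = y i" by auto
  define C' where "C' = 2 + (\<Sum>j<m. (\<Sum>k<m. cmod (K j k) * (sqrt (real k + 1) * 2)) * disk_norm (R (a j)))"
  have "\<exists>f\<in>bergman_space. (\<lambda>z. f z - A (bW f) z) = h \<and> disk_norm f \<le> C' * disk_norm h" if h: "h \<in> bergman_space" for h
  proof -
    define x where "x = (\<lambda>j. \<Sum>k<m. K j k * tcoeff (R h) k)"
    define g where "g = (\<lambda>z. \<Sum>j<m. x j * R (a j) z)"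
    define f where "f = (\<lambda>z. R h z + g z)"
    have g: "g \<in> bergman_space" unfolding g_def by (rule comb)
    have f: "f \<in> bergman_space" unfolding f_def by (intro bergman_add R h g)
    have tf: "tcoeff f i = x i" if "i < m" for i
    proof -
      have "(\<Sum>j<m. M i j * x j) = tcoeff (R h) i" unfolding x_def by (rule K[OF that])
      then have "x i = tcoeff (R h) i + tcoeff g i" unfolding Mx[OF that] g_def comb by (simp only: diff_eq_eq)
      then show ?thesis unfolding f_def using R[OF h] g by (simp add: tcoeff_add bergman_holomorphic)
    qed
    have eq: "(\<lambda>z. f z - A (bW f) z) = h"
      unfolding split[OF f]
    proof
      fix z
      have "(\<Sum>j<m. tcoeff f j * a j z) = (\<Sum>j<m. x j * a j z)" by (intro sum.cong) (auto simp: tf)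
      moreover have "B f z = B (R h) z + B g z"
        unfolding f_def bergman_linear_add[OF B R[OF h] g] ..
      moreover have "R h z - B (R h) z = h z" using fun_cong[OF RB[OF h]] by simp
      moreover have "g z - B g z = (\<Sum>j<m. x j * a j z)" using Bcomb[of x z] unfolding g_def .
      ultimately show "f z - (B f z + (\<Sum>j<m. tcoeff f j * a j z)) = h z"
        unfolding f_def by (simp add: algebra_simps)
    qed
    have xb: "cmod (x j) \<le> (\<Sum>k<m. cmod (K j k) * (sqrt (real k + 1) * 2)) * disk_norm h" for j
    proof -
      have "cmod (x j) \<le> (\<Sum>k<m. cmod (K j k * tcoeff (R h) k))" unfolding x_def by (rule norm_sum)
      also have "\<dots> \<le> (\<Sum>k<m. cmod (K j k) * (sqrt (real k + 1) * 2) * disk_norm h)"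
      proof (intro sum_mono)
        fix k
        have "cmod (tcoeff (R h) k) \<le> sqrt (real k + 1) * disk_norm (R h)" by (rule tcoeff_le_disk_norm[OF R[OF h]])
        also have "\<dots> \<le> sqrt (real k + 1) * (2 * disk_norm h)" using Rn[OF h] by (intro mult_left_mono) auto
        finally have "cmod (K j k) * cmod (tcoeff (R h) k) \<le> cmod (K j k) * (sqrt (real k + 1) * (2 * disk_norm h))"
          by (intro mult_left_mono) auto
        then show "cmod (K j k * tcoeff (R h) k) \<le> cmod (K j k) * (sqrt (real k + 1) * 2) * disk_norm h"
          by (simp add: norm_mult mult_ac)
      qed
      finally show ?thesis by (simp add: sum_distrib_right)
    qed
    have "disk_norm f \<le> disk_norm (R h) + disk_norm g" unfolding f_def by (rule bergman_add(2)[OF R[OF h] g])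
    also have "\<dots> \<le> 2 * disk_norm h + (\<Sum>j<m. cmod (x j) * disk_norm (R (a j)))"
      unfolding g_def by (intro add_mono Rn h comb)
    also have "\<dots> \<le> 2 * disk_norm h + (\<Sum>j<m. ((\<Sum>k<m. cmod (K j k) * (sqrt (real k + 1) * 2)) * disk_norm h) * disk_norm (R (a j)))"
      by (intro add_left_mono sum_mono mult_right_mono xb disk_norm_nonneg)
    also have "\<dots> = C' * disk_norm h"
    proof -
      have "(\<Sum>j<m. (s j * n) * d j) = (\<Sum>j<m. s j * d j) * n" for s d :: "nat \<Rightarrow> real" and n
        unfolding sum_distrib_right by (simp only: mult_ac)
      then show ?thesis unfolding C'_def distrib_right by simp
    qed
    finally show ?thesis using f eq by blast
  qed
  then show ?thesis by blast
qed

section \<open>The Bergman-space Toeplitz operator\<close>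

lemma bergman_const: "(\<lambda>z. if cmod z < 1 then k else 0) \<in> bergman_space"
proof -
  have "(\<lambda>z. if cmod z < 1 then k else 0) holomorphic_on ball 0 1"
    by (rule holomorphic_transform[of "\<lambda>z. k"]) auto
  moreover have "set_integrable lborel (ball 0 1) (\<lambda>z::complex. (cmod (if cmod z < 1 then k else 0))\<^sup>2)"
  proof -
    have "set_integrable lborel (ball 0 1) (\<lambda>z::complex. (cmod k)\<^sup>2)"
      by (intro set_integrable_ball_continuous continuous_intros)
    then show ?thesis by (rule set_integrable_cong[THEN iffD1, rotated 3]) auto
  qed
  ultimately show ?thesis by (auto simp: bergman_space_def)
qed

text \<open>Continuity fills in the exceptional points; this is what allows identities to be divided
  by \<open>z\<close> or by \<open>q\<close>.\<close>

lemma bergman_eqI_finite: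
  assumes f: "f \<in> bergman_space" and g: "g \<in> bergman_space" and F: "finite F"
    and eq: "\<And>z. cmod z < 1 \<Longrightarrow> z \<notin> F \<Longrightarrow> f z = g z"
  shows "f = g"
proof (rule bergman_eqI[OF f g])
  fix z :: complex assume z: "cmod z < 1"
  have c: "isCont (\<lambda>z. f z - g z) z"
    using holomorphic_on_imp_continuous_on[OF bergman_holomorphic[OF f]]
      holomorphic_on_imp_continuous_on[OF bergman_holomorphic[OF g]] z
    by (auto intro!: continuous_intros simp: continuous_on_eq_continuous_at)
  have "eventually (\<lambda>y. y \<in> ball 0 1 - (F - {z})) (at z)"
    using z F by (intro eventually_at_in_open') (auto intro!: open_Diff finite_imp_closed)
  then have "eventually (\<lambda>y. f y - g y = 0) (at z)"
    using eventually_neq_at_within[of z z UNIV] by eventually_elim (use eq in auto)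
  then have "((\<lambda>z. f z - g z) \<longlongrightarrow> 0) (at z)" by (rule tendsto_eventually)
  with c have "f z - g z = 0" unfolding isCont_def by (intro tendsto_unique[of "at z"]) auto
  then show "f z = g z" by simp
qed

text \<open>\<open>bD f\<close> is the Bergman projection of \<open>cnj z * f z\<close>.\<close>

definition bD :: "(complex \<Rightarrow> complex) \<Rightarrow> complex \<Rightarrow> complex" where
  "bD f = bfun (\<lambda>n. of_nat (n + 1) / of_nat (n + 2) * tcoeff f (Suc n))"

lemma bD:
  assumes f: "f \<in> bergman_space"
  shows bD_bergman: "bD f \<in> bergman_space"
    and tcoeff_bD: "tcoeff (bD f) n = of_nat (n + 1) / of_nat (n + 2) * tcoeff f (Suc n)"
proof -
  have "summable (\<lambda>n. (cmod (of_nat (n + 1) / of_nat (n + 2) * tcoeff f (Suc n)))\<^sup>2 / (real n + 1))"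
  proof (rule summable_comparison_test'[OF bergman_tcoeff_Suc_summable(1)[OF f], where N=0])
    fix n
    have "(cmod (of_nat (n + 1) / of_nat (n + 2) * tcoeff f (Suc n)))\<^sup>2 / (real n + 1)
       = (cmod (tcoeff f (Suc n)))\<^sup>2 / (real n + 2) * ((real n + 1) / (real n + 2))"
      by (simp only: norm_mult norm_divide norm_of_nat power_mult_distrib power_divide)
         (simp add: power2_eq_square add.commute)
    also have "\<dots> \<le> (cmod (tcoeff f (Suc n)))\<^sup>2 / (real n + 2) * 1"
      by (intro mult_left_mono) auto
    finally show "norm ((cmod (of_nat (n + 1) / of_nat (n + 2) * tcoeff f (Suc n)))\<^sup>2 / (real n + 1))
      \<le> (cmod (tcoeff f (Suc n)))\<^sup>2 / (real n + 2)" by simp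
  qed
  from bfun[OF this] show "bD f \<in> bergman_space"
    "tcoeff (bD f) n = of_nat (n + 1) / of_nat (n + 2) * tcoeff f (Suc n)"
    unfolding bD_def by auto
qed

text \<open>The weights \<open>(n + 1) / (n + 2)\<close> and \<open>1 / (n + 2)\<close> add up to 1,
  so \<open>bD + bW\<close> is the plain backward shift \<open>(f - f 0) / z\<close>. Thus
  \<open>bW\<close> measures how far the Bergman operator is from the Hardy formula.\<close>

lemma bD_bW:
  assumes f: "f \<in> bergman_space" and z: "cmod z < 1"
  shows "z * bD f z = f z - f 0 - z * bW f z"
proof -
  have "(\<lambda>n. tcoeff (bD f) n * z ^ n + tcoeff (bW f) n * z ^ n) sums (bD f z + bW f z)"
    by (intro sums_add tcoeff_sums bergman_holomorphic bD_bergman bW_bergman f z)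
  moreover have "tcoeff (bD f) n * z ^ n + tcoeff (bW f) n * z ^ n = tcoeff f (Suc n) * z ^ n" for n
  proof -
    have "of_nat (n + 1) / of_nat (n + 2) + 1 / of_nat (n + 2) = (1::complex)"
      unfolding add_divide_distrib[symmetric] of_nat_Suc[symmetric]
      by (metis Suc_eq_plus1 add_2_eq_Suc' divide_self of_nat_1 of_nat_add of_nat_neq_0)
    then have "tcoeff f (Suc n) = of_nat (n + 1) / of_nat (n + 2) * tcoeff f (Suc n) + tcoeff f (Suc n) / of_nat (n + 2)"
      by (metis distrib_right mult_1 times_divide_eq_left)
    then show ?thesis unfolding tcoeff_bD[OF f] tcoeff_bW[OF f] by (metis distrib_right)
  qed
  ultimately have "(\<lambda>n. tcoeff f (Suc n) * z ^ n) sums (bD f z + bW f z)" by simp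
  from sums_mult[OF this, of z] have "(\<lambda>n. tcoeff f (Suc n) * z ^ Suc n) sums (z * (bD f z + bW f z))"
    by (simp add: mult_ac)
  moreover have "(\<lambda>n. tcoeff f (Suc n) * z ^ Suc n) sums (f z - f 0)"
    using tcoeff_sums[OF bergman_holomorphic[OF f] z] by (subst sums_Suc_iff) (simp add: tcoeff_0)
  ultimately have "z * (bD f z + bW f z) = f z - f 0" by (rule sums_unique2)
  then show ?thesis by (simp add: algebra_simps)
qed

lemma disk_inner_self:
  "disk_inner d d = of_real ((disk_norm d)\<^sup>2)"
  unfolding disk_inner_def disk_norm_sq complex_norm_square[symmetric] set_integral_complex_of_real by simp

text \<open>\<open>bD\<close> is the adjoint of multiplication by \<open>z\<close>, so
  \<open>cnj z * f - bD f\<close> is orthogonal to the space, while the polynomial part of the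
  product already lies in it. Uniqueness is proved along with it, because
  \<open>bergman_proj\<close> is a definite description.\<close>

lemma bergman_toeplitz_eq:
  assumes f: "f \<in> bergman_space"
  shows "(\<lambda>z. bD f z + (a * z\<^sup>2 + b * z + c) * f z) \<in> bergman_space"
    "bergman_toeplitz (\<lambda>z. cnj z + (a * z\<^sup>2 + b * z + c)) f = (\<lambda>z. bD f z + (a * z\<^sup>2 + b * z + c) * f z)"
proof -
  define P where "P = (\<lambda>z. a * z\<^sup>2 + b * z + c)"
  define g where "g = (\<lambda>z. bD f z + P z * f z)"
  define u where "u = (\<lambda>z. (cnj z + P z) * f z)"
  have "(\<lambda>z. P z * f z) \<in> bergman_space"
  proof (rule bergman_mult_bounded(1)[OF f, where B="cmod a + cmod b + cmod c"])
    show "P holomorphic_on ball 0 1" unfolding P_def by (intro holomorphic_intros)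
    fix z :: complex assume "cmod z < 1"
    then have "cmod (a * z\<^sup>2) \<le> cmod a" "cmod (b * z) \<le> cmod b"
      by (auto simp: norm_mult norm_power intro!: mult_left_le power_le_one)
    then show "cmod (P z) \<le> cmod a + cmod b + cmod c"
      unfolding P_def by (intro order.trans[OF norm_triangle_ineq] add_mono) auto
  qed auto
  then have g: "g \<in> bergman_space" unfolding g_def by (intro bergman_add bD_bergman f)
  have ug: "(u z - g z) * cnj (h z) = f z * cnj (z * h z) - bD f z * cnj (h z)" for h z
    by (simp add: u_def g_def algebra_simps)
  have int: "set_integrable lborel (ball 0 1) (\<lambda>z. (u z - g z) * cnj (h z))" if h: "h \<in> bergman_space" for h
    unfolding ug by (intro set_integral_diff disk_mult_cnj_integrable f bergman_shift h bD_bergman)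
  have orth: "disk_inner (\<lambda>z. u z - g z) h = 0" if h: "h \<in> bergman_space" for h
  proof -
    have "disk_inner (\<lambda>z. u z - g z) h = disk_inner f (\<lambda>z. z * h z) - disk_inner (bD f) h"
      unfolding disk_inner_def ug
      by (subst set_integral_diff(2)) (auto intro!: disk_mult_cnj_integrable f bergman_shift h bD_bergman simp: diff_divide_distrib simp del: complex_cnj_mult)
    \<comment> \<open>Termwise: the shift moves index \<open>n\<close> to \<open>n + 1\<close>, and
      the weight \<open>1 / (n + 2)\<close> there is the weight of \<open>bD\<close> times
      \<open>1 / (n + 1)\<close>.\<close>
    moreover have "disk_inner f (\<lambda>z. z * h z) = disk_inner (bD f) h"
    proof -
      let ?t = "\<lambda>n. tcoeff f n * cnj (tcoeff (\<lambda>z. z * h z) n) / of_nat (n + 1)"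
      have A: "?t sums disk_inner f (\<lambda>z. z * h z)" by (intro disk_inner_sums f bergman_shift h)
      have t0: "?t 0 = 0" by (simp add: tcoeff_shift bergman_holomorphic h)
      have A': "(\<lambda>n. ?t (Suc n)) sums disk_inner f (\<lambda>z. z * h z)"
        by (subst sums_Suc_iff) (use A in \<open>simp only: t0 add_0_right\<close>)
      have E: "?t (Suc n) = tcoeff (bD f) n * cnj (tcoeff h n) / of_nat (n + 1)" for n
      proof -
        have cancel: "(x / y * u) * v / x = u * v / y" if "x \<noteq> 0" for x y u v :: complex
          using that by simp
        have nz: "(of_nat (n + 1) :: complex) \<noteq> 0" using of_nat_neq_0[of n, where 'a=complex] by (simp only: Suc_eq_plus1 not_False_eq_True)
        have "Suc n + 1 = n + 2" by simp
        then show ?thesis unfolding tcoeff_bD[OF f] tcoeff_shift[OF bergman_holomorphic[OF h]] cancel[OF nz]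
          by (simp only: nat.distinct if_False diff_Suc_1)
      qed
      show ?thesis by (rule sums_unique2[OF A'[unfolded E] disk_inner_sums[OF bD_bergman[OF f] h]])
    qed
    ultimately show ?thesis by simp
  qed
  have uniq: "g' = g" if g': "g' \<in> bergman_space" and o': "\<forall>h\<in>bergman_space. disk_inner (\<lambda>z. u z - g' z) h = 0" for g'
  proof -
    define d where "d = (\<lambda>z. g' z - g z)"
    have d: "d \<in> bergman_space" unfolding d_def by (rule bergman_diff(1)[OF g' g])
    have "(u z - g' z) * cnj (d z) = (u z - g z) * cnj (d z) - d z * cnj (d z)" for z
      by (simp add: d_def algebra_simps)
    then have "disk_inner (\<lambda>z. u z - g' z) d = disk_inner (\<lambda>z. u z - g z) d - disk_inner d d"
      unfolding disk_inner_def using int[OF d] disk_mult_cnj_integrable[OF d d]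
      by (simp add: set_integral_diff(2) diff_divide_distrib)
    then have "disk_inner d d = 0" using o' d orth[OF d] by simp
    then have "disk_norm d = 0" unfolding disk_inner_self by simp
    then have "d = (\<lambda>z. 0)" using disk_norm_eq_0[OF d] by simp
    then show ?thesis by (auto simp: d_def fun_eq_iff)
  qed
  have "bergman_proj u = g"
    unfolding bergman_proj_def by (rule the_equality) (intro conjI ballI g orth, assumption, elim conjE uniq)
  then show "bergman_toeplitz (\<lambda>z. cnj z + (a * z\<^sup>2 + b * z + c)) f = (\<lambda>z. bD f z + (a * z\<^sup>2 + b * z + c) * f z)"
    by (simp add: bergman_toeplitz_def u_def g_def P_def)
  show "(\<lambda>z. bD f z + (a * z\<^sup>2 + b * z + c) * f z) \<in> bergman_space" using g by (simp add: g_def P_def)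
qed

text \<open>
  Near the circle \<open>F = h / (z - r)\<close> is controlled by \<open>h\<close>, and by Parseval's identity the mass of \<open>F\<close> on a ball
  of radius \<open>\<rho>\<close> is at most \<open>\<rho>\<^sup>2\<close> times its total mass.
\<close>

lemma bergman_divide:
  assumes r: "cmod r < 1"
  shows "\<exists>C\<ge>0. \<forall>h\<in>bergman_space. h r = 0 \<longrightarrow>
     (\<exists>F\<in>bergman_space. (\<forall>z. cmod z < 1 \<longrightarrow> (z - r) * F z = h z) \<and> disk_norm F \<le> C * disk_norm h)"
proof -
  \<comment> \<open>Halfway between \<open>cmod r\<close> and 1, so that \<open>cmod (z - r)\<close>
    is at least \<open>\<delta>\<close> beyond radius \<open>\<rho>\<close>. With the masses
    \<open>X\<close>, \<open>Y\<close>, \<open>Z\<close> below,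
    \<open>X - Y \<le> Z / \<delta>^2\<close> and \<open>Y \<le> \<rho>^2 * X\<close> lead to the
    constant \<open>C\<close>.\<close>
  define \<rho> where "\<rho> = (1 + cmod r) / 2"
  define \<delta> where "\<delta> = \<rho> - cmod r"
  have \<rho>: "0 < \<rho>" "\<rho> < 1" "cmod r < \<rho>" "\<delta> > 0" using r norm_ge_zero[of r] by (auto simp: \<rho>_def \<delta>_def simp del: norm_ge_zero)
  define C where "C = 1 / (\<delta> * sqrt (1 - \<rho>\<^sup>2))"
  have \<rho>2: "1 - \<rho>\<^sup>2 > 0" using \<rho> by (simp add: power_less_one_iff)
  have C0: "C \<ge> 0" using \<rho> \<rho>2 by (simp add: C_def)
  have "\<exists>F\<in>bergman_space. (\<forall>z. cmod z < 1 \<longrightarrow> (z - r) * F z = h z) \<and> disk_norm F \<le> C * disk_norm h"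
    if h: "h \<in> bergman_space" and hr: "h r = 0" for h
  proof -
    define F where "F = (\<lambda>z. if cmod z < 1 then if z = r then deriv h r else (h z - h r) / (z - r) else 0)"
    have "(\<lambda>z. if z = r then deriv h r else (h z - h r) / (z - r)) holomorphic_on ball 0 1"
      by (rule pole_lemma[OF bergman_holomorphic[OF h]]) (use r in simp)
    then have hol: "F holomorphic_on ball 0 1"
      by (rule holomorphic_transform) (auto simp: F_def)
    have eq: "(z - r) * F z = h z" if "cmod z < 1" for z using that hr by (auto simp: F_def)
    have far: "(cmod (F z))\<^sup>2 \<le> (cmod (h z))\<^sup>2 / \<delta>\<^sup>2" if "cmod z < 1" "cmod z \<ge> \<rho>" for z
    proof -
      have "\<delta> \<le> cmod (z - r)" using that norm_triangle_ineq2[of z r] by (simp add: \<delta>_def)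
      then have "\<delta> * cmod (F z) \<le> cmod (h z)"
        unfolding eq[OF that(1), symmetric] norm_mult by (rule mult_right_mono) simp
      then have "(\<delta> * cmod (F z))\<^sup>2 \<le> (cmod (h z))\<^sup>2" using \<rho> by (intro power_mono) auto
      then show ?thesis using \<rho> by (simp add: power_mult_distrib field_simps)
    qed
    have cF: "continuous_on (cball 0 \<rho>) F"
      by (rule holomorphic_on_imp_continuous_on, rule holomorphic_on_subset[OF hol]) (use \<rho> in auto)
    obtain M where M: "\<And>z. z \<in> cball 0 \<rho> \<Longrightarrow> cmod (F z) \<le> M"
      using compact_imp_bounded[OF compact_continuous_image[OF cF]]
      by (metis (no_types, lifting) bounded_iff compact_cball imageI)
    have "set_integrable lborel (ball 0 1) (\<lambda>z. (cmod (F z))\<^sup>2)"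
    proof (rule set_integrable_bound)
      have "set_integrable lborel (ball 0 1) (\<lambda>z::complex. M\<^sup>2)"
        by (intro set_integrable_ball_continuous continuous_intros)
      then show "set_integrable lborel (ball 0 1) (\<lambda>z. M\<^sup>2 + (cmod (h z))\<^sup>2 / \<delta>\<^sup>2)"
        using bergman_sq_integrable[OF h] by (intro set_integral_add(1) set_integrable_divide) auto
      show "set_borel_measurable lborel (ball 0 1) (\<lambda>z. (cmod (F z))\<^sup>2)"
        unfolding set_borel_measurable_def measurable_lborel2
        by (rule borel_measurable_continuous_on_indicator)
           (use holomorphic_on_imp_continuous_on[OF hol] in \<open>auto intro!: continuous_intros\<close>)
      have "(cmod (F z))\<^sup>2 \<le> M\<^sup>2 + (cmod (h z))\<^sup>2 / \<delta>\<^sup>2" if "cmod z < 1" for z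
      proof (cases "cmod z < \<rho>")
        case True
        then have "(cmod (F z))\<^sup>2 \<le> M\<^sup>2" using M[of z] by (intro power_mono) auto
        then show ?thesis by (simp add: add_increasing2)
      next
        case False
        then show ?thesis using far[OF that] by (simp add: add_increasing)
      qed
      then show "AE z in lborel. z \<in> ball 0 1 \<longrightarrow> norm ((cmod (F z))\<^sup>2) \<le> norm (M\<^sup>2 + (cmod (h z))\<^sup>2 / \<delta>\<^sup>2)"
        by auto
    qed
    then have F: "F \<in> bergman_space" using hol by (auto simp: bergman_space_def F_def)
    define X where "X = (LINT z:ball 0 1|lborel. (cmod (F z))\<^sup>2)"
    define Y where "Y = (LINT z:ball 0 \<rho>|lborel. (cmod (F z))\<^sup>2)"
    define Z where "Z = (LINT z:ball 0 1|lborel. (cmod (h z))\<^sup>2)"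
    have "Y \<le> \<rho>\<^sup>2 * X"
    proof -
      note P = parseval_ball[OF hol \<rho>(1,2)]
      have Q: "(\<lambda>n. \<rho>\<^sup>2 * pi * ((cmod (tcoeff F n))\<^sup>2 / (real n + 1))) sums (\<rho>\<^sup>2 * pi * (X / pi))"
        unfolding X_def by (intro sums_mult parseval_disk_sums hol bergman_sq_integrable F)
      have "Y \<le> \<rho>\<^sup>2 * pi * (X / pi)"
        unfolding Y_def
      proof (rule sums_le[OF _ P Q])
        fix n
        have "\<rho> ^ (2 * n + 2) \<le> \<rho>\<^sup>2" using \<rho> by (intro power_decreasing) auto
        then have "(cmod (tcoeff F n))\<^sup>2 * (pi * \<rho> ^ (2 * n + 2) / (real n + 1)) \<le> (cmod (tcoeff F n))\<^sup>2 * (pi * \<rho>\<^sup>2 / (real n + 1))"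
          by (intro mult_left_mono divide_right_mono) auto
        then show "(cmod (tcoeff F n))\<^sup>2 * (pi * \<rho> ^ (2 * n + 2) / (real n + 1)) \<le> \<rho>\<^sup>2 * pi * ((cmod (tcoeff F n))\<^sup>2 / (real n + 1))"
          by (simp add: mult_ac)
      qed
      then show ?thesis by simp
    qed
    moreover have "X - Y \<le> Z / \<delta>\<^sup>2"
    proof -
      have cF2: "continuous_on (cball 0 \<rho>) (\<lambda>z. (cmod (F z))\<^sup>2)"
        by (intro continuous_intros cF)
      have iF: "integrable lborel (\<lambda>z. indicat_real (ball 0 1) z *\<^sub>R (cmod (F z))\<^sup>2)"
        "integrable lborel (\<lambda>z. indicat_real (ball 0 \<rho>) z *\<^sub>R (cmod (F z))\<^sup>2)"
        "integrable lborel (\<lambda>z. (indicat_real (ball 0 1) z *\<^sub>R (cmod (h z))\<^sup>2) / \<delta>\<^sup>2)"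
        using bergman_sq_integrable[OF F] bergman_sq_integrable[OF h]
          set_integrable_ball_continuous[OF cF2]
        unfolding set_integrable_def by auto
      have "X - Y = (LINT z|lborel. indicat_real (ball 0 1) z *\<^sub>R (cmod (F z))\<^sup>2 - indicat_real (ball 0 \<rho>) z *\<^sub>R (cmod (F z))\<^sup>2)"
        unfolding X_def Y_def set_lebesgue_integral_def by (rule Bochner_Integration.integral_diff[OF iF(1,2), symmetric])
      also have "\<dots> \<le> (LINT z|lborel. (indicat_real (ball 0 1) z *\<^sub>R (cmod (h z))\<^sup>2) / \<delta>\<^sup>2)"
      proof (rule integral_mono[OF Bochner_Integration.integrable_diff[OF iF(1,2)] iF(3)])
        fix z :: complex
        show "indicat_real (ball 0 1) z *\<^sub>R (cmod (F z))\<^sup>2 - indicat_real (ball 0 \<rho>) z *\<^sub>R (cmod (F z))\<^sup>2 \<le> (indicat_real (ball 0 1) z *\<^sub>R (cmod (h z))\<^sup>2) / \<delta>\<^sup>2"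
          using far[of z] \<rho> by (auto simp: indicator_def)
      qed
      also have "\<dots> = Z / \<delta>\<^sup>2" by (simp add: Z_def set_lebesgue_integral_def)
      finally show ?thesis .
    qed
    ultimately have "(1 - \<rho>\<^sup>2) * X \<le> Z / \<delta>\<^sup>2" by (simp add: algebra_simps)
    then have XZ: "X \<le> Z / (\<delta>\<^sup>2 * (1 - \<rho>\<^sup>2))" using \<rho>2 \<rho> by (simp add: field_simps)
    have "(disk_norm F)\<^sup>2 \<le> (C * disk_norm h)\<^sup>2"
      unfolding power_mult_distrib disk_norm_sq X_def[symmetric] Z_def[symmetric]
      using divide_right_mono[OF XZ, of pi] \<rho>2 by (simp add: C_def power_mult_distrib power_divide mult_ac)
    then have "disk_norm F \<le> C * disk_norm h"
      by (rule power2_le_imp_le) (use C0 disk_norm_nonneg in auto)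
    with F eq show ?thesis by blast
  qed
  with C0 show ?thesis by blast
qed

section \<open>From the kernel equation to a differential equation\<close>

lemma tcoeff_deriv: "tcoeff (deriv f) n = of_nat (Suc n) * tcoeff f (Suc n)"
proof -
  have "(deriv ^^ n) (deriv f) = (deriv ^^ Suc n) f" by (simp add: funpow_swap1)
  moreover have "(of_nat (Suc n) :: complex) \<noteq> 0" by (rule of_nat_neq_0)
  ultimately show ?thesis unfolding tcoeff_def fact_Suc of_nat_mult of_nat_fact by simp
qed

lemma holomorphic_eqI_tcoeff:
  assumes "f holomorphic_on ball 0 1" "g holomorphic_on ball 0 1" "\<And>n. tcoeff f n = tcoeff g n" "cmod z < 1"
  shows "f z = g z"
  using tcoeff_sums[OF assms(1,4)] tcoeff_sums[OF assms(2,4)] assms(3) by (simp add: sums_iff)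

text \<open>The coefficients of \<open>f 0 + z * bW f z\<close> are
  \<open>tcoeff f n / (n + 1)\<close>; multiplication by \<open>z\<close> followed by
  differentiation undoes the division. This removes \<open>bW\<close> from the kernel
  equation.\<close>

lemma bW_antiderivative:
  assumes f: "f \<in> bergman_space" and z: "cmod z < 1"
  shows "((\<lambda>z. z * (f 0 + z * bW f z)) has_field_derivative f z) (at z)"
proof -
  define G where "G = (\<lambda>z. f 0 + z * bW f z)"
  define H where "H = (\<lambda>z. z * G z)"
  have hW: "bW f holomorphic_on ball 0 1" by (rule bergman_holomorphic[OF bW_bergman[OF f]])
  have hG: "G holomorphic_on ball 0 1" unfolding G_def by (intro holomorphic_intros hW)
  have hH: "H holomorphic_on ball 0 1" unfolding H_def by (intro holomorphic_intros hG)
  have tG: "tcoeff G n = tcoeff f n / of_nat (Suc n)" for n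
  proof -
    have h1: "(\<lambda>z. z * bW f z) holomorphic_on ball 0 1" by (intro holomorphic_intros hW)
    have "tcoeff (\<lambda>z. f 0) n = (if n = 0 then f 0 else 0)"
      by (simp add: tcoeff_def higher_deriv_const)
    then have "tcoeff G n = (if n = 0 then f 0 else 0) + (if n = 0 then 0 else tcoeff (bW f) (n - 1))"
      unfolding G_def using tcoeff_add[OF holomorphic_on_const h1] tcoeff_shift[OF hW] by simp
    then show ?thesis by (cases n) (simp_all add: tcoeff_0 tcoeff_bW[OF f])
  qed
  have "deriv H z = f z"
  proof (rule holomorphic_eqI_tcoeff[OF _ bergman_holomorphic[OF f] _ z])
    show "deriv H holomorphic_on ball 0 1" by (rule holomorphic_deriv[OF hH]) simp
    show "tcoeff (deriv H) n = tcoeff f n" for n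
    proof -
      have "(of_nat (Suc n) :: complex) \<noteq> 0" by (rule of_nat_neq_0)
      then show ?thesis unfolding tcoeff_deriv H_def tcoeff_shift[OF hG] by (simp add: tG del: of_nat_Suc)
    qed
  qed
  moreover have "(H has_field_derivative deriv H z) (at z)"
    by (rule holomorphic_derivI[OF hH]) (use z in auto)
  ultimately show ?thesis by (simp add: H_def G_def)
qed

text \<open>Two arguments below \<open>pi / 2\<close> in modulus add up to less than
  \<open>pi\<close>, so the product avoids the negative axis. The computation multiplies by
  \<open>cnj x\<close> and compares real parts.\<close>

lemma mult_right_half_planes_ne_neg:
  fixes x y :: complex
  assumes "Re x > 0" "Re y > 0" "k > 0"
  shows "of_real k * x * y \<noteq> - 1"
proof
  assume eq: "of_real k * x * y = - 1"
  have "of_real k * of_real ((cmod x)\<^sup>2) * y = cnj x * (of_real k * x * y)"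
    unfolding complex_norm_square by (simp add: mult_ac)
  also have "\<dots> = - cnj x" by (simp add: eq)
  finally have "Re (of_real (k * (cmod x)\<^sup>2) * y) = - Re x" by simp
  then have "k * (cmod x)\<^sup>2 * Re y = - Re x" by (simp only: Re_complex_of_real times_complex.sel Im_complex_of_real mult_zero_left diff_0_right)
  moreover have "k * (cmod x)\<^sup>2 * Re y \<ge> 0" using assms by simp
  ultimately show False using assms by simp
qed

section \<open>Invertibility on the Bergman space in terms of the roots\<close>

context toeplitz_symbol
begin

lemma q_0: "q 0 = 1" by (simp add: q_def)

lemma roots_prod: "a * r * s * t = -1"
proof -
  have "- (a * r * s * t) = 1" using q_factor[of 0] q_0 by simp
  then show ?thesis by (metis minus_minus)
qed

lemma roots_nz: "r \<noteq> 0" "s \<noteq> 0" "t \<noteq> 0" using roots_prod by auto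

lemma q_eq_0_iff: "q z = 0 \<longleftrightarrow> z = r \<or> z = s \<or> z = t"
  using a_nz by (auto simp: q_factor)

lemma phi_eq: "\<phi> = (\<lambda>z. cnj z + (a * z\<^sup>2 + b * z + c))" by (simp add: \<phi>_def fun_eq_iff)

lemma p_holomorphic: "p holomorphic_on A"
  unfolding p_def by (intro holomorphic_intros)

lemma q_holomorphic: "q holomorphic_on A"
  unfolding q_def by (intro holomorphic_intros p_holomorphic)

lemma bergman_toeplitz_shifted:
  assumes f: "f \<in> bergman_space"
  shows "(\<lambda>z. bergman_toeplitz \<phi> f z - w * f z) \<in> bergman_space"
    "cmod z < 1 \<Longrightarrow> z * (bergman_toeplitz \<phi> f z - w * f z) = q z * f z - f 0 - z * bW f z"
proof -
  note T = bergman_toeplitz_eq[OF f, of a b c]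
  show "(\<lambda>z. bergman_toeplitz \<phi> f z - w * f z) \<in> bergman_space"
    unfolding phi_eq T(2) by (intro bergman_diff T(1) bergman_cmult f)
  show "z * (bergman_toeplitz \<phi> f z - w * f z) = q z * f z - f 0 - z * bW f z" if "cmod z < 1"
  proof -
    have "z * (bergman_toeplitz \<phi> f z - w * f z) = z * bD f z + z * p z * f z"
      unfolding phi_eq T(2) by (simp add: p_def algebra_simps)
    then show ?thesis unfolding bD_bW[OF f that] by (simp add: q_def algebra_simps)
  qed
qed

lemma bergman_toeplitz_eq_iff:
  assumes f: "f \<in> bergman_space" and g: "g \<in> bergman_space"
  shows "(\<lambda>z. bergman_toeplitz \<phi> f z - w * f z) = g \<longleftrightarrow>
    (\<forall>z. cmod z < 1 \<longrightarrow> q z * f z = f 0 + z * (g z + bW f z))"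
proof
  assume eq: "(\<lambda>z. bergman_toeplitz \<phi> f z - w * f z) = g"
  show "\<forall>z. cmod z < 1 \<longrightarrow> q z * f z = f 0 + z * (g z + bW f z)"
    using bergman_toeplitz_shifted(2)[OF f] fun_cong[OF eq] by (simp add: algebra_simps)
next
  assume eq: "\<forall>z. cmod z < 1 \<longrightarrow> q z * f z = f 0 + z * (g z + bW f z)"
  show "(\<lambda>z. bergman_toeplitz \<phi> f z - w * f z) = g"
  proof (rule bergman_eqI_finite[OF bergman_toeplitz_shifted(1)[OF f] g, of "{0}"])
    fix z assume z: "cmod z < 1" "z \<notin> {0}"
    have "z * (bergman_toeplitz \<phi> f z - w * f z) = z * g z"
      unfolding bergman_toeplitz_shifted(2)[OF f z(1)] using eq z by (simp add: algebra_simps)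
    then show "bergman_toeplitz \<phi> f z - w * f z = g z" using z by simp
  qed simp
qed

lemma bergman_q_cancel:
  assumes "f \<in> bergman_space" "g \<in> bergman_space" "\<And>z. cmod z < 1 \<Longrightarrow> q z * f z = q z * g z"
  shows "f = g"
  by (rule bergman_eqI_finite[OF assms(1,2), of "{r, s, t}"]) (use assms(3) q_eq_0_iff in auto)

lemma bergman_kernel_trivial:
  assumes r: "cmod r < 1" and s: "cmod s > 1" and t: "cmod t > 1"
    and f: "f \<in> bergman_space" and eq: "\<And>z. cmod z < 1 \<Longrightarrow> q z * f z = f 0 + z * bW f z"
  shows "f = (\<lambda>z. 0)"
proof (rule ccontr)
  assume f0: "f \<noteq> (\<lambda>z. 0)"
  define G where "G = (\<lambda>z. f 0 + z * bW f z)"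
  have hG: "G holomorphic_on ball 0 1" unfolding G_def
    by (intro holomorphic_intros bergman_holomorphic[OF bW_bergman[OF f]])
  have dG: "(G has_field_derivative deriv G z) (at z)" if "cmod z < 1" for z
    by (rule holomorphic_derivI[OF hG]) (use that in auto)
  \<comment> \<open>Inserting \<open>f = (z G)'\<close> into \<open>q f = G\<close> and using
    \<open>q = 1 + z p\<close> cancels \<open>G\<close> and one factor \<open>z\<close>, which
    leaves the first-order equation \<open>ode\<close>.\<close>
  have fG: "f z = G z + z * deriv G z" if z: "cmod z < 1" for z
  proof -
    have "((\<lambda>z. z * G z) has_field_derivative (G z + z * deriv G z)) (at z)"
      by (auto intro!: derivative_eq_intros dG z)
    moreover have "((\<lambda>z. z * G z) has_field_derivative f z) (at z)"
      unfolding G_def by (rule bW_antiderivative[OF f z])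
    ultimately show ?thesis using DERIV_unique by blast
  qed
  have ode: "p z * G z + q z * deriv G z = 0" if z: "cmod z < 1" "z \<noteq> 0" for z
  proof -
    have "q z * (G z + z * deriv G z) = G z" using eq[OF z(1)] fG[OF z(1)] by (simp add: G_def)
    then have "z * (p z * G z + q z * deriv G z) = 0" by (simp add: q_def algebra_simps)
    then show ?thesis using z by simp
  qed
  have pr: "r * p r = - 1" using q_eq_0_iff[of r] by (simp add: q_def add_eq_0_iff)
  then have "p r \<noteq> 0" by auto
  moreover have "q r = 0" using q_eq_0_iff by simp
  ultimately have Gr: "G r = 0" using ode[OF r roots_nz(1)] by simp
  \<comment> \<open>A constant \<open>G\<close> would be 0, as it vanishes at \<open>r\<close>, and
    then \<open>f\<close> would be 0 too. So the zero at \<open>r\<close> has a finite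
    order.\<close>
  have nc: "\<not> G constant_on ball 0 1"
  proof
    assume "G constant_on ball 0 1"
    then have G0: "G z = 0" if "cmod z < 1" for z
      using Gr r that unfolding constant_on_def by auto
    have "f z = 0" if z: "cmod z < 1" for z
    proof -
      have "((\<lambda>z. 0) has_field_derivative 0) (at z)" by simp
      then have "(G has_field_derivative 0) (at z)"
        by (rule has_field_derivative_transform_within_open[of _ _ _ "ball 0 1"]) (use z G0 in auto)
      then have "deriv G z = 0" by (rule DERIV_imp_deriv)
      then show ?thesis using fG[OF z] G0[OF z] by simp
    qed
    then have "f = (\<lambda>z. 0)" by (intro bergman_eqI[OF f bergman_zero(1)]) auto
    with f0 show False by simp
  qed
  obtain g e n where n: "0 < n" and e: "0 < e" "ball r e \<subseteq> ball 0 1" and g: "g holomorphic_on ball r e"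
    and Gg: "\<And>w. w \<in> ball r e \<Longrightarrow> G w = (w - r) ^ n * g w" and gnz: "\<And>w. w \<in> ball r e \<Longrightarrow> g w \<noteq> 0"
    by (rule holomorphic_factor_zero_nonconstant[OF hG open_ball convex_connected[OF convex_ball] _ Gr nc])
      (use r in \<open>auto intro: that\<close>)
  \<comment> \<open>\<open>v\<close> is \<open>q / (z - r)\<close>, so \<open>v r\<close> is the
    derivative of \<open>q\<close> at \<open>r\<close>; \<open>D\<close> is the differential
    equation for \<open>(z - r) ^ n * g z\<close> after division by \<open>(z - r) ^ n\<close>,
    extended to \<open>r\<close> by continuity.\<close>
  define v where "v = (\<lambda>z. a * (z - s) * (z - t))"
  define D where "D = (\<lambda>z. p z * g z + v z * (of_nat n * g z + (z - r) * deriv g z))"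
  have D0: "D z = 0" if z: "z \<in> ball r e" "z \<noteq> r" "z \<noteq> 0" for z
  proof -
    have z1: "cmod z < 1" using e(2) z by auto
    have "((\<lambda>w. (w - r) ^ n * g w) has_field_derivative
        (of_nat n * (z - r) ^ (n - 1) * g z + (z - r) ^ n * deriv g z)) (at z)"
      by (auto intro!: derivative_eq_intros holomorphic_derivI[OF g _ z(1)])
    then have "(G has_field_derivative (of_nat n * (z - r) ^ (n - 1) * g z + (z - r) ^ n * deriv g z)) (at z)"
      by (rule has_field_derivative_transform_within_open[of _ _ _ "ball r e"]) (use z Gg in auto)
    then have dGz: "deriv G z = of_nat n * (z - r) ^ (n - 1) * g z + (z - r) ^ n * deriv g z"
      by (rule DERIV_imp_deriv)
    have pw: "(z - r) * (z - r) ^ (n - 1) = (z - r) ^ n" using n by (simp add: power_eq_if)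
    have "0 = p z * G z + q z * deriv G z" using ode[OF z1 z(3)] by simp
    also have "q z = (z - r) * v z" by (simp add: q_factor v_def mult_ac)
    also have "p z * G z + (z - r) * v z * deriv G z
      = (z - r) ^ n * (p z * g z + v z * ((z - r) * deriv g z)) + ((z - r) * (z - r) ^ (n - 1)) * (v z * of_nat n * g z)"
      unfolding dGz Gg[OF z(1)] by (simp add: algebra_simps)
    also have "\<dots> = (z - r) ^ n * D z" unfolding pw D_def by (simp add: algebra_simps)
    finally show ?thesis using z by simp
  qed
  have hD: "D holomorphic_on ball r e"
    unfolding D_def v_def by (intro holomorphic_intros p_holomorphic g holomorphic_deriv[OF g]) auto
  have "isCont D r"
    using holomorphic_on_imp_continuous_on[OF hD] e(1) by (simp add: continuous_on_eq_continuous_at)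
  moreover have "eventually (\<lambda>z. z \<in> ball r e - {0}) (at r)"
    using e(1) roots_nz(1) by (intro eventually_at_in_open') auto
  then have "eventually (\<lambda>z. D z = 0) (at r)"
    using eventually_neq_at_within[of r r UNIV] by eventually_elim (use D0 in auto)
  then have "(D \<longlongrightarrow> 0) (at r)" by (rule tendsto_eventually)
  ultimately have "D r = 0" unfolding isCont_def by (intro tendsto_unique[of "at r"]) auto
  moreover have "D r = (p r + of_nat n * v r) * g r" by (simp add: D_def algebra_simps)
  ultimately have "p r + of_nat n * v r = 0" using gnz[of r] e(1) by simp
  moreover have "r * p r + of_nat n * (r * v r) = r * (p r + of_nat n * v r)" by (simp add: algebra_simps)
  ultimately have nv: "of_nat n * (r * v r) = 1" unfolding pr by (simp add: add_eq_0_iff)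
  \<comment> \<open>From \<open>a * r * s * t = -1\<close>, the factor \<open>a * r\<close> is
    \<open>- 1 / (s * t)\<close>, which normalises the differences \<open>s - r\<close> and
    \<open>t - r\<close>.\<close>
  have rv: "r * v r = - ((1 - r / s) * (1 - r / t))"
  proof -
    have e1: "(1 - r / s) * (1 - r / t) = (s - r) * (t - r) / (s * t)"
      using roots_nz by (simp add: field_simps)
    have e2: "a * r = - 1 / (s * t)"
      using roots_prod roots_nz by (simp only: nonzero_eq_divide_eq mult_eq_0_iff de_Morgan_disj simp_thms mult.assoc)
    have e3: "r * v r = (a * r) * ((s - r) * (t - r))" by (simp add: v_def algebra_simps)
    show ?thesis unfolding e1 e3 e2 by simp
  qed
  have "of_real (real n) * (1 - r / s) * (1 - r / t) = - (of_nat n * (r * v r))"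
    unfolding rv by (simp add: mult.assoc)
  then have "of_real (real n) * (1 - r / s) * (1 - r / t) = - 1" unfolding nv .
  moreover have "Re (1 - r / x) > 0" if "cmod x > 1" for x
  proof -
    have "cmod (r / x) < 1" using r that by (simp add: norm_divide divide_less_eq)
    then show ?thesis using complex_Re_le_cmod[of "r / x"] by simp
  qed
  ultimately show False using mult_right_half_planes_ne_neg[of "1 - r / s" "1 - r / t" "real n"] n s t by simp
qed

text \<open>\<open>A\<close> inverts \<open>L f = (q f - f 0) / z\<close>: since
  \<open>q 0 = 1\<close>, the value of \<open>A g\<close> at 0 is \<open>- r * g r\<close>. The
  numerator vanishes at \<open>r\<close>, the only root of \<open>q\<close> in the disk. As
  \<open>T - w = L - bW\<close>, the equation \<open>(T - w) f = g\<close> becomes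
  \<open>f - A (bW f) = A g\<close>.\<close>

lemma bergman_left_inverse:
  assumes r: "cmod r < 1" and s: "cmod s > 1" and t: "cmod t > 1"
  shows "\<exists>A C. bergman_linear A \<and> (\<forall>g\<in>bergman_space. disk_norm (A g) \<le> C * disk_norm g) \<and>
    (\<forall>g\<in>bergman_space. \<forall>z. cmod z < 1 \<longrightarrow> q z * A g z = z * g z - r * g r)"
proof -
  \<comment> \<open>A bound on the disk for the reciprocal of \<open>a * (z - s) * (z - t)\<close>,
    whose roots lie outside.\<close>
  define B where "B = 1 / (cmod a * (cmod s - 1) * (cmod t - 1))"
  have B0: "B \<ge> 0" using s t by (simp add: B_def)
  from bergman_eval_bound[OF r] obtain C1 where C1: "C1 \<ge> 0" "\<forall>f\<in>bergman_space. cmod (f r) \<le> C1 * disk_norm f"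
    by (elim exE conjE)
  from bergman_divide[OF r] obtain C2 where C2: "C2 \<ge> 0" "\<forall>h\<in>bergman_space. h r = 0 \<longrightarrow>
     (\<exists>F\<in>bergman_space. (\<forall>z. cmod z < 1 \<longrightarrow> (z - r) * F z = h z) \<and> disk_norm F \<le> C2 * disk_norm h)"
    by (elim exE conjE)
  define I where "I = (\<lambda>z. if cmod z < 1 then 1 else 0 :: complex)"
  have I: "I \<in> bergman_space" unfolding I_def by (rule bergman_const)
  define C where "C = B * (C2 * (1 + cmod r * C1 * disk_norm I))"
  have ex: "\<exists>f. f \<in> bergman_space \<and> disk_norm f \<le> C * disk_norm g \<and> (\<forall>z. cmod z < 1 \<longrightarrow> q z * f z = z * g z - r * g r)"
    if g: "g \<in> bergman_space" for g
  proof -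
    define h where "h = (\<lambda>z. z * g z - (r * g r) * I z)"
    have h: "h \<in> bergman_space" unfolding h_def by (intro bergman_diff bergman_shift g bergman_cmult I)
    have "h r = 0" using r by (simp add: h_def I_def)
    with C2(2) h have "\<exists>F\<in>bergman_space. (\<forall>z. cmod z < 1 \<longrightarrow> (z - r) * F z = h z) \<and> disk_norm F \<le> C2 * disk_norm h"
      by simp
    then obtain F where F: "F \<in> bergman_space" "\<forall>z. cmod z < 1 \<longrightarrow> (z - r) * F z = h z" "disk_norm F \<le> C2 * disk_norm h"
      by (elim bexE conjE)
    have "disk_norm h \<le> disk_norm (\<lambda>z. z * g z) + disk_norm (\<lambda>z. (r * g r) * I z)"
      unfolding h_def by (intro bergman_diff bergman_shift g bergman_cmult I)
    also have "\<dots> \<le> disk_norm g + cmod (r * g r) * disk_norm I"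
      using bergman_shift(2)[OF g] by (simp add: bergman_cmult(2)[OF I])
    also have "\<dots> \<le> disk_norm g + cmod r * (C1 * disk_norm g) * disk_norm I"
      using C1(2)[rule_format, OF g] by (intro add_left_mono mult_right_mono) (auto simp: norm_mult disk_norm_nonneg intro!: mult_left_mono)
    finally have hn: "disk_norm h \<le> (1 + cmod r * C1 * disk_norm I) * disk_norm g" by (simp add: algebra_simps)
    define m where "m = (\<lambda>z. 1 / (a * (z - s) * (z - t)))"
    have ne: "z - s \<noteq> 0" "z - t \<noteq> 0" if "cmod z < 1" for z using that s t by auto
    have mh: "m holomorphic_on ball 0 1" unfolding m_def
      by (intro holomorphic_intros) (use ne a_nz in auto)
    have mb: "cmod (m z) \<le> B" if z: "cmod z < 1" for z
    proof -
      have "cmod s - 1 \<le> cmod (z - s)" "cmod t - 1 \<le> cmod (z - t)"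
        using z norm_triangle_ineq2[of s z] norm_triangle_ineq2[of t z] by (simp_all add: norm_minus_commute)
      then have "cmod a * (cmod s - 1) * (cmod t - 1) \<le> cmod a * cmod (z - s) * cmod (z - t)"
        using s t by (intro mult_mono) auto
      moreover have "0 < cmod a * (cmod s - 1) * (cmod t - 1)" using a_nz s t by simp
      ultimately show ?thesis by (simp add: m_def B_def norm_divide norm_mult frac_le)
    qed
    note mF = bergman_mult_bounded[OF F(1) mh mb B0]
    have "disk_norm (\<lambda>z. m z * F z) \<le> B * disk_norm F" by (rule mF(2))
    also have "\<dots> \<le> B * (C2 * ((1 + cmod r * C1 * disk_norm I) * disk_norm g))"
      using F(3) hn B0 C2(1) by (intro mult_left_mono order.trans[OF F(3)]) auto
    also have "\<dots> = C * disk_norm g" by (simp add: C_def)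
    finally have "disk_norm (\<lambda>z. m z * F z) \<le> C * disk_norm g" .
    moreover have "q z * (m z * F z) = z * g z - r * g r" if z: "cmod z < 1" for z
    proof -
      have "q z * m z = z - r" using ne[OF z] a_nz by (simp add: q_factor m_def)
      then have "q z * (m z * F z) = (z - r) * F z" by (simp add: mult.assoc[symmetric])
      then show ?thesis unfolding F(2)[rule_format, OF z] using z by (simp add: h_def I_def)
    qed
    ultimately show ?thesis using mF(1) by (intro exI[of _ "\<lambda>z. m z * F z"] conjI allI impI)
  qed
  have "\<forall>g\<in>bergman_space. \<exists>f. f \<in> bergman_space \<and> disk_norm f \<le> C * disk_norm g \<and> (\<forall>z. cmod z < 1 \<longrightarrow> q z * f z = z * g z - r * g r)"
    using ex by (intro ballI)
  from bchoice[OF this] obtain A where A': "\<forall>g\<in>bergman_space. A g \<in> bergman_space \<and> disk_norm (A g) \<le> C * disk_norm g \<and>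
      (\<forall>z. cmod z < 1 \<longrightarrow> q z * A g z = z * g z - r * g r)" ..
  have A: "A g \<in> bergman_space" "disk_norm (A g) \<le> C * disk_norm g" if "g \<in> bergman_space" for g
    using A' that by auto
  have Aq: "q z * A g z = z * g z - r * g r" if "g \<in> bergman_space" "cmod z < 1" for g z
    using A' that by auto
  \<comment> \<open>\<open>A\<close> comes from a choice, but \<open>q * A g\<close> is linear in
    \<open>g\<close> and \<open>q\<close> can be cancelled.\<close>
  have "bergman_linear A"
    unfolding bergman_linear_def
  proof (intro conjI ballI allI)
    fix f g k assume f: "f \<in> bergman_space"
    show "A f \<in> bergman_space" by (rule A[OF f])
    show "A (\<lambda>z. k * f z) = (\<lambda>z. k * A f z)"
    proof (rule bergman_q_cancel)
      fix z :: complex assume z: "cmod z < 1"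
      have "q z * (k * A f z) = k * (q z * A f z)" by simp
      then show "q z * A (\<lambda>z. k * f z) z = q z * (k * A f z)"
        unfolding Aq[OF f z] Aq[OF bergman_cmult(1)[OF f] z] by (simp add: algebra_simps)
    qed (intro A bergman_cmult f)+
    assume g: "g \<in> bergman_space"
    show "A (\<lambda>z. f z + g z) = (\<lambda>z. A f z + A g z)"
    proof (rule bergman_q_cancel)
      fix z :: complex assume z: "cmod z < 1"
      show "q z * A (\<lambda>z. f z + g z) z = q z * (A f z + A g z)"
        unfolding distrib_left Aq[OF f z] Aq[OF g z] Aq[OF bergman_add(1)[OF f g] z] by (simp add: algebra_simps)
    qed (intro A bergman_add f g)+
  qed
  then show ?thesis by (intro exI[of _ A] exI[of _ C] conjI ballI allI impI) (assumption, erule A(2), erule (1) Aq)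
qed

lemma bergman_resolvent:
  assumes r: "cmod r < 1" and s: "cmod s > 1" and t: "cmod t > 1"
  shows "w \<notin> op_spectrum bergman_space disk_norm (=) (bergman_toeplitz \<phi>)"
proof -
  from bergman_left_inverse[OF assms] obtain A C where A: "bergman_linear A"
    and C0: "\<forall>g\<in>bergman_space. disk_norm (A g) \<le> C * disk_norm g"
    and Aq0: "\<forall>g\<in>bergman_space. \<forall>z. cmod z < 1 \<longrightarrow> q z * A g z = z * g z - r * g r"
    by (elim exE conjE)
  note C = C0[rule_format] and Aq = Aq0[rule_format]
  \<comment> \<open>A fixed point of \<open>A \<circ> bW\<close> is in the kernel of
    \<open>T - w\<close>: evaluation at 0, where \<open>q\<close> is 1, identifies
    \<open>- (r * bW f r)\<close> with \<open>f 0\<close>.\<close>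
  have K: "f = (\<lambda>z. 0)" if f: "f \<in> bergman_space" and eq: "A (bW f) = f" for f
  proof (rule bergman_kernel_trivial[OF r s t f])
    fix z :: complex assume z: "cmod z < 1"
    have "f 0 = - (r * bW f r)" using Aq[OF bW_bergman[OF f], of 0] by (simp add: eq q_0)
    then show "q z * f z = f 0 + z * bW f z" using Aq[OF bW_bergman[OF f] z] by (simp add: eq)
  qed
  have "\<exists>C'. \<forall>h\<in>bergman_space. \<exists>f\<in>bergman_space. (\<lambda>z. f z - A (bW f) z) = h \<and> disk_norm f \<le> C' * disk_norm h"
    by (rule bergman_fredholm[OF A]) (erule C, erule (1) K)
  then obtain C' where
    C'0: "\<forall>h\<in>bergman_space. \<exists>f\<in>bergman_space. (\<lambda>z. f z - A (bW f) z) = h \<and> disk_norm f \<le> C' * disk_norm h" by (elim exE)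
  note C' = C'0[rule_format]
  have "\<exists>f. f \<in> bergman_space \<and> (\<lambda>z. bergman_toeplitz \<phi> f z - w * f z) = g \<and> disk_norm f \<le> \<bar>C'\<bar> * \<bar>C\<bar> * disk_norm g"
    if g: "g \<in> bergman_space" for g
  proof -
    have Ag: "A g \<in> bergman_space" by (rule bergman_linear_maps[OF A g])
    from C'[OF Ag] obtain f where f: "f \<in> bergman_space" and eq: "(\<lambda>z. f z - A (bW f) z) = A g" and n: "disk_norm f \<le> C' * disk_norm (A g)"
      by (elim bexE conjE)
    have fe: "f z = A g z + A (bW f) z" for z using fun_cong[OF eq, of z] by (simp add: algebra_simps)
    have qf: "q z * f z = z * g z - r * g r + (z * bW f z - r * bW f r)" if "cmod z < 1" for z
    proof -
      have "q z * f z = q z * A g z + q z * A (bW f) z" by (subst fe) (rule distrib_left)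
      then show ?thesis unfolding Aq[OF g that] Aq[OF bW_bergman[OF f] that] .
    qed
    have f0: "f 0 = - (r * g r) - r * bW f r" using qf[of 0] by (simp add: q_0)
    have "(\<lambda>z. bergman_toeplitz \<phi> f z - w * f z) = g"
      unfolding bergman_toeplitz_eq_iff[OF f g]
    proof (intro allI impI)
      fix z :: complex assume z: "cmod z < 1"
      show "q z * f z = f 0 + z * (g z + bW f z)" unfolding qf[OF z] f0 by (simp add: distrib_left)
    qed
    moreover have "disk_norm f \<le> \<bar>C'\<bar> * \<bar>C\<bar> * disk_norm g"
    proof -
      have 1: "C' * disk_norm (A g) \<le> \<bar>C'\<bar> * disk_norm (A g)" "C * disk_norm g \<le> \<bar>C\<bar> * disk_norm g"
        by (intro mult_right_mono disk_norm_nonneg abs_ge_self)+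
      have "disk_norm f \<le> \<bar>C'\<bar> * disk_norm (A g)" using n 1(1) by (rule order.trans)
      also have "\<dots> \<le> \<bar>C'\<bar> * (\<bar>C\<bar> * disk_norm g)"
        by (intro mult_left_mono order.trans[OF C[OF g] 1(2)]) simp
      finally show ?thesis by (simp only: mult.assoc)
    qed
    ultimately show ?thesis using f by (intro exI[of _ f] conjI)
  qed
  then have "\<forall>g\<in>bergman_space. \<exists>f. f \<in> bergman_space \<and> (\<lambda>z. bergman_toeplitz \<phi> f z - w * f z) = g \<and> disk_norm f \<le> \<bar>C'\<bar> * \<bar>C\<bar> * disk_norm g"
    by (intro ballI)
  from bchoice[OF this] obtain S where S': "\<forall>g\<in>bergman_space. S g \<in> bergman_space \<and>
    (\<lambda>z. bergman_toeplitz \<phi> (S g) z - w * S g z) = g \<and> disk_norm (S g) \<le> \<bar>C'\<bar> * \<bar>C\<bar> * disk_norm g" ..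
  have S: "S g \<in> bergman_space" "(\<lambda>z. bergman_toeplitz \<phi> (S g) z - w * S g z) = g"
    "disk_norm (S g) \<le> \<bar>C'\<bar> * \<bar>C\<bar> * disk_norm g" if "g \<in> bergman_space" for g
    using S'[rule_format, OF that] by blast+
  \<comment> \<open>Injectivity again: \<open>S g\<close> and \<open>f\<close> have the same image
    under \<open>T - w\<close>, so their difference is in the kernel.\<close>
  have ST: "S (\<lambda>z. bergman_toeplitz \<phi> f z - w * f z) = f" if f: "f \<in> bergman_space" for f
  proof -
    define g where "g = (\<lambda>z. bergman_toeplitz \<phi> f z - w * f z)"
    have g: "g \<in> bergman_space" unfolding g_def by (rule bergman_toeplitz_shifted(1)[OF f])
    define d where "d = (\<lambda>z. S g z - f z)"
    have d: "d \<in> bergman_space" unfolding d_def by (intro bergman_diff S g f)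
    have q1: "q z * f z = f 0 + z * (g z + bW f z)" if "cmod z < 1" for z
      using bergman_toeplitz_eq_iff[OF f g] g_def that by blast
    have q2: "q z * S g z = S g 0 + z * (g z + bW (S g) z)" if "cmod z < 1" for z
      using bergman_toeplitz_eq_iff[OF S(1)[OF g] g] S(2)[OF g] that by blast
    have "d = (\<lambda>z. 0)"
    proof (rule bergman_kernel_trivial[OF r s t d])
      fix z :: complex assume z: "cmod z < 1"
      have "bW d = (\<lambda>z. bW (S g) z - bW f z)"
        unfolding d_def by (rule bergman_linear_diff[OF bW_linear S(1)[OF g] f])
      then show "q z * d z = d 0 + z * bW d z"
        using q1[OF z] q2[OF z] by (simp add: d_def algebra_simps)
    qed
    then have "S g = f" by (auto simp: d_def fun_eq_iff)
    then show ?thesis by (simp only: g_def)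
  qed
  show ?thesis
    by (rule op_spectrum_notI[of bergman_space S "(=)" disk_norm "\<bar>C'\<bar> * \<bar>C\<bar>" "bergman_toeplitz \<phi>" w])
      (erule S(1), simp, erule S(3), erule S(2), erule ST)
qed

text \<open>The kernel contains \<open>(z * G)'\<close>, where \<open>G\<close> is a zero-free solution of \<open>q G' + p G = 0\<close>.\<close>

lemma bergman_spectrum_outer:
  assumes "cmod r > 1" "cmod s > 1" "cmod t > 1"
  shows "w \<in> op_spectrum bergman_space disk_norm (=) (bergman_toeplitz \<phi>)"
  unfolding op_spectrum_def
proof (safe)
  fix S C
  assume bd: "\<forall>g\<in>bergman_space. disk_norm (S g) \<le> C * disk_norm g"
    and inv: "\<forall>f\<in>bergman_space. S (\<lambda>x. bergman_toeplitz \<phi> f x - w * f x) = f"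
  \<comment> \<open>\<open>q\<close> has no zero in a ball that contains the closed unit disk, so
    \<open>m\<close> is bounded on the disk and the kernel function \<open>f\<close> belongs to the
    space.\<close>
  define R where "R = min (cmod r) (min (cmod s) (cmod t))"
  have R: "R > 1" using assms by (simp add: R_def)
  have qn: "q z \<noteq> 0" if "z \<in> ball 0 R" for z
    using that q_eq_0_iff[of z] by (auto simp: R_def)
  have "(\<lambda>z. p z / q z) holomorphic_on ball 0 R"
    using qn by (intro holomorphic_intros p_holomorphic q_holomorphic) auto
  then obtain E where E: "\<And>z. z \<in> ball 0 R \<Longrightarrow> (E has_field_derivative p z / q z) (at z)"
    using holomorphic_convex_primitive'[of "ball 0 R" "\<lambda>z. p z / q z"] by (auto simp: at_within_open[of _ "ball 0 R"])
  define G where "G = (\<lambda>z. exp (- E z))"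
  have dG: "(G has_field_derivative - (p z / q z) * G z) (at z)" if "z \<in> ball 0 R" for z
    unfolding G_def by (auto intro!: derivative_eq_intros E that)
  have hG: "G holomorphic_on ball 0 R"
    using dG unfolding holomorphic_on_open[OF open_ball] by blast
  define m where "m = (\<lambda>z. G z + z * deriv G z)"
  have hm: "m holomorphic_on ball 0 R" unfolding m_def
    by (intro holomorphic_intros hG holomorphic_deriv[OF hG]) auto
  have qm: "q z * m z = G z" if z: "z \<in> ball 0 R" for z
  proof -
    have "q z * deriv G z = - p z * G z" using DERIV_imp_deriv[OF dG[OF z]] qn[OF z] by simp
    moreover have "q z * m z = q z * G z + z * (q z * deriv G z)" by (simp add: m_def algebra_simps)
    ultimately have "q z * m z = q z * G z - z * p z * G z" by simp
    then show ?thesis by (simp add: q_def algebra_simps)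
  qed
  have "continuous_on (cball 0 1) m"
    by (rule continuous_on_subset[OF holomorphic_on_imp_continuous_on[OF hm]]) (use R in auto)
  then have "bounded (m ` cball 0 1)" by (intro compact_imp_bounded compact_continuous_image) auto
  then obtain M where M: "\<And>z. cmod z \<le> 1 \<Longrightarrow> cmod (m z) \<le> M" "M > 0"
    unfolding bounded_pos by (metis imageI mem_cball_0)
  define f where "f = (\<lambda>z. m z * (if cmod z < 1 then 1 else 0))"
  have sub: "ball 0 1 \<subseteq> ball (0::complex) R" using R by auto
  have f: "f \<in> bergman_space" unfolding f_def
    by (rule bergman_mult_bounded(1)[OF bergman_const holomorphic_on_subset[OF hm sub], of M]) (use M in auto)
  have hG1: "G holomorphic_on ball 0 1" by (rule holomorphic_on_subset[OF hG sub])
  have tf: "tcoeff f n = of_nat (Suc n) * tcoeff G n" for n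
  proof -
    have hz: "(\<lambda>z. z * G z) holomorphic_on ball 0 1" by (intro holomorphic_intros hG1)
    have "(\<lambda>n. tcoeff (deriv (\<lambda>z. z * G z)) n * z ^ n) sums f z" if z: "cmod z < 1" for z
    proof -
      have "((\<lambda>z. z * G z) has_field_derivative m z) (at z)"
        unfolding m_def by (auto intro!: derivative_eq_intros holomorphic_derivI[OF hG1] simp: z)
      then have "deriv (\<lambda>z. z * G z) z = f z" using z by (simp add: DERIV_imp_deriv f_def)
      moreover have "deriv (\<lambda>z. z * G z) holomorphic_on ball 0 1" by (rule holomorphic_deriv[OF hz]) simp
      ultimately show ?thesis using tcoeff_sums[of "deriv (\<lambda>z. z * G z)" z] z by simp
    qed
    from tcoeff_unique[OF this] show ?thesis by (simp add: tcoeff_deriv tcoeff_shift[OF hG1])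
  qed
  have GW: "G z = f 0 + z * bW f z" if z: "cmod z < 1" for z
  proof -
    have "tcoeff (bW f) n = tcoeff G (Suc n)" for n
    proof -
      have "(of_nat (n + 2) :: complex) \<noteq> 0" using of_nat_neq_0[of "Suc n", where 'a=complex] by simp
      then show ?thesis unfolding tcoeff_bW[OF f] tf by simp
    qed
    then have "(\<lambda>n. tcoeff G (Suc n) * z ^ n) sums bW f z"
      using tcoeff_sums[OF bergman_holomorphic[OF bW_bergman[OF f]] z] by simp
    from sums_mult[OF this, of z] have "(\<lambda>n. tcoeff G (Suc n) * z ^ Suc n) sums (z * bW f z)"
      by (simp add: mult_ac)
    moreover have "(\<lambda>n. tcoeff G (Suc n) * z ^ Suc n) sums (G z - G 0)"
      using tcoeff_sums[OF hG1 z] by (subst sums_Suc_iff) (simp add: tcoeff_0)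
    ultimately have "z * bW f z = G z - G 0" by (rule sums_unique2)
    moreover have "f 0 = G 0" using tf[of 0] by (simp add: tcoeff_0)
    ultimately show ?thesis by simp
  qed
  have z0: "(\<lambda>z. 0) \<in> bergman_space" by (rule bergman_zero)
  have "(\<lambda>z. bergman_toeplitz \<phi> f z - w * f z) = (\<lambda>z. 0)"
    unfolding bergman_toeplitz_eq_iff[OF f z0] using qm GW R by (auto simp: f_def)
  \<comment> \<open>The norm bound at 0 now makes \<open>f\<close> vanish, although
    \<open>f 0 = G 0\<close> is a value of \<open>exp\<close>.\<close>
  then have "S (\<lambda>z. 0) = f" using inv[rule_format, OF f] by simp
  then have "disk_norm f \<le> C * 0" using bd[rule_format, OF z0] by (simp add: bergman_zero(2))
  then have "f = (\<lambda>z. 0)" using disk_norm_eq_0[OF f] by simp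
  moreover have "f 0 = G 0" using GW[of 0] by simp
  ultimately show False by (simp add: G_def)
qed

text \<open>
  Let \<open>L f = (q f - f 0) / z\<close>. If \<open>S\<close> were the resolvent, then \<open>L = (T - w) \<circ> (1 + S \<circ> bW)\<close>. Since \<open>L\<close> is
  injective, the Fredholm alternative would make it surjective, but \<open>L f = 1\<close> has no solution.
\<close>

lemma bergman_spectrum_inner:
  assumes r: "cmod r < 1" and s: "cmod s < 1"
  shows "w \<in> op_spectrum bergman_space disk_norm (=) (bergman_toeplitz \<phi>)"
  unfolding op_spectrum_def
proof (safe)
  fix S C
  assume S: "\<forall>g\<in>bergman_space. S g \<in> bergman_space"
    and bd: "\<forall>g\<in>bergman_space. disk_norm (S g) \<le> C * disk_norm g"
    and inv1: "\<forall>g\<in>bergman_space. (\<lambda>x. bergman_toeplitz \<phi> (S g) x - w * S g x) = g"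
    and inv2: "\<forall>f\<in>bergman_space. S (\<lambda>x. bergman_toeplitz \<phi> f x - w * f x) = f"
  have Sm: "S g \<in> bergman_space" if "g \<in> bergman_space" for g using S that by simp
  have Sq: "q z * S g z = S g 0 + z * (g z + bW (S g) z)" if g: "g \<in> bergman_space" and z: "cmod z < 1" for g z
    using bergman_toeplitz_eq_iff[OF Sm[OF g] g] inv1 g z by simp
  have Su: "S g = f" if f: "f \<in> bergman_space" and g: "g \<in> bergman_space"
    and eq: "\<And>z. cmod z < 1 \<Longrightarrow> q z * f z = f 0 + z * (g z + bW f z)" for f g
  proof -
    have "(\<lambda>x. bergman_toeplitz \<phi> f x - w * f x) = g" using bergman_toeplitz_eq_iff[OF f g] eq by simp
    then show ?thesis using inv2[rule_format, OF f] by simp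
  qed
  \<comment> \<open>Linearity is inherited from \<open>T - w\<close>: the linear combination of
    values of \<open>S\<close> solves the equation for the combined right-hand side, and
    \<open>Su\<close> identifies every such solution with the value of \<open>S\<close>.\<close>
  have Slin: "bergman_linear S"
    unfolding bergman_linear_def
  proof (intro conjI ballI allI)
    fix f g k assume f: "f \<in> bergman_space"
    show "S f \<in> bergman_space" by (rule Sm[OF f])
    show "S (\<lambda>z. k * f z) = (\<lambda>z. k * S f z)"
    proof (rule Su)
      fix z :: complex assume z: "cmod z < 1"
      have "q z * (k * S f z) = k * (q z * S f z)" by simp
      then show "q z * (k * S f z) = k * S f 0 + z * (k * f z + bW (\<lambda>z. k * S f z) z)"
        unfolding Sq[OF f z] bergman_linear_cmult[OF bW_linear Sm[OF f]] by (simp add: algebra_simps)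
    qed (intro bergman_cmult Sm f)+
    assume g: "g \<in> bergman_space"
    show "S (\<lambda>z. f z + g z) = (\<lambda>z. S f z + S g z)"
    proof (rule Su)
      fix z :: complex assume z: "cmod z < 1"
      show "q z * (S f z + S g z) = (S f 0 + S g 0) + z * ((f z + g z) + bW (\<lambda>z. S f z + S g z) z)"
        unfolding distrib_left[of "q z"] Sq[OF f z] Sq[OF g z] bergman_linear_add[OF bW_linear Sm[OF f] Sm[OF g]]
        by (simp add: algebra_simps)
    qed (intro bergman_add Sm f g)+
  qed
  \<comment> \<open>The sign turns \<open>f - A (bW f)\<close>, the form used in the Fredholm
    alternative, into \<open>f + S (bW f)\<close>.\<close>
  define A where "A = (\<lambda>f z. (-1) * S f z)"
  have A: "bergman_linear A"
    using Slin unfolding bergman_linear_def A_def by (auto simp: algebra_simps bergman_cmult)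
      (use bergman_cmult(1)[of _ "-1"] in auto)
  have AC: "disk_norm (A f) \<le> C * disk_norm f" if "f \<in> bergman_space" for f
    unfolding A_def bergman_cmult(2)[OF Sm[OF that]] using bd that by simp
  have K: "f = (\<lambda>z. 0)" if f: "f \<in> bergman_space" and eq: "A (bW f) = f" for f
  proof -
    define g where "g = S (bW f)"
    have g: "g \<in> bergman_space" unfolding g_def by (intro Sm bW_bergman f)
    have fg: "f = (\<lambda>z. (-1) * g z)" using eq by (simp add: A_def g_def)
    have bWf: "bW f z = - bW g z" for z
      unfolding fg bergman_linear_cmult[OF bW_linear g] by simp
    have qg: "q z * g z = g 0" if z: "cmod z < 1" for z
      using Sq[OF bW_bergman[OF f] z] by (simp add: g_def[symmetric] bWf)
    have "g 0 = 0" using qg[OF r] q_eq_0_iff[of r] by simp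
    then have "g = (\<lambda>z. 0)" using qg by (intro bergman_q_cancel[OF g bergman_zero(1)]) simp
    then show ?thesis by (simp add: fg)
  qed
  have "\<exists>C'. \<forall>h\<in>bergman_space. \<exists>f\<in>bergman_space. (\<lambda>z. f z - A (bW f) z) = h \<and> disk_norm f \<le> C' * disk_norm h"
    by (rule bergman_fredholm[OF A]) (erule AC, erule (1) K)
  then obtain C' where
    C'0: "\<forall>h\<in>bergman_space. \<exists>f\<in>bergman_space. (\<lambda>z. f z - A (bW f) z) = h \<and> disk_norm f \<le> C' * disk_norm h" by (elim exE)
  note C' = C'0[rule_format]
  define I where "I = (\<lambda>z. if cmod z < 1 then 1 else 0 :: complex)"
  have I: "I \<in> bergman_space" unfolding I_def by (rule bergman_const)
  \<comment> \<open>Solving \<open>f + S (bW f) = S I\<close> amounts to \<open>L f = I\<close>,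
    that is, \<open>q f = f 0 + z\<close> on the disk.\<close>
  from C'[OF Sm[OF I]] obtain f where f: "f \<in> bergman_space" and eq: "(\<lambda>z. f z - A (bW f) z) = S I"
    by (elim bexE conjE)
  define g where "g = S (bW f)"
  have g: "g \<in> bergman_space" unfolding g_def by (intro Sm bW_bergman f)
  have fe: "f = (\<lambda>z. S I z - g z)" using eq by (auto simp: A_def g_def fun_eq_iff algebra_simps)
  have bWf: "bW f z = bW (S I) z - bW g z" for z
    unfolding fe bergman_linear_diff[OF bW_linear Sm[OF I] g] ..
  have qf: "q z * f z = f 0 + z" if z: "cmod z < 1" for z
  proof -
    have "q z * f z = q z * S I z - q z * g z" by (simp add: fe algebra_simps)
    also have "\<dots> = S I 0 + z * (1 + bW (S I) z) - (g 0 + z * (bW f z + bW g z))"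
      using Sq[OF I z] Sq[OF bW_bergman[OF f] z] z by (simp add: g_def[symmetric] I_def)
    also have "\<dots> = f 0 + z" unfolding bWf fun_cong[OF fe, of 0] by (simp add: algebra_simps)
    finally show ?thesis .
  qed
  have "q r = 0" by (simp add: q_eq_0_iff)
  then have "f 0 + r = 0" using qf[OF r] by simp
  then have "f 0 = - r" by (simp add: eq_neg_iff_add_eq_0)
  \<comment> \<open>Evaluation at \<open>r\<close> gave \<open>q f = z - r\<close>. Dividing by
    \<open>z - r\<close> leaves \<open>a * (z - s) * (z - t) * f z = 1\<close>, which fails at
    \<open>s\<close>.\<close>
  have "(\<lambda>z. a * (z * (z * f z - s * f z) - t * (z * f z - s * f z))) = I"
  proof (rule bergman_eqI_finite[of _ _ "{r}"])
    show "(\<lambda>z. a * (z * (z * f z - s * f z) - t * (z * f z - s * f z))) \<in> bergman_space"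
      by (intro bergman_cmult bergman_diff bergman_shift f)
    fix z :: complex assume z: "cmod z < 1" "z \<notin> {r}"
    have "(z - r) * (a * (z * (z * f z - s * f z) - t * (z * f z - s * f z))) = q z * f z"
      by (simp add: q_factor algebra_simps)
    also have "\<dots> = (z - r) * 1" unfolding qf[OF z(1)] \<open>f 0 = - r\<close> by simp
    finally show "a * (z * (z * f z - s * f z) - t * (z * f z - s * f z)) = I z"
      using z by (simp add: I_def)
  qed (auto intro: I)
  from fun_cong[OF this, of s] show False using s by (simp add: I_def)
qed

text \<open>In the area norm plain geometric sums grow too slowly; the test functions
  \<open>f n\<close> carry the coefficients \<open>(j + 1) / \<rho>^j\<close>, so the squared norm
  is of order \<open>n^2\<close>. Multiplication by \<open>z - \<rho>\<close> leaves one term of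
  size \<open>n\<close> at index \<open>n\<close> and a geometric sum, both of norm at most
  \<open>sqrt n\<close>. Thus \<open>T - w\<close> shrinks \<open>f n\<close> by a factor of order
  \<open>sqrt n\<close>.\<close>

lemma bergman_spectrum_circle:
  assumes \<rho>: "cmod \<rho> = 1" and u: "\<And>z. q z = (z - \<rho>) * u z" "u holomorphic_on UNIV"
  shows "w \<in> op_spectrum bergman_space disk_norm (=) (bergman_toeplitz \<phi>)"
  unfolding op_spectrum_def
proof (safe)
  fix S C
  assume bd: "\<forall>g\<in>bergman_space. disk_norm (S g) \<le> C * disk_norm g"
    and inv: "\<forall>f\<in>bergman_space. S (\<lambda>x. bergman_toeplitz \<phi> f x - w * f x) = f"
  have \<rho>0: "\<rho> \<noteq> 0" using \<rho> by auto
  have "continuous_on (cball 0 1) u"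
    by (rule continuous_on_subset[OF holomorphic_on_imp_continuous_on[OF u(2)]]) auto
  then have "bounded (u ` cball 0 1)" by (intro compact_imp_bounded compact_continuous_image) auto
  then obtain B where B: "\<And>z. cmod z \<le> 1 \<Longrightarrow> cmod (u z) \<le> B" "B > 0"
    unfolding bounded_pos by (metis imageI mem_cball_0)
  have finsum: "summable (\<lambda>j. (cmod (if j \<in> {..<n} then c j else 0))\<^sup>2 / (real j + 1))" for c :: "nat \<Rightarrow> complex" and n
    by (rule summable_finite[of "{..<n}"]) auto
  define P where "P = (\<lambda>n c. bfun (\<lambda>j. if j \<in> {..<n} then c j else 0))"
  have P: "P n c \<in> bergman_space" "tcoeff (P n c) j = (if j < n then c j else 0)" for n c j
    unfolding P_def using bfun[OF finsum[where c=c and n=n]] by auto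
  have Pz: "P n c z = (\<Sum>j<n. c j * z ^ j)" if "cmod z < 1" for n c z
  proof -
    have "(\<lambda>j. tcoeff (P n c) j * z ^ j) sums P n c z" by (intro tcoeff_sums bergman_holomorphic P that)
    moreover have "(\<lambda>j. tcoeff (P n c) j * z ^ j) sums (\<Sum>j<n. tcoeff (P n c) j * z ^ j)"
      by (rule sums_finite) (auto simp: P)
    ultimately show ?thesis using sums_unique2 by (fastforce simp: P)
  qed
  have Pn: "(disk_norm (P n c))\<^sup>2 = (\<Sum>j<n. (cmod (c j))\<^sup>2 / (real j + 1))" for n c
  proof -
    have "(\<lambda>j. (cmod (tcoeff (P n c) j))\<^sup>2 / (real j + 1)) sums (\<Sum>j<n. (cmod (tcoeff (P n c) j))\<^sup>2 / (real j + 1))"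
      by (rule sums_finite) (auto simp: P)
    from sums_unique2[OF disk_norm_sums[OF P(1)] this] show ?thesis by (simp add: P)
  qed
  have nr: "cmod ((1 / \<rho>) ^ j) = 1" for j using \<rho> by (simp add: norm_divide norm_power)
  define f where "f = (\<lambda>n. P n (\<lambda>j. of_nat (Suc j) * (1 / \<rho>) ^ j))"
  define g where "g = (\<lambda>n. P n (\<lambda>j. (1 / \<rho>) ^ j))"
  define e where "e = (\<lambda>n. P (Suc n) (\<lambda>j. if j = n then of_nat n * (1 / \<rho>) ^ j else 0))"
  have mem: "f n \<in> bergman_space" "g n \<in> bergman_space" "e n \<in> bergman_space" for n
    by (simp_all add: f_def g_def e_def P)
  have nf: "(disk_norm (f n))\<^sup>2 \<ge> (real n)\<^sup>2 / 2" for n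
  proof -
    have "(disk_norm (f n))\<^sup>2 = (\<Sum>j<n. real (Suc j))"
      unfolding f_def Pn norm_mult nr norm_of_nat by (intro sum.cong refl) (simp add: power2_eq_square add.commute)
    also have "\<dots> \<ge> (real n)\<^sup>2 / 2"
      by (induction n) (auto simp: power2_eq_square field_simps)
    finally show ?thesis .
  qed
  have ng: "disk_norm (g n) \<le> sqrt (real n)" for n
  proof (rule real_le_rsqrt)
    have "(disk_norm (g n))\<^sup>2 \<le> (\<Sum>j<n. 1)"
      unfolding g_def Pn nr by (intro sum_mono) simp
    then show "(disk_norm (g n))\<^sup>2 \<le> real n" by simp
  qed
  have ne: "disk_norm (e n) \<le> sqrt (real n)" for n
  proof (rule real_le_rsqrt)
    have "(disk_norm (e n))\<^sup>2 = (\<Sum>j<Suc n. if j = n then (real n)\<^sup>2 / (real n + 1) else 0)"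
      unfolding e_def Pn by (intro sum.cong refl) (simp add: norm_mult nr del: power_divide power_one_over)
    also have "\<dots> = (real n)\<^sup>2 / (real n + 1)" by (simp add: sum.delta)
    also have "\<dots> \<le> real n" by (simp add: divide_le_eq power2_eq_square mult_left_mono)
    finally show "(disk_norm (e n))\<^sup>2 \<le> real n" .
  qed
  have fg: "(z - \<rho>) * f n z = \<rho> * (e n z - g n z)" if z: "cmod z < 1" for n z
  proof -
    define x where "x = z / \<rho>"
    have 1: "f n z = (\<Sum>j<n. of_nat (Suc j) * x ^ j)" "g n z = (\<Sum>j<n. x ^ j)"
      unfolding f_def g_def Pz[OF z] x_def by (simp_all add: power_divide)
    have "e n z = (\<Sum>j<Suc n. if j = n then of_nat n * x ^ n else 0)"
      unfolding e_def Pz[OF z] x_def by (intro sum.cong) (auto simp: power_divide)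
    then have 2: "e n z = of_nat n * x ^ n" by simp
    have "(x - 1) * (\<Sum>j<n. of_nat (Suc j) * x ^ j) = of_nat n * x ^ n - (\<Sum>j<n. x ^ j)"
      by (induction n) (simp_all add: algebra_simps)
    moreover have "z - \<rho> = \<rho> * (x - 1)" using \<rho>0 by (simp add: x_def right_diff_distrib)
    ultimately show ?thesis unfolding 1 2 by (simp add: mult.assoc)
  qed
  \<comment> \<open>Averaging divides the coefficient of index \<open>j\<close> by
    \<open>j + 1\<close>, which turns \<open>f n\<close> exactly into \<open>g n\<close>.\<close>
  have gW: "f n 0 + z * bW (f n) z = g n z" if z: "cmod z < 1" for n z
  proof -
    define d where "d = (\<lambda>z. z * bW (f n) z)"
    have d: "d \<in> bergman_space" unfolding d_def by (intro bergman_shift bW_bergman mem)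
    have "tcoeff (\<lambda>z. z * bW (f n) z) j = (if j = 0 then 0 else tcoeff (g n) j)" for j
    proof (cases j)
      case 0
      then show ?thesis by (simp add: tcoeff_shift[OF bergman_holomorphic[OF bW_bergman[OF mem(1)]]])
    next
      case (Suc k)
      have nz: "(of_nat (k + 2) :: complex) \<noteq> 0" using of_nat_neq_0[of "Suc k", where 'a=complex] by simp
      have "tcoeff (\<lambda>z. z * bW (f n) z) j = tcoeff (f n) (Suc k) / of_nat (k + 2)"
        unfolding Suc tcoeff_shift[OF bergman_holomorphic[OF bW_bergman[OF mem(1)]]] by (simp add: tcoeff_bW[OF mem(1)])
      also have "\<dots> = tcoeff (g n) (Suc k)" unfolding f_def g_def P using nz by simp
      finally show ?thesis by (simp add: Suc)
    qed
    then have "(\<lambda>j. (if j = 0 then 0 else tcoeff (g n) j) * z ^ j) sums (z * bW (f n) z)"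
      using tcoeff_sums[OF bergman_holomorphic[OF d] z] by (simp add: d_def)
    moreover have "(\<lambda>j. (if j = 0 then 0 else tcoeff (g n) j) * z ^ j) sums (g n z - g n 0)"
    proof -
      have "(\<lambda>j. tcoeff (g n) j * z ^ j) sums g n z" by (intro tcoeff_sums bergman_holomorphic mem z)
      then have "(\<lambda>j. tcoeff (g n) (Suc j) * z ^ Suc j) sums (g n z - g n 0)"
        by (subst sums_Suc_iff) (simp add: tcoeff_0)
      then have "(\<lambda>j. (\<lambda>j. (if j = 0 then 0 else tcoeff (g n) j) * z ^ j) (Suc j)) sums (g n z - g n 0)" by simp
      from sums_Suc[OF this] show ?thesis by simp
    qed
    ultimately have "z * bW (f n) z = g n z - g n 0" by (rule sums_unique2)
    moreover have "tcoeff (f n) 0 = tcoeff (g n) 0" by (simp add: f_def g_def P)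
    then have "f n 0 = g n 0" by (simp add: tcoeff_0)
    ultimately show ?thesis by simp
  qed
  \<comment> \<open>The formula for \<open>T - w\<close> comes multiplied by \<open>z\<close>, and
    this bound removes the factor. Shifting changes the weight \<open>1 / (j + 1)\<close> into
    \<open>1 / (j + 2)\<close>, a loss covered by \<open>4 = 2^2\<close>.\<close>
  have shift_lower: "disk_norm h \<le> 2 * disk_norm (\<lambda>z. z * h z)" if h: "h \<in> bergman_space" for h
  proof (rule disk_norm_leI[OF h])
    fix m
    let ?b = "\<lambda>j. (cmod (tcoeff (\<lambda>z. z * h z) j))\<^sup>2 / (real j + 1)"
    note zh = bergman_shift(1)[OF h]
    have "(\<Sum>j<m. (cmod (tcoeff h j))\<^sup>2 / (real j + 1)) \<le> (\<Sum>j<m. 4 * ?b (Suc j))"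
    proof (rule sum_mono)
      fix j
      have "1 / (real j + 1) \<le> 4 / (real j + 2)" by (simp add: field_simps)
      then have "(cmod (tcoeff h j))\<^sup>2 * (1 / (real j + 1)) \<le> (cmod (tcoeff h j))\<^sup>2 * (4 / (real j + 2))"
        by (intro mult_left_mono) auto
      then show "(cmod (tcoeff h j))\<^sup>2 / (real j + 1) \<le> 4 * ?b (Suc j)"
        by (simp add: tcoeff_shift[OF bergman_holomorphic[OF h]] add.commute mult_ac)
    qed
    also have "\<dots> = 4 * (\<Sum>j\<in>{1..<Suc m}. ?b j)"
      unfolding sum_distrib_left[symmetric] One_nat_def sum.shift_bounds_Suc_ivl by (simp add: atLeast0LessThan)
    also have "(\<Sum>j\<in>{1..<Suc m}. ?b j) \<le> (disk_norm (\<lambda>z. z * h z))\<^sup>2"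
      unfolding sums_unique[OF disk_norm_sums[OF zh]]
      by (intro sum_le_suminf sums_summable[OF disk_norm_sums[OF zh]]) auto
    finally show "(\<Sum>j<m. (cmod (tcoeff h j))\<^sup>2 / (real j + 1)) \<le> (2 * disk_norm (\<lambda>z. z * h z))\<^sup>2"
      by (simp add: power_mult_distrib)
  qed (simp add: disk_norm_nonneg)
  \<comment> \<open>The leading 2 is from \<open>shift_lower\<close>, \<open>2 * B\<close> from the
    two terms \<open>e n\<close> and \<open>g n\<close> multiplied by \<open>u\<close>, and 1 from
    the subtracted \<open>g n\<close>.\<close>
  define K where "K = 2 * (2 * B + 1)"
  have up: "disk_norm (\<lambda>x. bergman_toeplitz \<phi> (f n) x - w * f n x) \<le> K * sqrt (real n)" for n
  proof -
    define h where "h = (\<lambda>x. bergman_toeplitz \<phi> (f n) x - w * f n x)"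
    have h: "h \<in> bergman_space" unfolding h_def by (rule bergman_toeplitz_shifted(1)[OF mem(1)])
    note eg = bergman_diff[OF mem(3)[of n] mem(2)[of n]]
    have ueg: "(\<lambda>z. (u z * \<rho>) * (e n z - g n z)) \<in> bergman_space"
        "disk_norm (\<lambda>z. (u z * \<rho>) * (e n z - g n z)) \<le> B * disk_norm (\<lambda>z. e n z - g n z)"
    proof -
      have hol: "(\<lambda>z. u z * \<rho>) holomorphic_on ball 0 1"
        by (intro holomorphic_intros holomorphic_on_subset[OF u(2)]) auto
      have le: "cmod (u z * \<rho>) \<le> B" if "cmod z < 1" for z using B(1)[of z] that \<rho> by (simp add: norm_mult)
      note bm = bergman_mult_bounded[OF eg(1) hol le less_imp_le[OF B(2)]]
      show "(\<lambda>z. (u z * \<rho>) * (e n z - g n z)) \<in> bergman_space"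
        "disk_norm (\<lambda>z. (u z * \<rho>) * (e n z - g n z)) \<le> B * disk_norm (\<lambda>z. e n z - g n z)"
        by (rule bm; assumption)+
    qed
    have eqh: "(\<lambda>z. z * h z) = (\<lambda>z. (u z * \<rho>) * (e n z - g n z) - g n z)"
    proof (rule bergman_eqI)
      show "(\<lambda>z. z * h z) \<in> bergman_space" by (rule bergman_shift[OF h])
      show "(\<lambda>z. (u z * \<rho>) * (e n z - g n z) - g n z) \<in> bergman_space" by (rule bergman_diff(1)[OF ueg(1) mem(2)])
      fix z :: complex assume z: "cmod z < 1"
      have "z * h z = q z * f n z - (f n 0 + z * bW (f n) z)"
        using bergman_toeplitz_shifted(2)[OF mem(1)[of n] z] by (simp add: h_def)
      also have "\<dots> = u z * ((z - \<rho>) * f n z) - g n z" unfolding gW[OF z] u(1) by (simp add: mult_ac)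
      finally show "z * h z = (u z * \<rho>) * (e n z - g n z) - g n z" unfolding fg[OF z] by (simp add: mult_ac)
    qed
    have "disk_norm h \<le> 2 * disk_norm (\<lambda>z. z * h z)" by (rule shift_lower[OF h])
    also have "disk_norm (\<lambda>z. z * h z) \<le> B * disk_norm (\<lambda>z. e n z - g n z) + disk_norm (g n)"
      unfolding eqh using bergman_diff(2)[OF ueg(1) mem(2)[of n]] ueg(2) by linarith
    also have "\<dots> \<le> B * (sqrt (real n) + sqrt (real n)) + sqrt (real n)"
      using eg(2) ne[of n] ng[of n] B(2) by (intro add_mono mult_left_mono) auto
    finally show ?thesis by (simp add: h_def K_def algebra_simps)
  qed
  have bound: "real n \<le> 2 * (C * K)\<^sup>2" for n
  proof (cases "n = 0")
    case False
    define h where "h = (\<lambda>x. bergman_toeplitz \<phi> (f n) x - w * f n x)"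
    have h: "h \<in> bergman_space" unfolding h_def by (rule bergman_toeplitz_shifted(1)[OF mem(1)])
    have "S h = f n" using inv mem(1) by (simp add: h_def)
    then have "disk_norm (f n) \<le> C * disk_norm h" using bd[rule_format, OF h] by simp
    then have "(disk_norm (f n))\<^sup>2 \<le> (C * disk_norm h)\<^sup>2" by (intro power_mono disk_norm_nonneg)
    also have "\<dots> = C\<^sup>2 * (disk_norm h)\<^sup>2" by (simp add: power_mult_distrib)
    also have "\<dots> \<le> C\<^sup>2 * (K * sqrt (real n))\<^sup>2"
      using up[of n] by (intro mult_left_mono power_mono disk_norm_nonneg) (auto simp: h_def)
    also have "\<dots> = (C * K)\<^sup>2 * real n" by (simp add: power_mult_distrib)
    finally have "(real n)\<^sup>2 / 2 \<le> (C * K)\<^sup>2 * real n" using nf[of n] by linarith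
    then have "real n * real n \<le> (2 * (C * K)\<^sup>2) * real n" by (simp add: power2_eq_square)
    then show ?thesis using False by simp
  qed simp
  obtain n where "real n > 2 * (C * K)\<^sup>2" using reals_Archimedean2 by blast
  with bound[of n] show False by simp
qed

end

section \<open>Roots, winding numbers and connectedness\<close>

text \<open>Two roots come from the fundamental theorem of algebra with a division after each, the
  third from the remaining linear factor; the factorisation is symmetric, so the roots can be sorted
  by modulus.\<close>

lemma cubic_factor:
  fixes a b d :: complex
  assumes a: "a \<noteq> 0"
  shows "\<exists>r s t. cmod r \<le> cmod s \<and> cmod s \<le> cmod t \<and>
    (\<forall>z. 1 + z * (a * z\<^sup>2 + b * z + d) = a * (z - r) * (z - s) * (z - t))"
proof -
  obtain r where "poly [:1, d, b, a:] r = 0"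
    using fundamental_theorem_of_algebra_alt[of "[:1, d, b, a:]"] a by auto
  then have r: "1 + r * (d + r * (b + r * a)) = 0" by simp
  \<comment> \<open>\<open>e\<close> and \<open>g\<close> are the lower coefficients of the quotient
    by \<open>z - r\<close>, as in Horner's scheme.\<close>
  define e where "e = b + a * r"
  define g where "g = d + e * r"
  obtain s where "poly [:g, e, a:] s = 0"
    using fundamental_theorem_of_algebra_alt[of "[:g, e, a:]"] a by auto
  then have s: "g + s * (e + s * a) = 0" by simp
  define t where "t = - (e + a * s) / a"
  have at: "a * t = - (e + a * s)" using a by (simp add: t_def)
  have fac: "1 + z * (a * z\<^sup>2 + b * z + d) = a * (z - r) * (z - s) * (z - t)" for z
  proof -
    have "1 + z * (a * z\<^sup>2 + b * z + d) = (z - r) * (g + z * (e + z * a)) + (1 + r * (d + r * (b + r * a)))"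
      by (simp add: e_def g_def algebra_simps power2_eq_square)
    also have "\<dots> = (z - r) * (g + z * (e + z * a))" unfolding r by simp
    also have "g + z * (e + z * a) = (z - s) * (a * z + (e + a * s)) + (g + s * (e + s * a))"
      by (simp add: algebra_simps)
    also have "\<dots> = (z - s) * (a * z - a * t)" unfolding s at by simp
    also have "(z - r) * ((z - s) * (a * z - a * t)) = a * (z - r) * (z - s) * (z - t)"
      by (simp add: algebra_simps)
    finally show ?thesis .
  qed
  define Q where "Q = (\<lambda>r s t. \<forall>z. 1 + z * (a * z\<^sup>2 + b * z + d) = a * (z - r) * (z - s) * (z - t))"
  have perm: "Q x y z \<Longrightarrow> Q y x z" "Q x y z \<Longrightarrow> Q x z y" for x y z
    unfolding Q_def by (simp_all add: mult_ac)
  have Q0: "Q r s t" using fac by (simp add: Q_def)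
  note Q = Q0 perm(1)[OF Q0] perm(2)[OF Q0] perm(2)[OF perm(1)[OF Q0]] perm(1)[OF perm(2)[OF Q0]]
    perm(1)[OF perm(2)[OF perm(1)[OF Q0]]]
  have "\<exists>r s t. cmod r \<le> cmod s \<and> cmod s \<le> cmod t \<and> Q r s t"
  proof -
    have ex: ?thesis if "cmod x \<le> cmod y" "cmod y \<le> cmod z" "Q x y z" for x y z
      using that by (intro exI[of _ x] exI[of _ y] exI[of _ z] conjI)
    consider "cmod r \<le> cmod s" "cmod s \<le> cmod t" | "cmod s \<le> cmod r" "cmod r \<le> cmod t"
      | "cmod r \<le> cmod t" "cmod t \<le> cmod s" | "cmod s \<le> cmod t" "cmod t \<le> cmod r"
      | "cmod t \<le> cmod r" "cmod r \<le> cmod s" | "cmod t \<le> cmod s" "cmod s \<le> cmod r"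
      by linarith
    then show ?thesis
      by cases (erule (1) ex, rule Q)+
  qed
  then show ?thesis unfolding Q_def .
qed

lemma winding_number_unit_circle:
  assumes "cmod x \<noteq> 1"
  shows "winding_number (circlepath 0 1) x = (if cmod x < 1 then 1 else 0)"
proof (cases "cmod x < 1")
  case True
  then show ?thesis using winding_number_circlepath[of x 0 1] by simp
next
  case False
  then have "winding_number (circlepath 0 1) x = 0"
    using assms by (intro winding_number_zero_outside[of _ "cball 0 1"]) auto
  then show ?thesis using False by simp
qed

text \<open>The frontier of \<open>C\<close> lies in \<open>K\<close>, so adding \<open>C\<close> to
  \<open>K\<close> is the same as adding the closure of \<open>C\<close>, which is connected and
  meets \<open>K\<close>: the frontier is non-empty because \<open>C\<close> is neither empty nor
  the whole plane.\<close>

lemma connected_Un_component_complement: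
  fixes K :: "complex set"
  assumes K: "closed K" "connected K" "K \<noteq> {}" and C: "C \<in> components (- K)"
  shows "connected (K \<union> C)"
proof -
  have "frontier C \<subseteq> K" using frontier_of_components_closed_complement[OF K(1) C] .
  then have eq: "K \<union> C = K \<union> closure C"
    using closure_Un_frontier[of C] by blast
  have "C \<noteq> {}" "C \<subseteq> - K" using C in_components_nonempty in_components_subset by blast+
  then have "frontier C \<noteq> {}" using K(3) unfolding frontier_eq_empty by blast
  then have "K \<inter> closure C \<noteq> {}" using \<open>frontier C \<subseteq> K\<close> by (auto simp: frontier_def)
  moreover have "connected (closure C)" by (rule connected_imp_connected_closure[OF in_components_connected[OF C]])
  ultimately show ?thesis unfolding eq using K(2) by (intro connected_Un)
qed

text \<open>The winding number is constant on components of the complement, so the set is the curve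
  together with whole components, each of which forms a connected set with the curve.\<close>

lemma connected_winding_set:
  assumes p: "path \<gamma>" and loop: "pathfinish \<gamma> = pathstart \<gamma>"
  shows "connected (path_image \<gamma> \<union> {w. w \<notin> path_image \<gamma> \<and> winding_number \<gamma> w \<noteq> 0})"
proof -
  define K where "K = path_image \<gamma>"
  define U where "U = {w. w \<notin> K \<and> winding_number \<gamma> w \<noteq> 0}"
  have K: "closed K" "connected K" "K \<noteq> {}"
    unfolding K_def using p by (auto simp: closed_path_image connected_path_image path_image_nonempty)
  define cc where "cc = (\<lambda>w. connected_component_set (- K) w)"
  have ccU: "cc w \<subseteq> U" "w \<in> cc w" "cc w \<in> components (- K)" if w: "w \<in> U" for w
  proof -
    have wK: "w \<in> - K" using w by (simp add: U_def)
    show 1: "w \<in> cc w" using wK by (simp add: cc_def)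
    show "cc w \<in> components (- K)" unfolding cc_def using wK by (rule componentsI)
    have sub: "cc w \<subseteq> - K" unfolding cc_def by (rule connected_component_subset)
    have "winding_number \<gamma> constant_on cc w"
      by (rule winding_number_constant[OF p loop]) (use sub in \<open>auto simp: cc_def K_def\<close>)
    then obtain k where "\<And>x. x \<in> cc w \<Longrightarrow> winding_number \<gamma> x = k" unfolding constant_on_def by blast
    then show "cc w \<subseteq> U" using 1 w sub by (auto simp: U_def)
  qed
  have "K \<union> U = \<Union> (insert K ((\<lambda>w. K \<union> cc w) ` U))" using ccU by auto
  moreover have "connected (\<Union> (insert K ((\<lambda>w. K \<union> cc w) ` U)))"
  proof (rule connected_Union)
    show "connected S" if "S \<in> insert K ((\<lambda>w. K \<union> cc w) ` U)" for S
      using that K ccU(3) connected_Un_component_complement[OF K] by auto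
    show "\<Inter> (insert K ((\<lambda>w. K \<union> cc w) ` U)) \<noteq> {}" using K(3) by auto
  qed
  ultimately show ?thesis unfolding K_def U_def by simp
qed

section \<open>The image of the circle and its winding number\<close>

context toeplitz_symbol
begin

text \<open>Parametrised over \<open>[0, 1]\<close>, as paths are, and written as in the final
  statement so that the two curves can be identified.\<close>

definition \<gamma> :: "real \<Rightarrow> complex" where
  "\<gamma> \<tau> = \<phi> (exp (complex_of_real (2 * pi * \<tau>) * \<i>))"

lemma gamma_eq: "\<gamma> = \<phi> \<circ> circlepath 0 1"
  by (rule ext) (simp add: \<gamma>_def circlepath mult_ac)

lemma phi_unit: "cmod z = 1 \<Longrightarrow> \<phi> z - w = cnj z * q z"
proof -
  assume "cmod z = 1"
  then have "cnj z * z = 1" using complex_norm_square[of z] by (simp add: mult.commute)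
  then have "cnj z * q z = cnj z + p z" by (simp add: q_def distrib_left mult.assoc[symmetric])
  then show ?thesis by (simp add: \<phi>_def p_def)
qed

lemma mem_path_image_gamma: "w \<in> path_image \<gamma> \<longleftrightarrow> cmod r = 1 \<or> cmod s = 1 \<or> cmod t = 1"
proof -
  have "path_image \<gamma> = \<phi> ` sphere 0 1"
    unfolding gamma_eq path_image_compose by simp
  moreover have "\<phi> z = w \<longleftrightarrow> q z = 0" if "cmod z = 1" for z
  proof -
    have "z \<noteq> 0" using that by auto
    then show ?thesis using phi_unit[OF that] by auto
  qed
  ultimately have "w \<in> path_image \<gamma> \<longleftrightarrow> (\<exists>z. cmod z = 1 \<and> q z = 0)" by force
  then show ?thesis by (auto simp: q_eq_0_iff)
qed

lemma gamma_loop: "path \<gamma>" "pathfinish \<gamma> = pathstart \<gamma>"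
proof -
  show "path \<gamma>" unfolding gamma_eq
    by (intro path_continuous_image) (auto simp: phi_eq intro!: continuous_intros)
  show "pathfinish \<gamma> = pathstart \<gamma>"
    unfolding gamma_eq pathfinish_compose pathstart_compose by simp
qed

text \<open>The argument principle carried out for one rational function: the logarithmic derivative
  of \<open>q z / z\<close> is \<open>L\<close>, whose first three terms count the roots in the disk
  and whose last term contributes -1.\<close>

lemma winding_number_gamma:
  assumes "cmod r \<noteq> 1" "cmod s \<noteq> 1" "cmod t \<noteq> 1"
  shows "winding_number \<gamma> w = (if cmod r < 1 then 1 else 0) + (if cmod s < 1 then 1 else 0) + (if cmod t < 1 then 1 else 0) - 1"
proof -
  define c1 where "c1 = circlepath 0 1"
  define L where "L = (\<lambda>z. 1 / (z - r) + 1 / (z - s) + 1 / (z - t) - 1 / (z - 0))"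
  \<comment> \<open>\<open>\<phi>\<close> is not holomorphic, but on the circle
    \<open>cnj z = 1 / z\<close>, so there it agrees with the rational function \<open>F\<close>, to
    which the chain rule applies.\<close>
  define F where "F = (\<lambda>z. w + a * (z - r) * (z - s) * (z - t) / z)"
  have unit: "cmod (c1 x) = 1" for x by (simp add: c1_def circlepath norm_mult)
  have c1ne: "c1 x - r \<noteq> 0" "c1 x - s \<noteq> 0" "c1 x - t \<noteq> 0" "c1 x \<noteq> 0" for x
    using unit[of x] assms by auto
  have \<gamma>F: "\<gamma> = F \<circ> c1"
  proof
    fix x
    have "cnj (c1 x) = 1 / c1 x"
      using unit[of x] c1ne[of x] complex_norm_square[of "c1 x"] by (simp add: field_simps)
    moreover have "\<gamma> x - w = cnj (c1 x) * q (c1 x)"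
      using phi_unit[OF unit[of x]] by (simp add: gamma_eq c1_def)
    ultimately have "\<gamma> x - w = q (c1 x) / c1 x" by simp
    then show "\<gamma> x = (F \<circ> c1) x" by (simp add: F_def q_factor algebra_simps)
  qed
  have dF: "(F has_field_derivative (F z - w) * L z) (at z)" if "z - r \<noteq> 0" "z - s \<noteq> 0" "z - t \<noteq> 0" "z \<noteq> 0" for z
  proof -
    have "(F has_field_derivative
       (a * ((z - s) * (z - t) + (z - r) * (z - t) + (z - r) * (z - s)) * z - a * (z - r) * (z - s) * (z - t)) / (z * z)) (at z)"
      unfolding F_def using that by (auto intro!: derivative_eq_intros simp: algebra_simps)
    moreover have "(a * ((z - s) * (z - t) + (z - r) * (z - t) + (z - r) * (z - s)) * z - a * (z - r) * (z - s) * (z - t)) / (z * z) = (F z - w) * L z"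
    proof -
      have gen: "(a * (y * v + x * v + x * y) * z - a * x * y * v) / (z * z) = a * x * y * v / z * (1 / x + 1 / y + 1 / v - 1 / z)"
        if "x \<noteq> 0" "y \<noteq> 0" "v \<noteq> 0" "z \<noteq> 0" for x y v z :: complex
        using that by (simp add: field_simps)
      show ?thesis unfolding F_def L_def using gen[OF that] by simp
    qed
    ultimately show ?thesis by simp
  qed
  have vc: "(c1 has_vector_derivative vector_derivative c1 (at x within {0..1})) (at x within {0..1})" if "x \<in> {0..1}" for x
  proof -
    have "c1 differentiable (at x within {0..1})"
      unfolding c1_def circlepath_def by (intro differentiableI_vector) (rule has_vector_derivative_circlepath[unfolded circlepath_def])
    then show ?thesis by (simp add: vector_derivative_works)
  qed
  have v\<gamma>: "vector_derivative \<gamma> (at x within {0..1}) = vector_derivative c1 (at x within {0..1}) * ((\<gamma> x - w) * L (c1 x))"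
    if x: "x \<in> {0..1}" for x
  proof -
    have "(\<gamma> has_vector_derivative vector_derivative c1 (at x within {0..1}) * ((F (c1 x) - w) * L (c1 x))) (at x within {0..1})"
      unfolding \<gamma>F
      by (rule field_vector_diff_chain_within[OF vc[OF x] has_field_derivative_at_within[OF dF]]) (use c1ne in auto)
    from vector_derivative_within_closed_interval[OF zero_less_one x this] show ?thesis
      by (simp add: \<gamma>F)
  qed
  have wn: "w \<notin> path_image \<gamma>" using mem_path_image_gamma assms by simp
  have vp: "valid_path \<gamma>"
    unfolding \<gamma>F
  proof (rule valid_path_compose_holomorphic[of _ _ "- {0}"])
    show "F holomorphic_on - {0}" unfolding F_def by (intro holomorphic_intros) auto
  qed (auto simp: c1_def)
  have ci: "((\<lambda>z. 1 / (z - x)) has_contour_integral (2 * pi * \<i> * (if cmod x < 1 then 1 else 0))) c1" if "cmod x \<noteq> 1" for x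
    using has_contour_integral_winding_number[of c1 x] that winding_number_unit_circle[OF that] by (simp add: c1_def)
  have "(L has_contour_integral (2 * pi * \<i> * (if cmod r < 1 then 1 else 0) + 2 * pi * \<i> * (if cmod s < 1 then 1 else 0)
      + 2 * pi * \<i> * (if cmod t < 1 then 1 else 0) - 2 * pi * \<i> * (if cmod 0 < 1 then 1 else 0))) c1"
    unfolding L_def by (intro has_contour_integral_add has_contour_integral_diff ci assms) auto
  \<comment> \<open>Change of variables: along the parameter interval the integrand of
    \<open>L\<close> on the circle equals that of \<open>1 / (z - w)\<close> on
    \<open>\<gamma>\<close>.\<close>
  then have "((\<lambda>z. 1 / (z - w)) has_contour_integral (2 * pi * \<i> * (if cmod r < 1 then 1 else 0) + 2 * pi * \<i> * (if cmod s < 1 then 1 else 0)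
      + 2 * pi * \<i> * (if cmod t < 1 then 1 else 0) - 2 * pi * \<i> * (if cmod 0 < 1 then 1 else 0))) \<gamma>"
    unfolding has_contour_integral_def
  proof (rule has_integral_eq[rotated])
    fix x :: real assume x: "x \<in> {0..1}"
    have "\<gamma> x - w \<noteq> 0" using wn x by (auto simp: path_image_def)
    then show "L (c1 x) * vector_derivative c1 (at x within {0..1}) = 1 / (\<gamma> x - w) * vector_derivative \<gamma> (at x within {0..1})"
      unfolding v\<gamma>[OF x] by simp
  qed
  from contour_integral_unique[OF this] show ?thesis
    unfolding winding_number_valid_path[OF vp wn] by (simp add: field_simps)
qed

lemma circle_root_factor:
  assumes "cmod r = 1 \<or> cmod s = 1 \<or> cmod t = 1"
  obtains (that') \<rho> u where "cmod \<rho> = 1" "\<And>z. q z = (z - \<rho>) * u z" "u holomorphic_on UNIV"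
proof -
  have *: thesis if "cmod x = 1" "\<And>z. q z = (z - x) * (a * (z - y) * (z - v))" for x y v
    by (rule that'[OF that]) (intro holomorphic_intros)
  show thesis
    using assms
  proof (elim disjE)
    assume "cmod r = 1" then show thesis by (rule *[of r s t]) (simp add: q_factor mult_ac)
  next
    assume "cmod s = 1" then show thesis by (rule *[of s r t]) (simp add: q_factor mult_ac)
  next
    assume "cmod t = 1" then show thesis by (rule *[of t r s]) (simp add: q_factor mult_ac)
  qed
qed

text \<open>Off the curve the winding number is the number of roots in the disk minus 1; with sorted
  moduli it vanishes exactly when the disk contains the first root and no other.\<close>

lemma winding_set_iff:
  assumes "cmod r \<le> cmod s" "cmod s \<le> cmod t"
  shows "w \<in> path_image \<gamma> \<union> {w. w \<notin> path_image \<gamma> \<and> winding_number \<gamma> w \<noteq> 0} \<longleftrightarrow> \<not> (cmod r < 1 \<and> 1 < cmod s)"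
proof (cases "w \<in> path_image \<gamma>")
  case True
  then show ?thesis using mem_path_image_gamma assms by auto
next
  case False
  then have "cmod r \<noteq> 1" "cmod s \<noteq> 1" "cmod t \<noteq> 1" using mem_path_image_gamma by auto
  then show ?thesis using False winding_number_gamma assms by auto
qed

text \<open>With sorted moduli the negated condition splits into three cases: a root on the circle,
  at least two roots in the disk, or all roots outside the closed disk.\<close>

lemma spectrum_iff:
  assumes "cmod r \<le> cmod s" "cmod s \<le> cmod t"
  shows bergman_spectrum_iff: "w \<in> op_spectrum bergman_space disk_norm (=) (bergman_toeplitz \<phi>) \<longleftrightarrow> \<not> (cmod r < 1 \<and> 1 < cmod s)"
    and hardy_spectrum_iff: "w \<in> op_spectrum hardy_H2 circle_norm circle_ae_eq (hardy_toeplitz \<phi>) \<longleftrightarrow> \<not> (cmod r < 1 \<and> 1 < cmod s)"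
proof -
  have "w \<in> op_spectrum bergman_space disk_norm (=) (bergman_toeplitz \<phi>) \<and>
      w \<in> op_spectrum hardy_H2 circle_norm circle_ae_eq (hardy_toeplitz \<phi>)" if ns: "\<not> (cmod r < 1 \<and> 1 < cmod s)"
  proof (cases "cmod r = 1 \<or> cmod s = 1 \<or> cmod t = 1")
    case True
    obtain \<rho> u where u: "cmod \<rho> = 1" "\<And>z. q z = (z - \<rho>) * u z" "u holomorphic_on UNIV"
      using circle_root_factor[OF True] by metis
    show ?thesis
      using bergman_spectrum_circle[OF u] hardy_spectrum_circle[OF u(1,2) holomorphic_on_imp_continuous_on[OF u(3)]] by simp
  next
    case False
    show ?thesis
    proof (cases "cmod r < 1")
      case True
      then have "cmod s < 1" using ns False by auto
      with True show ?thesis using bergman_spectrum_inner hardy_spectrum_inner by simp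
    next
      case rge: False
      then have "cmod r > 1" using False by auto
      then show ?thesis using bergman_spectrum_outer hardy_spectrum_outer assms by simp
    qed
  qed
  moreover have "w \<notin> op_spectrum bergman_space disk_norm (=) (bergman_toeplitz \<phi>) \<and>
      w \<notin> op_spectrum hardy_H2 circle_norm circle_ae_eq (hardy_toeplitz \<phi>)" if "cmod r < 1 \<and> 1 < cmod s"
    using that assms bergman_resolvent hardy_resolvent by simp
  ultimately show "w \<in> op_spectrum bergman_space disk_norm (=) (bergman_toeplitz \<phi>) \<longleftrightarrow> \<not> (cmod r < 1 \<and> 1 < cmod s)"
    "w \<in> op_spectrum hardy_H2 circle_norm circle_ae_eq (hardy_toeplitz \<phi>) \<longleftrightarrow> \<not> (cmod r < 1 \<and> 1 < cmod s)"
    by blast+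
qed

end

theorem theorem3p1:
  fixes a b c :: complex
  assumes "a \<noteq> 0"
  defines "\<phi> \<equiv> (\<lambda>z::complex. cnj z + (a * z\<^sup>2 + b * z + c))"
  defines "\<gamma> \<equiv> (\<lambda>t::real. \<phi> (exp (complex_of_real (2 * pi * t) * \<i>)))"
  defines "\<Sigma> \<equiv> path_image \<gamma> \<union> {w. w \<notin> path_image \<gamma> \<and> winding_number \<gamma> w \<noteq> 0}"
  shows "op_spectrum bergman_space disk_norm (=) (bergman_toeplitz \<phi>) = \<Sigma> \<and>
         op_spectrum hardy_H2 circle_norm circle_ae_eq (hardy_toeplitz \<phi>) = \<Sigma> \<and>
         connected (op_spectrum bergman_space disk_norm (=) (bergman_toeplitz \<phi>))"
proof -
  have main: "(w \<in> op_spectrum bergman_space disk_norm (=) (bergman_toeplitz \<phi>) \<longleftrightarrow> w \<in> \<Sigma>) \<and>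
      (w \<in> op_spectrum hardy_H2 circle_norm circle_ae_eq (hardy_toeplitz \<phi>) \<longleftrightarrow> w \<in> \<Sigma>) \<and>
      path \<gamma> \<and> pathfinish \<gamma> = pathstart \<gamma>" for w
  proof -
    obtain r s t where o: "cmod r \<le> cmod s" "cmod s \<le> cmod t"
      and f: "\<And>z. 1 + z * (a * z\<^sup>2 + b * z + (c - w)) = a * (z - r) * (z - s) * (z - t)"
      using cubic_factor[OF assms(1), of b "c - w"] by metis
    \<comment> \<open>The roots depend on \<open>w\<close>, so the locale is interpreted separately
      for each \<open>w\<close>; its symbol and curve are the same for all of them.\<close>
    interpret T: toeplitz_symbol a b c w r s t
      by standard (use assms(1) f in auto)
    have "T.\<phi> = \<phi>" unfolding T.phi_eq \<phi>_def ..
    then have "T.\<gamma> = \<gamma>" unfolding T.\<gamma>_def \<gamma>_def by simp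
    then show ?thesis
      using T.bergman_spectrum_iff[OF o] T.hardy_spectrum_iff[OF o] T.winding_set_iff[OF o] T.gamma_loop \<open>T.\<phi> = \<phi>\<close>
      unfolding \<Sigma>_def by simp
  qed
  have 1: "op_spectrum bergman_space disk_norm (=) (bergman_toeplitz \<phi>) = \<Sigma>"
    and 2: "op_spectrum hardy_H2 circle_norm circle_ae_eq (hardy_toeplitz \<phi>) = \<Sigma>"
    using main by blast+
  have "connected \<Sigma>" unfolding \<Sigma>_def using main by (intro connected_winding_set) auto
  with 1 2 show ?thesis by simp
qed
end
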